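(* Let $(X,\mathcal{A})$ be a compact $p$-adic analytic manifold with finite equalising atlas $\mathcal{A}$ with connected nerve graph and compact chart domains, $\omega$ a nowhere vanishing analytic differential $n$-form on $X$ and $\mu_X=|\omega|$. Let $s\in\mathbb{R}$ and $$\Delta^s h(x)=\int_X d_g(x,y)^{-s}\,(h(x)-h(y))\,|\omega(y)|.$$ The Hilbert space $L^2(X,\mu_X)_w$ has an orthonormal basis of eigenfunctions of $\Delta^s$ consisting of wavelets on $X$. Each eigenvalue has only finite multiplicity.
   Context: $K$ is a non-archimedean local field of residue characteristic $p$, with ring of integers $O_K$ and uniformiser $\pi$; $K^n$ carries the maximum norm and Haar measure $|dx|$. A $p$-adic analytic manifold $(X,\mathcal{A})$ of dimension $n$ is a Hausdorff space $X$ with an atlas $\mathcal{A}$ of charts $(U_\alpha,\phi_\alpha)$, $\phi_\alpha\colon U_\alpha\to K^n$ homeomorphisms onto open subsets, with bi-analytic transition maps $\tau_{\alpha\beta}\colon\phi_\alpha(U_\alpha\cap U_\beta)\to\phi_\beta(U_\alpha\cap U_\beta)$. For a locally bi-analytic map $F$ between open subsets of $K^n$, $e(F)$ is the smallest $N\in\mathbb{Z}$ such that $F$ takes balls of radius $p^{-N}$ to balls of the same radius, and $e(F)=-\infty$ if there is none. $\mathcal{A}$ is equalising if $\sup_{\alpha,\beta} e(\tau_{\alpha\beta})\ne-\infty$. Distinct charts are assumed to have distinct domains. Measure: in a chart write $\omega=f_\alpha\,dx_1\wedge\dots\wedge dx_n$ with $f_\alpha$ analytic; then $\mu_X(A)=\int_{\phi_\alpha(A)}|f_\alpha|\,|dx|$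 for measurable $A\subseteq U_\alpha$. Nerve complex $N(\mathcal{A})$: its $k$-simplices are the non-empty intersections $U_J=\bigcap_{j\in J}U_j$ of chart domains with $|J|=k+1$; $U_J$ is a facet of $U_{J'}$ if $J\subset J'$. Simplices are identified with the corresponding subsets of $X$. The nerve graph is its $1$-skeleton. Ball: a set $B\subseteq X$ contained in a chart domain is a ball if for each chart $(U_\alpha,\phi_\alpha)$ with $B\subseteq U_\alpha$ the set $\phi_\alpha(B)$ is a ball in $K^n$, and for any two charts with $B\subseteq U_\alpha\cap U_\beta$, $\tau_{\alpha\beta}$ takes $\phi_\alpha(B)$ to the ball $\phi_\beta(B)$ of equal radius. Join: $x\wedge y=\bigcap B$ over all balls $B\subseteq X$ containing $x$ and $y$, if such balls exist; otherwise undefined. Geodetic distance $d_g$: $d_g(x,y)=\mu_X(x\wedge y)$ if $x,y$ lie in a common ball in $X$, and otherwise $d_g(x,y)=\min_{\gamma\colon\sigma(x)\leadsto\sigma(y)}\mu_X(U_\gamma(x,y))$. Here $\sigma(x)$ is the highest-dimensional simplex of $N(\mathcal{A})$ containing $x$, $\gamma$ is a path in $N(\mathcal{A})$ from $\sigma(x)$ to $\sigma(y)$ through a sequence of adjacent faces of higher or lower dimension (of two consecutive simplices one is a facet of the other), and $U_\gamma(x,y)=\bigcup_{\sigma\in\gamma}\sigma\subseteq X$. Wavelet: a function $\psi\colon X\to\mathbb{C}$ supported on a ball $B(a)\subseteq X$ with $a\in X$ such that for any chart $(U_\alpha,\phi_\alpha)$ containing $B(a)$, the function $\psi_\alpha=\psi\circ\phi_\alpha^{-1}$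 is a Kozyrev wavelet supported in a ball centred in $\phi_\alpha(a)\in K^n$. A Kozyrev wavelet supported on $b+\pi^mO_K^n$ is a constant multiple of $z\mapsto\chi(\pi^{-m-1}\,\eta\cdot z)\,1_{b+\pi^mO_K^n}(z)$, where $\chi$ is a fixed additive character of $K$ trivial on $O_K$ and non-trivial on $\pi^{-1}O_K$, and $\eta\in O_K^n$ represents a non-zero class in $(O_K/\pi O_K)^n$; on $X$, wavelets are normalised to have norm $1$ in $L^2(X,\mu_X)$. $L^2(X,\mu_X)_w$ is the closure in $L^2(X,\mu_X)$ of the span of the wavelets on $X$ with supports so small that they do not overlap (i.e. of radius so small that two supports never partially overlap: they are disjoint or nested). $\mathcal{D}(X)$ is the space of locally constant functions $X\to\mathbb{C}$ with compact support; $\Delta^s$ is densely defined on $L^2(X,\mu_X)_w$ with dense domain $\mathcal{D}(X)_w=\mathcal{D}(X)\cap L^2(X,\mu_X)_w$.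
   Formalization: Finite multiplicity is claimed only for s ≠ 0: for s = 0 all small wavelets are eigenfunctions for the one eigenvalue μ_X(X). The wavelets spanning L²(X,μ_X)_w are those of radius at most R, for every sufficiently small R, since large wavelets may have non-zero mean. *)

theory Defs
  imports "HOL-Analysis.Analysis" "HOL-Computational_Algebra.Primes"
begin

section \<open>Non-archimedean local fields and their coordinate spaces\<close>

text \<open>
  A non-archimedean local field with its normalised absolute value: the ring of integers is
  compact, the value group is discrete and non-trivial, and a uniformiser has absolute value
  \<open>1/q\<close>, where \<open>q\<close> is the number of residue classes of the ring of integers modulo its
  maximal ideal. With this normalisation \<open>|det|\<close> is the factor by which linear maps scale the Haar
  measure, so that the measure of a differential form does not depend on the chart.
\<close>

class nonarch_local_field = field + metric_space +
  fixes absv :: "'a \<Rightarrow> real"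
  assumes dist_absv: "dist x y = absv (x - y)"
    and absv_mult: "absv (x * y) = absv x * absv y"
    and absv_ultrametric: "absv (x + y) \<le> max (absv x) (absv y)"
    and compact_integers: "compact {x. absv x \<le> 1}"
    and absv_normalised: "\<exists>\<pi>. \<pi> \<noteq> 0 \<and> absv \<pi> < 1 \<and> (\<forall>x. absv x < 1 \<longrightarrow> absv x \<le> absv \<pi>) \<and>
          absv \<pi> = 1 / real (card ((\<lambda>x. {y. absv (y - x) < 1}) ` {x. absv x \<le> 1}))"

definition uniformiser :: "'k::nonarch_local_field \<Rightarrow> bool" where
  "uniformiser \<pi> \<longleftrightarrow> \<pi> \<noteq> 0 \<and> absv \<pi> < 1 \<and> (\<forall>x::'k. absv x < 1 \<longrightarrow> absv x \<le> absv \<pi>)"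

definition residue_characteristic :: "'k::nonarch_local_field itself \<Rightarrow> nat \<Rightarrow> bool" where
  "residue_characteristic _ p \<longleftrightarrow> prime p \<and> absv (of_nat p :: 'k) < 1"

text \<open>
  The metric of the library on \<open>'k ^ 'n\<close> is the Euclidean one. It is only used for the topology;
  balls are those of the maximum norm.
\<close>

definition maxnorm :: "'k::nonarch_local_field ^ 'n \<Rightarrow> real" where
  "maxnorm z = Max (range (\<lambda>i. absv (z $ i)))"

definition kball :: "'k::nonarch_local_field ^ 'n \<Rightarrow> real \<Rightarrow> ('k ^ 'n) set" where
  "kball c r = {z. maxnorm (z - c) \<le> r}"

definition haar_measure :: "('k::nonarch_local_field ^ 'n) measure \<Rightarrow> bool" where
  "haar_measure \<nu> \<longleftrightarrow> sets \<nu> = sets borel \<and>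
     (\<forall>a. \<forall>S \<in> sets borel. emeasure \<nu> ((\<lambda>z. a + z) ` S) = emeasure \<nu> S) \<and>
     (\<forall>C. compact C \<longrightarrow> emeasure \<nu> C < \<infinity>) \<and> emeasure \<nu> UNIV \<noteq> 0"

definition kanalytic_on :: "('k::nonarch_local_field ^ 'n) set \<Rightarrow> ('k ^ 'n \<Rightarrow> 'k) \<Rightarrow> bool" where
  "kanalytic_on D f \<longleftrightarrow> (\<forall>c \<in> D. \<exists>r > 0. kball c r \<subseteq> D \<and>
     (\<exists>a :: ('n \<Rightarrow> nat) \<Rightarrow> 'k. \<forall>z \<in> kball c r.
        ((\<lambda>m. a m * (\<Prod>i\<in>UNIV. (z $ i - c $ i) ^ m i)) has_sum f z) UNIV))"

definition kanalytic_map_on ::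
    "('k::nonarch_local_field ^ 'n) set \<Rightarrow> ('k ^ 'n \<Rightarrow> 'k ^ 'n) \<Rightarrow> bool" where
  "kanalytic_map_on D F \<longleftrightarrow> (\<forall>j. kanalytic_on D (\<lambda>z. F z $ j))"

definition has_jacobian ::
    "('k::nonarch_local_field ^ 'n \<Rightarrow> 'k ^ 'n) \<Rightarrow> 'k ^ 'n ^ 'n \<Rightarrow> 'k ^ 'n \<Rightarrow> bool" where
  "has_jacobian F L z \<longleftrightarrow> (\<forall>\<epsilon> > 0. \<exists>\<delta> > 0. \<forall>h. maxnorm h \<le> \<delta> \<longrightarrow>
     maxnorm (F (z + h) - F z - L *v h) \<le> \<epsilon> * maxnorm h)"

text \<open>
  The condition that \<open>D\<close> contains some ball of radius \<open>p powi (-N)\<close> excludes those \<open>N\<close> for which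
  \<open>F\<close> takes balls of this radius to balls only because there are none. Without it a map between
  bounded sets would never have a smallest \<open>N\<close>.
\<close>

definition preserves_balls ::
    "('k::nonarch_local_field ^ 'n) set \<Rightarrow> ('k ^ 'n \<Rightarrow> 'k ^ 'n) \<Rightarrow> real \<Rightarrow> bool" where
  "preserves_balls D F r \<longleftrightarrow> (\<exists>c. kball c r \<subseteq> D) \<and>
     (\<forall>c. kball c r \<subseteq> D \<longrightarrow> (\<exists>c'. F ` kball c r = kball c' r))"

definition ball_exponent ::
    "nat \<Rightarrow> ('k::nonarch_local_field ^ 'n) set \<Rightarrow> ('k ^ 'n \<Rightarrow> 'k ^ 'n) \<Rightarrow> ereal" where
  "ball_exponent p D F =
     (let E = {N :: int. preserves_balls D F (real p powi (- N))}
      in if E \<noteq> {} \<and> bdd_below E then ereal (real_of_int (Inf E)) else - \<infinity>)"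


section \<open>Analytic manifolds\<close>

text \<open>
  A chart is a pair of its domain and its coordinate map. The values of the coordinate map
  outside the domain are irrelevant: since distinct charts have distinct domains, they do not
  give rise to further charts.
\<close>

type_synonym ('a, 'k, 'n) chart = "'a set \<times> ('a \<Rightarrow> 'k ^ 'n)"

abbreviation cdom :: "('a, 'k, 'n) chart \<Rightarrow> 'a set" where
  "cdom \<equiv> fst"

abbreviation cmap :: "('a, 'k, 'n) chart \<Rightarrow> 'a \<Rightarrow> 'k ^ 'n" where
  "cmap \<equiv> snd"

definition transition :: "('a, 'k, 'n) chart \<Rightarrow> ('a, 'k, 'n) chart \<Rightarrow> 'k ^ 'n \<Rightarrow> 'k ^ 'n" where
  "transition \<alpha> \<beta> = cmap \<beta> \<circ> inv_into (cdom \<alpha>) (cmap \<alpha>)"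

abbreviation overlap :: "('a, 'k, 'n) chart \<Rightarrow> ('a, 'k, 'n) chart \<Rightarrow> ('k ^ 'n) set" where
  "overlap \<alpha> \<beta> \<equiv> cmap \<alpha> ` (cdom \<alpha> \<inter> cdom \<beta>)"

text \<open>
  The manifold is the whole type \<open>'a\<close>. Transition maps are bi-analytic because the condition is
  imposed on both \<open>(\<alpha>, \<beta>)\<close> and \<open>(\<beta>, \<alpha>)\<close>.
\<close>

definition analytic_atlas :: "('a::t2_space, 'k::nonarch_local_field, 'n::finite) chart set \<Rightarrow> bool"
  where
  "analytic_atlas \<A> \<longleftrightarrow>
     (\<Union>\<alpha>\<in>\<A>. cdom \<alpha>) = UNIV \<and> inj_on cdom \<A> \<and>
     (\<forall>\<alpha>\<in>\<A>. open (cdom \<alpha>) \<and> open (cmap \<alpha> ` cdom \<alpha>) \<and>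
        (\<exists>g. homeomorphism (cdom \<alpha>) (cmap \<alpha> ` cdom \<alpha>) (cmap \<alpha>) g)) \<and>
     (\<forall>\<alpha>\<in>\<A>. \<forall>\<beta>\<in>\<A>. kanalytic_map_on (overlap \<alpha> \<beta>) (transition \<alpha> \<beta>))"

definition equalising ::
    "nat \<Rightarrow> ('a::t2_space, 'k::nonarch_local_field, 'n::finite) chart set \<Rightarrow> bool" where
  "equalising p \<A> \<longleftrightarrow>
     (SUP (\<alpha>, \<beta>) \<in> \<A> \<times> \<A>. ball_exponent p (overlap \<alpha> \<beta>) (transition \<alpha> \<beta>)) \<noteq> - \<infinity>"

text \<open>A differential form of top degree, given by its coefficient functions in the charts.\<close>

definition analytic_form :: "('a::t2_space, 'k::nonarch_local_field, 'n::finite) chart set \<Rightarrow>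
    (('a, 'k, 'n) chart \<Rightarrow> 'k ^ 'n \<Rightarrow> 'k) \<Rightarrow> bool" where
  "analytic_form \<A> \<omega> \<longleftrightarrow>
     (\<forall>\<alpha>\<in>\<A>. kanalytic_on (cmap \<alpha> ` cdom \<alpha>) (\<omega> \<alpha>)) \<and>
     (\<forall>\<alpha>\<in>\<A>. \<forall>\<beta>\<in>\<A>. \<forall>z \<in> overlap \<alpha> \<beta>. \<forall>L. has_jacobian (transition \<alpha> \<beta>) L z \<longrightarrow>
        \<omega> \<alpha> z = \<omega> \<beta> (transition \<alpha> \<beta> z) * det L)"

definition nowhere_vanishing :: "('a::t2_space, 'k::nonarch_local_field, 'n::finite) chart set \<Rightarrow>
    (('a, 'k, 'n) chart \<Rightarrow> 'k ^ 'n \<Rightarrow> 'k) \<Rightarrow> bool" where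
  "nowhere_vanishing \<A> \<omega> \<longleftrightarrow> (\<forall>\<alpha>\<in>\<A>. \<forall>z \<in> cmap \<alpha> ` cdom \<alpha>. \<omega> \<alpha> z \<noteq> 0)"

text \<open>\<open>\<mu>\<close> is the measure \<open>|\<omega>|\<close>; it is uniquely determined by this property.\<close>

definition form_measure :: "('k ^ 'n) measure \<Rightarrow>
    ('a::t2_space, 'k::nonarch_local_field, 'n::finite) chart set \<Rightarrow>
    (('a, 'k, 'n) chart \<Rightarrow> 'k ^ 'n \<Rightarrow> 'k) \<Rightarrow> 'a measure \<Rightarrow> bool" where
  "form_measure \<nu> \<A> \<omega> \<mu> \<longleftrightarrow> sets \<mu> = sets borel \<and>
     (\<forall>\<alpha>\<in>\<A>. \<forall>S \<in> sets borel. S \<subseteq> cdom \<alpha> \<longrightarrow>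
        emeasure \<mu> S = (\<integral>\<^sup>+z \<in> cmap \<alpha> ` S. ennreal (absv (\<omega> \<alpha> z)) \<partial>\<nu>))"


section \<open>Nerve complex, balls and the geodetic distance\<close>

text \<open>
  Simplices are represented by their vertex sets \<open>J\<close>; the corresponding subset of the manifold
  is \<open>U\<^sub>J\<close>. If \<open>U\<^sub>J = U\<^sub>J'\<close> for distinct \<open>J\<close> and \<open>J'\<close>, then \<open>J \<union> J'\<close> is a simplex with the same
  subset, so that passing from \<open>J\<close> to \<open>J'\<close> does not change the set swept out by a path.
\<close>

definition simplex_set :: "('a, 'k, 'n) chart set \<Rightarrow> 'a set" where
  "simplex_set J = (\<Inter>\<alpha>\<in>J. cdom \<alpha>)"

definition nerve :: "('a, 'k, 'n) chart set \<Rightarrow> ('a, 'k, 'n) chart set set" where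
  "nerve \<A> = {J. J \<subseteq> \<A> \<and> finite J \<and> J \<noteq> {} \<and> simplex_set J \<noteq> {}}"

definition connected_nerve_graph :: "('a, 'k, 'n) chart set \<Rightarrow> bool" where
  "connected_nerve_graph \<A> \<longleftrightarrow> (\<forall>\<alpha> \<beta>. {\<alpha>} \<in> nerve \<A> \<and> {\<beta>} \<in> nerve \<A> \<longrightarrow>
     (\<alpha>, \<beta>) \<in> {(\<alpha>', \<beta>'). {\<alpha>', \<beta>'} \<in> nerve \<A>}\<^sup>*)"

definition top_simplex :: "('a, 'k, 'n) chart set \<Rightarrow> 'a \<Rightarrow> ('a, 'k, 'n) chart set" where
  "top_simplex \<A> x = (ARG_MAX card J. J \<in> nerve \<A> \<and> x \<in> simplex_set J)"

definition nerve_path :: "('a, 'k, 'n) chart set \<Rightarrow> ('a, 'k, 'n) chart set \<Rightarrow>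
    ('a, 'k, 'n) chart set \<Rightarrow> ('a, 'k, 'n) chart set list \<Rightarrow> bool" where
  "nerve_path \<A> \<sigma> \<sigma>' \<gamma> \<longleftrightarrow> \<gamma> \<noteq> [] \<and> hd \<gamma> = \<sigma> \<and> last \<gamma> = \<sigma>' \<and> set \<gamma> \<subseteq> nerve \<A> \<and>
     (\<forall>i. Suc i < length \<gamma> \<longrightarrow> \<gamma> ! i \<subset> \<gamma> ! Suc i \<or> \<gamma> ! Suc i \<subset> \<gamma> ! i)"

definition swept_set :: "('a, 'k, 'n) chart set list \<Rightarrow> 'a set" where
  "swept_set \<gamma> = (\<Union>\<sigma> \<in> set \<gamma>. simplex_set \<sigma>)"

text \<open>
  The radius \<open>r\<close> is the same for all charts whose domains contain \<open>B\<close>. It is determined by \<open>B\<close> up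
  to replacing it by a real number which lies between the same two consecutive absolute values, as
  this does not change the sets \<^term>\<open>kball c r\<close>.
\<close>

definition mball_radius ::
    "('a, 'k::nonarch_local_field, 'n::finite) chart set \<Rightarrow> real \<Rightarrow> 'a set \<Rightarrow> bool" where
  "mball_radius \<A> r B \<longleftrightarrow> r > 0 \<and> (\<exists>\<alpha>\<in>\<A>. B \<subseteq> cdom \<alpha>) \<and>
     (\<forall>\<alpha>\<in>\<A>. B \<subseteq> cdom \<alpha> \<longrightarrow> (\<exists>c. cmap \<alpha> ` B = kball c r))"

definition mball :: "('a, 'k::nonarch_local_field, 'n::finite) chart set \<Rightarrow> 'a set \<Rightarrow> bool" where
  "mball \<A> B \<longleftrightarrow> (\<exists>r. mball_radius \<A> r B)"

definition join :: "('a, 'k::nonarch_local_field, 'n::finite) chart set \<Rightarrow> 'a \<Rightarrow> 'a \<Rightarrow> 'a set" where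
  "join \<A> x y = \<Inter> {B. mball \<A> B \<and> x \<in> B \<and> y \<in> B}"

definition geodetic_dist ::
    "('a, 'k::nonarch_local_field, 'n::finite) chart set \<Rightarrow> 'a measure \<Rightarrow> 'a \<Rightarrow> 'a \<Rightarrow> real" where
  "geodetic_dist \<A> \<mu> x y =
     (if \<exists>B. mball \<A> B \<and> x \<in> B \<and> y \<in> B then measure \<mu> (join \<A> x y)
      else Min {measure \<mu> (swept_set \<gamma>) | \<gamma>. nerve_path \<A> (top_simplex \<A> x) (top_simplex \<A> y) \<gamma>})"

definition geodetic_laplacian :: "('a, 'k::nonarch_local_field, 'n::finite) chart set \<Rightarrow>
    'a measure \<Rightarrow> real \<Rightarrow> ('a \<Rightarrow> complex) \<Rightarrow> 'a \<Rightarrow> complex" where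
  "geodetic_laplacian \<A> \<mu> s h x =
     (\<integral>y. complex_of_real (geodetic_dist \<A> \<mu> x y powr (- s)) * (h x - h y) \<partial>\<mu>)"


section \<open>The Hilbert space of square-integrable functions\<close>

text \<open>Elements of the Hilbert space are represented by functions.\<close>

definition L2 :: "'a measure \<Rightarrow> ('a \<Rightarrow> complex) set" where
  "L2 \<mu> = {h \<in> borel_measurable \<mu>. integrable \<mu> (\<lambda>x. (cmod (h x))\<^sup>2)}"

definition l2_inner :: "'a measure \<Rightarrow> ('a \<Rightarrow> complex) \<Rightarrow> ('a \<Rightarrow> complex) \<Rightarrow> complex" where
  "l2_inner \<mu> g h = (\<integral>x. g x * cnj (h x) \<partial>\<mu>)"

definition l2_norm :: "'a measure \<Rightarrow> ('a \<Rightarrow> complex) \<Rightarrow> real" where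
  "l2_norm \<mu> h = sqrt (\<integral>x. (cmod (h x))\<^sup>2 \<partial>\<mu>)"

definition lin_span :: "('a \<Rightarrow> complex) set \<Rightarrow> ('a \<Rightarrow> complex) set" where
  "lin_span W = {\<lambda>x. \<Sum>\<psi>\<in>S. c \<psi> * \<psi> x | S c. finite S \<and> S \<subseteq> W}"

definition l2_closure :: "'a measure \<Rightarrow> ('a \<Rightarrow> complex) set \<Rightarrow> ('a \<Rightarrow> complex) set" where
  "l2_closure \<mu> V = {h \<in> L2 \<mu>. \<forall>\<epsilon> > 0. \<exists>g \<in> V. l2_norm \<mu> (\<lambda>x. h x - g x) < \<epsilon>}"

definition orthonormal_basis ::
    "'a measure \<Rightarrow> ('a \<Rightarrow> complex) set \<Rightarrow> ('a \<Rightarrow> complex) set \<Rightarrow> bool" where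
  "orthonormal_basis \<mu> H \<Psi> \<longleftrightarrow> \<Psi> \<subseteq> L2 \<mu> \<and>
     (\<forall>\<psi>\<in>\<Psi>. \<forall>\<psi>'\<in>\<Psi>. l2_inner \<mu> \<psi> \<psi>' = (if \<psi> = \<psi>' then 1 else 0)) \<and>
     l2_closure \<mu> (lin_span \<Psi>) = H"


section \<open>Wavelets\<close>

definition wavelet_character :: "'k::nonarch_local_field \<Rightarrow> ('k \<Rightarrow> complex) \<Rightarrow> bool" where
  "wavelet_character \<pi> \<theta> \<longleftrightarrow> (\<forall>u v. \<theta> (u + v) = \<theta> u * \<theta> v) \<and> (\<forall>u. cmod (\<theta> u) = 1) \<and>
     (\<forall>u. absv u \<le> 1 \<longrightarrow> \<theta> u = 1) \<and> (\<exists>u. absv u \<le> 1 \<and> \<theta> (u / \<pi>) \<noteq> 1)"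

definition kozyrev_wavelet :: "'k::nonarch_local_field \<Rightarrow> ('k \<Rightarrow> complex) \<Rightarrow> 'k ^ 'n \<Rightarrow> int \<Rightarrow>
    ('k ^ 'n \<Rightarrow> complex) \<Rightarrow> bool" where
  "kozyrev_wavelet \<pi> \<theta> b m k \<longleftrightarrow>
     (\<exists>C \<eta>. (\<forall>i. absv (\<eta> $ i) \<le> 1) \<and> (\<exists>i. \<not> absv (\<eta> $ i) \<le> absv \<pi>) \<and>
        k = (\<lambda>z. C * \<theta> (\<pi> powi (- m - 1) * (\<Sum>i\<in>UNIV. \<eta> $ i * z $ i)) *
                  indicator (kball b (absv \<pi> powi m)) z))"

text \<open>
  The requirement that the ball of the Kozyrev wavelet be the image of \<open>B\<close> makes sure that it is
  not cut off at the boundary of the chart.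
\<close>

definition wavelet_on :: "('a, 'k::nonarch_local_field, 'n::finite) chart set \<Rightarrow> 'a measure \<Rightarrow>
    'k \<Rightarrow> ('k \<Rightarrow> complex) \<Rightarrow> 'a set \<Rightarrow> ('a \<Rightarrow> complex) \<Rightarrow> bool" where
  "wavelet_on \<A> \<mu> \<pi> \<theta> B \<psi> \<longleftrightarrow> mball \<A> B \<and> (\<forall>x. x \<notin> B \<longrightarrow> \<psi> x = 0) \<and>
     (\<exists>a\<in>B. \<forall>\<alpha>\<in>\<A>. B \<subseteq> cdom \<alpha> \<longrightarrow>
        (\<exists>m k. kozyrev_wavelet \<pi> \<theta> (cmap \<alpha> a) m k \<and>
           kball (cmap \<alpha> a) (absv \<pi> powi m) = cmap \<alpha> ` B \<and>
           (\<forall>z \<in> cmap \<alpha> ` cdom \<alpha>. \<psi> (inv_into (cdom \<alpha>) (cmap \<alpha>) z) = k z))) \<and>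
     l2_norm \<mu> \<psi> = 1"

text \<open>
  \<open>R\<close> is the bound on the radii of the supports. It has to be taken small: a wavelet whose support
  is so large that the density of \<open>\<mu>\<close> varies on it need not have integral 0.
\<close>

definition wavelets_upto :: "('a, 'k::nonarch_local_field, 'n::finite) chart set \<Rightarrow> 'a measure \<Rightarrow>
    'k \<Rightarrow> ('k \<Rightarrow> complex) \<Rightarrow> real \<Rightarrow> ('a \<Rightarrow> complex) set" where
  "wavelets_upto \<A> \<mu> \<pi> \<theta> R =
     {\<psi>. \<exists>B r. r \<le> R \<and> mball_radius \<A> r B \<and> wavelet_on \<A> \<mu> \<pi> \<theta> B \<psi>}"

definition no_partial_overlap ::
    "('a, 'k::nonarch_local_field, 'n::finite) chart set \<Rightarrow> real \<Rightarrow> bool" where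
  "no_partial_overlap \<A> R \<longleftrightarrow> (\<forall>B B' r r'. r \<le> R \<and> r' \<le> R \<and>
     mball_radius \<A> r B \<and> mball_radius \<A> r' B' \<longrightarrow> B \<inter> B' = {} \<or> B \<subseteq> B' \<or> B' \<subseteq> B)"

definition L2_wavelet :: "('a, 'k::nonarch_local_field, 'n::finite) chart set \<Rightarrow> 'a measure \<Rightarrow>
    'k \<Rightarrow> ('k \<Rightarrow> complex) \<Rightarrow> real \<Rightarrow> ('a \<Rightarrow> complex) set" where
  "L2_wavelet \<A> \<mu> \<pi> \<theta> R = l2_closure \<mu> (lin_span (wavelets_upto \<A> \<mu> \<pi> \<theta> R))"

definition test_functions :: "('a::topological_space \<Rightarrow> complex) set" where
  "test_functions = {h. (\<forall>x. \<exists>V. open V \<and> x \<in> V \<and> (\<forall>y\<in>V. h y = h x)) \<and>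
     compact (closure {x. h x \<noteq> 0})}"

text \<open>
  The eigenspaces of the operator on \<open>L2_wavelet\<close> with domain the test functions in it. For
  \<open>s = 0\<close> the operator is \<open>h \<mapsto> \<mu>(X) h - \<integral> h d\<mu>\<close>, so that all wavelets of small support, having
  integral 0, lie in the same eigenspace; it has finite-dimensional eigenspaces only if \<open>s \<noteq> 0\<close>.
\<close>

definition eigenspace :: "('a::t2_space, 'k::nonarch_local_field, 'n::finite) chart set \<Rightarrow>
    'a measure \<Rightarrow> 'k \<Rightarrow> ('k \<Rightarrow> complex) \<Rightarrow> real \<Rightarrow> real \<Rightarrow> complex \<Rightarrow> ('a \<Rightarrow> complex) set" where
  "eigenspace \<A> \<mu> \<pi> \<theta> R s \<kappa> = {h \<in> test_functions \<inter> L2_wavelet \<A> \<mu> \<pi> \<theta> R.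
     AE x in \<mu>. geodetic_laplacian \<A> \<mu> s h x = \<kappa> * h x}"

end

theory Submission
  imports Defs
begin

text \<open>
  At a sufficiently small scale \<open>R\<close> the manifold looks rigid in each of its finitely many charts
  (\<open>fine_atlas\<close>). Chart domains are compact and open, so a ball of radius at most \<open>R\<close> lies in
  every chart that it meets; the absolute value of the density of \<open>\<mu>\<close> is constant on it, so that
  \<open>\<mu>\<close> is a multiple of Haar measure there; and transition maps, being analytic, differ from a linear
  map by an error that is not larger than the distance of the arguments. Two balls of the manifold
  that meet, one of them small, can be compared in one chart and so are nested. This excludes
  partial overlaps.

  \<^emph>\<open>Wavelets are orthogonal or proportional.\<close> Translations by vectors of the ball preserve \<open>\<mu>\<close> and
  multiply an oscillating function by a constant other than 1, so its integral vanishes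
  (\<open>integral_oscillating\<close>). This gives the mean zero of a wavelet, and the orthogonality of two
  wavelets on one ball with different frequencies modulo the maximal ideal. For nested balls the
  larger wavelet is constant on the support of the smaller one. An orthonormal basis results from
  choosing one wavelet in each class of proportional ones.

  \<^emph>\<open>Wavelets are eigenfunctions.\<close> Let \<open>\<psi>\<close> be a wavelet on a ball \<open>B\<close>. For a point outside \<open>B\<close>
  the distance to the points of \<open>B\<close> is constant, since every ball that contains this point and
  meets \<open>B\<close> contains all of \<open>B\<close>. For two points of \<open>B\<close> at which \<open>\<psi>\<close> has different values the distance
  is \<open>\<mu>(B)\<close>, since they do not lie in a smaller ball. So \<open>\<psi>\<close> is an eigenfunction, with the eigenvalue
  \<open>\<mu>(B)\<close> to the power \<open>1 - s\<close> plus the integral over the complement of \<open>B\<close> of the distance from a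
  point of \<open>B\<close> to the power \<open>-s\<close> (\<open>laplacian_integrand\<close>).

  \<^emph>\<open>Multiplicities are finite.\<close> Let \<open>s\<close> be different from 0. Three facts on eigenvalues
  suffice. If a ball shrinks, its
  eigenvalue changes strictly monotonically (\<open>eigenvalue_nested_distinct\<close>). If a ball is moved by a
  translation inside a ball of radius \<open>R\<close>, its eigenvalue stays the same (\<open>eigenvalue_translate\<close>).
  And every small ball lies in one of radius \<open>R\<close>: if the transition maps at a point respect one
  small ball, then their linear parts do, and by homogeneity the transition maps respect all balls
  up to radius \<open>R\<close> (\<open>strictly_differentiable_contraction\<close>, \<open>mball_chart_ball\<close>). Since finitely many
  balls have radius \<open>R\<close>, only finitely many balls have a given eigenvalue, and each carries finitely
  many wavelets up to proportionality. Finally an eigenfunction in the domain is a test function.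
  It is constant on all sufficiently small balls, so its wavelet expansion is finite
  (\<open>test_function_expansion\<close>), and by comparison of coefficients it only involves wavelets with
  the same eigenvalue.
\<close>

section \<open>The absolute value and the maximum norm\<close>

lemma absv_eq_0_iff [simp]: "absv (x::'k::nonarch_local_field) = 0 \<longleftrightarrow> x = 0"
proof -
  have "absv x = dist x 0" by (simp add: dist_absv)
  then show ?thesis by simp
qed

lemma absv_0 [simp]: "absv (0::'k::nonarch_local_field) = 0"
  by simp

lemma absv_nonneg [simp]: "0 \<le> absv (x::'k::nonarch_local_field)"
proof -
  have "absv x = dist x 0" by (simp add: dist_absv)
  then show ?thesis by simp
qed

lemma absv_pos_iff [simp]: "0 < absv (x::'k::nonarch_local_field) \<longleftrightarrow> x \<noteq> 0"
  using absv_nonneg[of x] absv_eq_0_iff[of x] by linarith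

lemma absv_1 [simp]: "absv (1::'k::nonarch_local_field) = 1"
  using absv_mult[of 1 "1::'k"] by simp

lemma absv_minus_commute: "absv (x - y) = absv (y - (x::'k::nonarch_local_field))"
  by (simp add: dist_commute flip: dist_absv)

lemma absv_minus [simp]: "absv (- x) = absv (x::'k::nonarch_local_field)"
  using absv_minus_commute[of 0 x] by simp

lemma absv_add_le:
  "absv x \<le> r \<Longrightarrow> absv y \<le> r \<Longrightarrow> absv (x + (y::'k::nonarch_local_field)) \<le> r"
  using absv_ultrametric[of x y] by simp

lemma absv_diff_le:
  "absv x \<le> r \<Longrightarrow> absv y \<le> r \<Longrightarrow> absv (x - (y::'k::nonarch_local_field)) \<le> r"
  using absv_add_le[of x r "- y"] by simp

lemma absv_sum_le:
  fixes f :: "'i \<Rightarrow> 'k::nonarch_local_field"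
  assumes "\<And>i. i \<in> S \<Longrightarrow> absv (f i) \<le> r" "0 \<le> r"
  shows "absv (sum f S) \<le> r"
  using assms by (induction S rule: infinite_finite_induct) (auto intro: absv_add_le)

lemma absv_power: "absv ((x::'k::nonarch_local_field) ^ n) = absv x ^ n"
  by (induction n) (auto simp: absv_mult)

lemma absv_inverse: "absv (inverse (x::'k::nonarch_local_field)) = inverse (absv x)"
proof (cases "x = 0")
  case False
  then have "absv x * absv (inverse x) = 1" by (simp flip: absv_mult)
  then show ?thesis by (metis inverse_unique)
qed simp

lemma absv_divide: "absv ((x::'k::nonarch_local_field) / y) = absv x / absv y"
  by (simp add: divide_inverse absv_mult absv_inverse)

lemma absv_powi: "absv ((x::'k::nonarch_local_field) powi m) = absv x powi m"
  by (simp add: power_int_def absv_power absv_inverse)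

lemma absv_prod: "absv (\<Prod>i\<in>S. f i) = (\<Prod>i\<in>S. absv (f i :: 'k::nonarch_local_field))"
  by (induction S rule: infinite_finite_induct) (auto simp: absv_mult)

lemma absv_eq_if_close:
  fixes x y :: "'k::nonarch_local_field"
  assumes "absv (x - y) < absv y"
  shows "absv x = absv y"
proof (rule antisym)
  show "absv x \<le> absv y" using absv_ultrametric[of "x - y" y] assms by simp
  show "absv y \<le> absv x"
  proof (rule ccontr)
    assume "\<not> absv y \<le> absv x"
    moreover have "absv y \<le> max (absv (y - x)) (absv x)" using absv_ultrametric[of "y - x" x] by simp
    ultimately show False using assms by (simp add: absv_minus_commute max_def split: if_splits)
  qed
qed

lemma powi_less_iff:
  fixes q :: real
  assumes "0 < q" "q < 1"
  shows "q powi i < q powi j \<longleftrightarrow> j < i"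
  using assms power_int_strict_decreasing[of i j q] power_int_strict_decreasing[of j i q]
  by (cases i j rule: linorder_cases) auto

lemma powi_le_iff:
  fixes q :: real
  assumes "0 < q" "q < 1"
  shows "q powi i \<le> q powi j \<longleftrightarrow> j \<le> i"
  using powi_less_iff[OF assms, of j i] by linarith

lemma ex_powi_bracket:
  fixes q r :: real
  assumes "0 < q" "q < 1" "0 < r"
  obtains m :: int where "q powi m \<le> r" "r < q powi (m - 1)"
proof
  let ?m = "\<lceil>log q r\<rceil>"
  have r: "r = q powr (log q r)" using assms by simp
  have "q powi ?m = q powr real_of_int ?m" using assms by (simp add: powr_real_of_int')
  also have "\<dots> \<le> q powr (log q r)" using assms by (intro powr_mono') auto
  finally show "q powi ?m \<le> r" using r by simp
  have "q powi (?m - 1) = q powr real_of_int (?m - 1)"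
    by (rule powr_real_of_int'[symmetric]) (use assms in auto)
  moreover have "q powr (log q r) < q powr real_of_int (?m - 1)"
    using assms by (intro powr_less_mono') (auto, linarith)
  ultimately show "r < q powi (?m - 1)" using r by simp
qed

lemma absv_powi_uniformiser:
  fixes x \<pi> :: "'k::nonarch_local_field"
  assumes \<pi>: "uniformiser \<pi>" and x: "x \<noteq> 0"
  obtains j where "absv x = absv \<pi> powi j"
proof -
  let ?q = "absv \<pi>"
  have q: "0 < ?q" "?q < 1" using \<pi> by (auto simp: uniformiser_def)
  obtain m where m: "?q powi m \<le> absv x" "absv x < ?q powi (m - 1)"
    using ex_powi_bracket[OF q, of "absv x"] x by auto
  let ?y = "x * \<pi> powi (1 - m)"
  have y: "absv ?y = absv x * ?q powi (1 - m)" by (simp add: absv_mult absv_powi)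
  have pos: "?q powi (m - 1) * ?q powi (1 - m) = 1" "?q powi m * ?q powi (1 - m) = ?q"
    using q by (simp_all flip: power_int_add)
  have pp: "?q powi (1 - m) > 0" using q by simp
  have "absv ?y < 1" using m(2) pos(1) pp y mult_strict_right_mono by metis
  then have "absv ?y \<le> ?q" using \<pi> by (auto simp: uniformiser_def)
  then have "absv x * ?q powi (1 - m) \<le> ?q powi m * ?q powi (1 - m)" using y pos by simp
  then have "absv x \<le> ?q powi m" using pp by (simp only: mult_le_cancel_right_pos)
  then show ?thesis using m(1) that by (meson antisym)
qed

text \<open>
  This is used to replace an arbitrary real radius by one from the value group, where it can be
  rescaled by powers of the uniformiser.
\<close>

lemma ex_value_below:
  fixes \<pi> :: "'k::nonarch_local_field"
  assumes \<pi>: "uniformiser \<pi>" and r: "0 < r"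
  obtains m where "absv \<pi> powi m \<le> r" "\<And>x::'k. absv x \<le> r \<Longrightarrow> absv x \<le> absv \<pi> powi m"
proof -
  let ?q = "absv \<pi>"
  have q: "0 < ?q" "?q < 1" using \<pi> by (auto simp: uniformiser_def)
  obtain m where m: "?q powi m \<le> r" "r < ?q powi (m - 1)" using ex_powi_bracket[OF q r] .
  show ?thesis
  proof
    fix x :: 'k assume x: "absv x \<le> r"
    show "absv x \<le> ?q powi m"
    proof (cases "x = 0")
      case False
      obtain j where j: "absv x = ?q powi j" using absv_powi_uniformiser[OF \<pi> False] .
      then show ?thesis using x m powi_less_iff[OF q] powi_le_iff[OF q]
        by (metis le_less_trans zle_diff1_eq diff_add_cancel less_le_not_le linorder_not_le zless_imp_add1_zle)
    qed (use q in simp)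
  qed (use m in simp)
qed

lemma absv_less_uniformiser:
  fixes x \<pi> :: "'k::nonarch_local_field"
  assumes \<pi>: "uniformiser \<pi>" and "absv x < absv \<pi> powi m"
  shows "absv x \<le> absv \<pi> powi (m + 1)"
proof (cases "x = 0")
  case False
  have q: "0 < absv \<pi>" "absv \<pi> < 1" using \<pi> by (auto simp: uniformiser_def)
  obtain j where "absv x = absv \<pi> powi j" using absv_powi_uniformiser[OF \<pi> False] .
  then show ?thesis using assms powi_less_iff[OF q] powi_le_iff[OF q] by simp
qed simp

lemma maxnorm_le_iff:
  fixes z :: "'k::nonarch_local_field ^ 'n::finite"
  shows "maxnorm z \<le> r \<longleftrightarrow> (\<forall>i. absv (z $ i) \<le> r)"
  unfolding maxnorm_def by (subst Max_le_iff) auto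

lemma absv_nth_le_maxnorm: "absv (z $ i) \<le> maxnorm (z :: 'k::nonarch_local_field ^ 'n::finite)"
  using maxnorm_le_iff[of z "maxnorm z"] by simp

lemma maxnorm_nonneg [simp]: "0 \<le> maxnorm (z :: 'k::nonarch_local_field ^ 'n::finite)"
  using absv_nth_le_maxnorm[of z undefined] absv_nonneg order_trans by blast

lemma maxnorm_attained: "\<exists>i. maxnorm (z :: 'k::nonarch_local_field ^ 'n::finite) = absv (z $ i)"
proof -
  have "Max (range (\<lambda>i. absv (z $ i))) \<in> range (\<lambda>i. absv (z $ i))" by (rule Max_in) auto
  then show ?thesis unfolding maxnorm_def by (rule rangeE) blast
qed

lemma maxnorm_eq_0_iff [simp]: "maxnorm (z :: 'k::nonarch_local_field ^ 'n::finite) = 0 \<longleftrightarrow> z = 0"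
proof
  assume "maxnorm z = 0"
  then have "absv (z $ i) \<le> 0" for i using absv_nth_le_maxnorm[of z i] by simp
  then show "z = 0" by (simp add: vec_eq_iff) (metis absv_eq_0_iff absv_nonneg antisym)
next
  assume "z = 0"
  then show "maxnorm z = 0" using maxnorm_attained[of z] by auto
qed

lemma in_kball_iff:
  fixes z :: "'k::nonarch_local_field ^ 'n::finite"
  shows "z \<in> kball c r \<longleftrightarrow> (\<forall>i. absv (z $ i - c $ i) \<le> r)"
  by (simp add: kball_def maxnorm_le_iff)

lemma centre_in_kball [simp]: "0 \<le> r \<Longrightarrow> c \<in> kball (c :: 'k::nonarch_local_field ^ 'n::finite) r"
  by (simp add: in_kball_iff)

lemma kball_subset:
  fixes z :: "'k::nonarch_local_field ^ 'n::finite"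
  assumes "z \<in> kball c r" "r \<le> r'" "z \<in> kball c' r'"
  shows "kball c r \<subseteq> kball c' r'"
proof
  fix w assume w: "w \<in> kball c r"
  show "w \<in> kball c' r'"
    unfolding in_kball_iff
  proof
    fix i
    have "absv (w $ i - c $ i) \<le> r'" "absv (z $ i - c $ i) \<le> r'" "absv (z $ i - c' $ i) \<le> r'"
      using assms w by (auto simp: in_kball_iff intro: order_trans)
    then have "absv ((w $ i - c $ i) - (z $ i - c $ i) + (z $ i - c' $ i)) \<le> r'"
      using absv_add_le absv_diff_le by blast
    then show "absv (w $ i - c' $ i) \<le> r'" by simp
  qed
qed

lemma kball_recentre:
  fixes z :: "'k::nonarch_local_field ^ 'n::finite"
  assumes "z \<in> kball c r"
  shows "kball z r = kball c r"
proof -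
  have "absv (z $ i - c $ i) \<le> r" for i using assms by (simp add: in_kball_iff)
  then have "0 \<le> r" using absv_nonneg order_trans by blast
  then have "z \<in> kball z r" by simp
  with assms show ?thesis by (intro equalityI kball_subset[where z = z]) auto
qed

lemma kball_mono: "r \<le> r' \<Longrightarrow> kball c r \<subseteq> kball c r'"
  by (auto simp: kball_def)

lemma kball_eq_INT:
  fixes c :: "'k::nonarch_local_field ^ 'n::finite"
  shows "kball c r = (\<Inter>i. (\<lambda>z. z $ i) -` cball (c $ i) r)"
  by (auto simp: in_kball_iff dist_absv absv_minus_commute)

lemma closed_kball: "closed (kball (c :: 'k::nonarch_local_field ^ 'n::finite) r)"
  unfolding kball_eq_INT by (intro closed_INT ballI closed_vimage_vec_nth) auto

lemma open_absv_ball: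
  assumes "0 < r"
  shows "open (cball (c :: 'k::nonarch_local_field) r)"
  unfolding open_dist
proof
  fix x assume x: "x \<in> cball c r"
  show "\<exists>e>0. \<forall>y. dist y x < e \<longrightarrow> y \<in> cball c r"
  proof (intro exI[of _ r] conjI allI impI)
    fix y assume "dist y x < r"
    then have "absv (c - x) \<le> r" "absv (y - x) \<le> r" using x by (auto simp: dist_absv)
    then have "absv ((c - x) - (y - x)) \<le> r" by (rule absv_diff_le)
    then show "y \<in> cball c r" by (simp add: dist_absv)
  qed (use assms in auto)
qed

lemma open_kball: "0 < r \<Longrightarrow> open (kball (c :: 'k::nonarch_local_field ^ 'n::finite) r)"
  unfolding kball_eq_INT by (intro open_INT ballI open_vimage_vec_nth open_absv_ball) auto

lemma kball_borel [measurable]: "kball (c :: 'k::nonarch_local_field ^ 'n::finite) r \<in> sets borel"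
  by (simp add: closed_kball borel_closed)

lemma kball_in_open:
  fixes z :: "'k::nonarch_local_field ^ 'n::finite"
  assumes "open S" "z \<in> S"
  obtains r where "r > 0" "kball z r \<subseteq> S"
proof -
  obtain A where A: "\<And>i. open (A i)" "\<And>i. z $ i \<in> A i" "\<And>y. (\<forall>i. y $ i \<in> A i) \<Longrightarrow> y \<in> S"
    using assms unfolding open_vec_def by metis
  have "\<exists>e>0. cball (z $ i) e \<subseteq> A i" for i using A open_contains_cball by blast
  then obtain e where e: "\<And>i. e i > 0" "\<And>i. cball (z $ i) (e i) \<subseteq> A i" by metis
  let ?r = "Min (range e)"
  have r: "?r \<le> e i" for i by (rule Min_le) auto
  have "?r \<in> range e" by (rule Min_in) auto
  then have "?r > 0" using e by auto
  moreover have "kball z ?r \<subseteq> S"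
  proof
    fix y assume "y \<in> kball z ?r"
    then have "y $ i \<in> cball (z $ i) (e i)" for i
      using r[of i] by (force simp: in_kball_iff dist_absv absv_minus_commute)
    then show "y \<in> S" using A(3) e(2) by blast
  qed
  ultimately show ?thesis using that by blast
qed

lemma open_if_kballs:
  fixes S :: "('k::nonarch_local_field ^ 'n::finite) set"
  assumes "\<And>z. z \<in> S \<Longrightarrow> \<exists>r>0. kball z r \<subseteq> S"
  shows "open S"
  unfolding open_subopen[of S]
  using assms open_kball centre_in_kball by (metis less_imp_le)

text \<open>
  The Lebesgue number lemma for a local property that passes to smaller balls. In an ultrametric
  space every point of a ball is a centre of it, so no radius has to be halved.
\<close>

lemma uniform_radius:
  fixes D :: "('k::nonarch_local_field ^ 'n::finite) set"
  assumes "compact D" and ex: "\<And>z. z \<in> D \<Longrightarrow> \<exists>r>0. P z r"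
    and her: "\<And>z w r r'. P z r \<Longrightarrow> w \<in> kball z r \<Longrightarrow> 0 < r' \<Longrightarrow> r' \<le> r \<Longrightarrow> P w r'"
  shows "\<exists>R>0. \<forall>z\<in>D. P z R"
proof -
  obtain \<rho> where \<rho>: "\<And>z. z \<in> D \<Longrightarrow> \<rho> z > 0" "\<And>z. z \<in> D \<Longrightarrow> P z (\<rho> z)"
    using ex by metis
  have "D \<subseteq> (\<Union>z\<in>D. kball z (\<rho> z))" using \<rho>(1) by (force intro: centre_in_kball less_imp_le)
  then obtain F where F: "F \<subseteq> D" "finite F" "D \<subseteq> (\<Union>z\<in>F. kball z (\<rho> z))"
    using compactE_image[OF \<open>compact D\<close>, of D "\<lambda>z. kball z (\<rho> z)"] \<rho>(1) open_kball by metis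
  let ?R = "Min (insert 1 (\<rho> ` F))"
  have "?R > 0" using F \<rho> by (auto simp: Min_gr_iff)
  moreover have "P w ?R" if "w \<in> D" for w
  proof -
    obtain z where z: "z \<in> F" "w \<in> kball z (\<rho> z)" using subsetD[OF F(3) \<open>w \<in> D\<close>] by blast
    have "?R \<le> \<rho> z" using F z by (intro Min_le) auto
    then show ?thesis using her[OF \<rho>(2) z(2) \<open>?R > 0\<close>] z F by blast
  qed
  ultimately show ?thesis by blast
qed

text \<open>A power of the uniformiser scales the ball into the compact ring of integers.\<close>

lemma finite_absv_cover:
  fixes t r :: real
  assumes "0 < r"
  obtains F :: "'k::nonarch_local_field set"
  where "finite F" "\<And>x. absv x \<le> t \<Longrightarrow> \<exists>f\<in>F. absv (x - f) \<le> r"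
proof -
  obtain \<pi> :: 'k where \<pi>: "\<pi> \<noteq> 0" "absv \<pi> < 1" using absv_normalised by blast
  have "0 < absv \<pi>" using \<pi> by simp
  have "\<exists>n. absv \<pi> ^ n < inverse (max t 1)"
    using \<pi> by (intro real_arch_pow_inv) auto
  then obtain n where n: "absv \<pi> ^ n < inverse (max t 1)" by blast
  let ?c = "inverse (\<pi> ^ n)"
  have "absv \<pi> ^ n > 0" using \<pi> by simp
  then have c: "absv ?c \<ge> t" "absv ?c > 0"
  proof -
    have "absv \<pi> ^ n > 0" using \<pi> by simp
    then have "max t 1 < inverse (absv \<pi> ^ n)" using n
      using less_imp_inverse_less[OF n] by simp
    then show "absv ?c \<ge> t" by (simp add: absv_inverse absv_power)
  qed (use \<pi> in simp)
  define O' where "O' = {x::'k. absv x \<le> 1}"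
  let ?e = "r / absv ?c"
  have e: "?e > 0" using c assms by simp
  have "O' \<subseteq> (\<Union>x\<in>O'. ball x ?e)" using e by auto
  then obtain F where F: "F \<subseteq> O'" "finite F" "O' \<subseteq> (\<Union>x\<in>F. ball x ?e)"
    using compactE_image[OF compact_integers, of O' "\<lambda>x. ball x ?e"] unfolding O'_def by (metis open_ball)
  show ?thesis
  proof (rule that[of "(*) ?c ` F"])
    fix x :: 'k assume x: "absv x \<le> t"
    have "absv (x / ?c) \<le> 1" using x c by (simp only: absv_divide) (simp add: divide_le_eq)
    then obtain f where f: "f \<in> F" "absv (x / ?c - f) < ?e"
      using F(3) by (force simp: O'_def dist_absv absv_minus_commute)
    have "x - ?c * f = ?c * (x / ?c - f)" using c by (simp add: algebra_simps)
    then have "absv (x - ?c * f) = absv ?c * absv (x / ?c - f)" by (simp only: absv_mult)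
    also have "\<dots> \<le> absv ?c * ?e" using f c by (intro mult_left_mono) auto
    also have "\<dots> = r" using c by simp
    finally show "\<exists>f\<in>(*) ?c ` F. absv (x - f) \<le> r" using f by blast
  qed (use F in simp)
qed

lemma finite_kball_cover:
  fixes t r :: real
  assumes "0 < r"
  obtains F :: "('k::nonarch_local_field ^ 'n::finite) set"
  where "finite F" "kball 0 t \<subseteq> (\<Union>c\<in>F. kball c r)"
proof -
  obtain F :: "'k set" where F: "finite F" "\<And>x. absv x \<le> t \<Longrightarrow> \<exists>f\<in>F. absv (x - f) \<le> r"
    using finite_absv_cover[OF assms] by blast
  let ?G = "vec_lambda ` {g :: 'n \<Rightarrow> 'k. \<forall>i. g i \<in> F}"
  have "finite {g :: 'n \<Rightarrow> 'k. \<forall>i. (i \<in> UNIV \<longrightarrow> g i \<in> F) \<and> (i \<notin> UNIV \<longrightarrow> g i = 0)}"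
    using F by (intro finite_set_of_finite_funs) auto
  then have "finite ?G" by simp
  moreover have "kball 0 t \<subseteq> (\<Union>c\<in>?G. kball c r)"
  proof
    fix z :: "'k ^ 'n" assume "z \<in> kball 0 t"
    then have "\<exists>f\<in>F. absv (z $ i - f) \<le> r" for i using F(2) by (simp add: in_kball_iff)
    then obtain g where "\<And>i. g i \<in> F" "\<And>i. absv (z $ i - g i) \<le> r" by metis
    then show "z \<in> (\<Union>c\<in>?G. kball c r)"
      by (intro UN_I[of "vec_lambda g"]) (auto simp: in_kball_iff)
  qed
  ultimately show ?thesis using that by blast
qed

section \<open>Strict differentiability of analytic maps\<close>

text \<open>
  A term is the difference of two partial sums, and all sufficiently large partial sums are close
  to the limit.
\<close>

lemma has_sum_bounded_terms:
  fixes t :: "'i \<Rightarrow> 'k::nonarch_local_field"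
  assumes "(t has_sum S) UNIV"
  shows "\<exists>C. \<forall>m. absv (t m) \<le> C"
proof -
  have "eventually (\<lambda>F. dist (sum t F) S < 1) (finite_subsets_at_top UNIV)"
    using assms unfolding has_sum_def by (rule tendstoD) simp
  then obtain X where X: "finite X" "\<And>Y. finite Y \<Longrightarrow> X \<subseteq> Y \<Longrightarrow> dist (sum t Y) S < 1"
    unfolding eventually_finite_subsets_at_top by auto
  have "absv (t m) \<le> Max (insert 1 ((absv \<circ> t) ` X))" for m
  proof (cases "m \<in> X")
    case True
    then show ?thesis using X by (intro Max_ge) auto
  next
    case False
    have "absv (sum t (insert m X) - S) \<le> 1" "absv (sum t X - S) \<le> 1"
      using X(2)[of "insert m X"] X(2)[of X] X(1) by (auto simp: dist_absv subset_insertI less_imp_le)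
    then have "absv ((sum t (insert m X) - S) - (sum t X - S)) \<le> 1" by (rule absv_diff_le)
    then have "absv (t m) \<le> 1" using False X(1) by simp
    also have "1 \<le> Max (insert 1 ((absv \<circ> t) ` X))" using X(1) by (intro Max_ge) auto
    finally show ?thesis .
  qed
  then show ?thesis by blast
qed

text \<open>
  A relation between the values of one monomial of degree \<open>k\<close> at two points of norm at most \<open>\<delta>\<close>
  and distance at most \<open>d\<close>. The natural bound for the difference is \<open>d * \<delta> ^ (k - 1)\<close>; multiplied
  by \<open>\<delta>\<close> it makes sense in degree 0 and is compatible with products.
\<close>

definition near_of_degree :: "real \<Rightarrow> real \<Rightarrow> nat \<Rightarrow> 'k::nonarch_local_field \<Rightarrow> 'k \<Rightarrow> bool" where
  "near_of_degree \<delta> d k a b \<longleftrightarrow>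
     absv a \<le> \<delta> ^ k \<and> absv b \<le> \<delta> ^ k \<and> absv (a - b) * \<delta> \<le> d * \<delta> ^ k"

lemma near_of_degree_mult:
  fixes a b c e :: "'k::nonarch_local_field"
  assumes "near_of_degree \<delta> d k a b" "near_of_degree \<delta> d l c e" "0 \<le> \<delta>" "0 \<le> d"
  shows "near_of_degree \<delta> d (k + l) (a * c) (b * e)"
proof -
  have A: "absv a \<le> \<delta> ^ k" "absv b \<le> \<delta> ^ k" "absv (a - b) * \<delta> \<le> d * \<delta> ^ k"
    and C: "absv c \<le> \<delta> ^ l" "absv e \<le> \<delta> ^ l" "absv (c - e) * \<delta> \<le> d * \<delta> ^ l"
    using assms by (auto simp: near_of_degree_def)
  have p: "0 \<le> \<delta> ^ k" "0 \<le> \<delta> ^ l" using assms by auto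
  have 1: "absv (a * c) \<le> \<delta> ^ (k + l)" "absv (b * e) \<le> \<delta> ^ (k + l)"
    using A C p by (auto simp: absv_mult power_add intro!: mult_mono)
  have split: "a * c - b * e = a * (c - e) + (a - b) * e" by (simp add: algebra_simps)
  have "absv a * (absv (c - e) * \<delta>) \<le> \<delta> ^ k * (d * \<delta> ^ l)"
    by (rule mult_mono) (use A C p assms in auto)
  moreover have "(absv (a - b) * \<delta>) * absv e \<le> (d * \<delta> ^ k) * \<delta> ^ l"
    by (rule mult_mono) (use A C p assms in auto)
  moreover have "absv (a * c - b * e) \<le> max (absv a * absv (c - e)) (absv (a - b) * absv e)"
    unfolding split using absv_ultrametric by (metis absv_mult)
  ultimately have "absv (a * c - b * e) * \<delta> \<le> d * \<delta> ^ (k + l)"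
  proof -
    assume 1: "absv a * (absv (c - e) * \<delta>) \<le> \<delta> ^ k * (d * \<delta> ^ l)"
      and 2: "(absv (a - b) * \<delta>) * absv e \<le> (d * \<delta> ^ k) * \<delta> ^ l"
      and "absv (a * c - b * e) \<le> max (absv a * absv (c - e)) (absv (a - b) * absv e)"
    then have "absv (a * c - b * e) * \<delta>
        \<le> max (absv a * absv (c - e)) (absv (a - b) * absv e) * \<delta>"
      using assms(3) by (intro mult_right_mono) auto
    with 1 2 show ?thesis by (auto simp: max_def power_add algebra_simps split: if_splits)
  qed
  with 1 show ?thesis by (simp add: near_of_degree_def)
qed

lemma near_of_degree_1: "0 \<le> d \<Longrightarrow> near_of_degree \<delta> d 0 1 (1::'k::nonarch_local_field)"
  by (simp add: near_of_degree_def)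

lemma near_of_degree_power:
  assumes "near_of_degree \<delta> d 1 a b" "0 \<le> \<delta>" "0 \<le> d"
  shows "near_of_degree \<delta> d k (a ^ k) (b ^ k)"
proof (induction k)
  case (Suc k)
  then show ?case using near_of_degree_mult[OF assms(1) Suc assms(2,3)] by simp
qed (use assms in \<open>simp add: near_of_degree_1\<close>)

lemma near_of_degree_prod:
  assumes "\<And>i. i \<in> I \<Longrightarrow> near_of_degree \<delta> d (k i) (a i) (b i)" "0 \<le> \<delta>" "0 \<le> d"
  shows "near_of_degree \<delta> d (\<Sum>i\<in>I. k i) (\<Prod>i\<in>I. a i) (\<Prod>i\<in>I. b i)"
  using assms(1)
proof (induction I rule: infinite_finite_induct)
  case (insert i I)
  then show ?case by (simp add: near_of_degree_mult[OF _ _ assms(2,3)])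
qed (use assms in \<open>simp_all add: near_of_degree_1\<close>)

text \<open>
  Near the centre of expansion the terms of degree at least two of the power series are
  contracting, by the bound on the coefficients. What remains of a difference of two values is its
  linear part, up to an error that does not exceed the distance of the arguments.
\<close>

lemma kanalytic_on_linear_part:
  fixes f :: "'k::nonarch_local_field ^ 'n::finite \<Rightarrow> 'k"
  assumes f: "kanalytic_on D f" and c: "c \<in> D"
  obtains a \<delta> where "\<delta> > 0" "kball c \<delta> \<subseteq> D"
    "\<And>z w. z \<in> kball c \<delta> \<Longrightarrow> w \<in> kball c \<delta> \<Longrightarrow>
       absv (f z - f w - (\<Sum>i\<in>UNIV. a i * (z $ i - w $ i))) \<le> maxnorm (z - w)"
proof -
  obtain r A where r: "r > 0" "kball c r \<subseteq> D"
    and A: "\<And>z. z \<in> kball c r \<Longrightarrow>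
      ((\<lambda>m. A m * (\<Prod>i\<in>UNIV. (z $ i - c $ i) ^ m i)) has_sum f z) UNIV"
    using f c unfolding kanalytic_on_def by blast
  define deg :: "('n \<Rightarrow> nat) \<Rightarrow> nat" where "deg m = (\<Sum>i\<in>UNIV. m i)" for m
  obtain \<pi> :: 'k where \<pi>: "\<pi> \<noteq> 0" "absv \<pi> < 1" using absv_normalised by blast
  obtain n where n: "absv \<pi> ^ n < r" using real_arch_pow_inv[OF r(1) \<pi>(2)] by blast
  define \<rho> where "\<rho> = absv (\<pi> ^ n)"
  have \<rho>: "0 < \<rho>" "\<rho> \<le> r" using n \<pi> by (auto simp: \<rho>_def absv_power)
  obtain C0 where C0: "\<And>m. absv (A m) * \<rho> ^ deg m \<le> C0"
  proof -
    \<comment> \<open>At this point every monomial of degree \<open>k\<close> has the absolute value \<open>\<rho> ^ k\<close>.\<close>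
    let ?z = "c + (\<chi> i. \<pi> ^ n)"
    have "?z \<in> kball c r" using \<rho> by (simp add: in_kball_iff \<rho>_def)
    from has_sum_bounded_terms[OF A[OF this]] obtain C where
      C: "\<And>m. absv (A m * (\<Prod>i\<in>UNIV. (?z $ i - c $ i) ^ m i)) \<le> C" by blast
    have "absv (A m * (\<Prod>i\<in>UNIV. (?z $ i - c $ i) ^ m i)) = absv (A m) * \<rho> ^ deg m" for m
      by (simp add: absv_mult absv_prod absv_power \<rho>_def deg_def power_sum)
    then show ?thesis using C that by metis
  qed
  define C where "C = max C0 1"
  have C: "C \<ge> 1" "\<And>m. absv (A m) * \<rho> ^ deg m \<le> C"
    using C0 by (auto simp: C_def le_max_iff_disj)
  \<comment> \<open>A term of degree at least two changes by at most \<open>C * \<delta> / \<rho>\<^sup>2\<close> times the distance of the arguments.\<close>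
  define \<delta> where "\<delta> = min \<rho> (\<rho>\<^sup>2 / C)"
  have \<delta>: "\<delta> > 0" "\<delta> \<le> \<rho>" "C * \<delta> \<le> \<rho>\<^sup>2"
    using \<rho> C by (auto simp: \<delta>_def min_def field_simps)
  define e :: "'n \<Rightarrow> 'n \<Rightarrow> nat" where "e i = (\<lambda>j. if j = i then 1 else 0)" for i
  have inj_e: "inj e" by (rule injI) (metis e_def zero_neq_one)
  have deg_low: "m = (\<lambda>_. 0) \<or> m \<in> range e" if "deg m < 2" for m
  proof (cases "deg m = 0")
    case True
    then show ?thesis by (auto simp: deg_def)
  next
    case False
    then have "deg m = 1" using that by simp
    then obtain i where "m i = 1" "\<And>j. j \<noteq> i \<Longrightarrow> m j = 0"
      unfolding deg_def by (subst (asm) sum_eq_1_iff) auto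
    then have "m = e i" by (auto simp: e_def)
    then show ?thesis by blast
  qed
  have e_prod: "(\<Prod>j\<in>UNIV. x j ^ e i j) = x i" for x :: "'n \<Rightarrow> 'k" and i
  proof -
    have "(\<Prod>j\<in>UNIV. x j ^ e i j) = (\<Prod>j\<in>UNIV. if j = i then x j else 1)"
      by (intro prod.cong) (auto simp: e_def)
    then show ?thesis by simp
  qed
  have main: "absv (f z - f w - (\<Sum>i\<in>UNIV. A (e i) * (z $ i - w $ i))) \<le> maxnorm (z - w)"
    if z: "z \<in> kball c \<delta>" and w: "w \<in> kball c \<delta>" for z w
  proof (cases "z = w")
    case False
    define d where "d = maxnorm (z - w)"
    have "d \<ge> 0" by (simp add: d_def)
    moreover have "d \<noteq> 0" using False by (simp add: d_def)
    ultimately have d: "d > 0" by simp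
    define Z where "Z m = (\<Prod>i\<in>UNIV. (z $ i - c $ i) ^ m i)" for m
    define W where "W m = (\<Prod>i\<in>UNIV. (w $ i - c $ i) ^ m i)" for m
    have near: "near_of_degree \<delta> d (deg m) (Z m) (W m)" for m
      unfolding deg_def Z_def W_def
    proof (intro near_of_degree_prod near_of_degree_power)
      fix i
      have "absv (z $ i - w $ i) \<le> d" using absv_nth_le_maxnorm[of "z - w" i] by (simp add: d_def)
      then show "near_of_degree \<delta> d 1 (z $ i - c $ i) (w $ i - c $ i)"
        using z w \<delta> by (auto simp: near_of_degree_def in_kball_iff intro!: mult_right_mono)
    qed (use \<delta> d in auto)
    have small: "absv (A m * (Z m - W m)) \<le> d" if m: "m \<notin> range e" for m
    proof (cases "m = (\<lambda>_. 0)")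
      case True
      then show ?thesis using d by (simp add: Z_def W_def)
    next
      case False
      then have "2 \<le> deg m" using deg_low[of m] m by linarith
      then obtain k where k: "deg m = k + 2" by (metis add.commute le_Suc_ex)
      let ?X = "absv (Z m - W m)"
      have "?X * \<delta> \<le> d * \<delta> ^ (k + 2)" using near[of m] k by (simp add: near_of_degree_def)
      then have "?X * \<delta> \<le> (d * \<delta> ^ (k + 1)) * \<delta>" by (simp add: algebra_simps)
      then have X: "?X \<le> d * \<delta> ^ (k + 1)" using \<delta>(1) mult_le_cancel_right_pos by blast
      have "absv (A m) * \<rho> ^ (k + 2) \<le> C" using C(2)[of m] k by simp
      then have "(absv (A m) * \<rho> ^ (k + 2)) * ?X \<le> C * (d * \<delta> ^ (k + 1))"
        by (rule mult_mono) (use X C(1) in auto)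
      also have "\<dots> = (C * \<delta>) * (d * \<delta> ^ k)" by simp
      also have "\<dots> \<le> \<rho>\<^sup>2 * (d * \<rho> ^ k)"
        by (intro mult_mono power_mono) (use \<delta> d C(1) in auto)
      finally have "(absv (A m) * ?X) * \<rho> ^ (k + 2) \<le> d * \<rho> ^ (k + 2)"
        by (simp add: algebra_simps power2_eq_square)
      then have "absv (A m) * ?X \<le> d" using \<rho> by (simp only: mult_le_cancel_right_pos zero_less_power)
      then show ?thesis by (simp add: absv_mult)
    qed
    have zr: "z \<in> kball c r" "w \<in> kball c r"
      using z w \<delta>(2) \<rho>(2) kball_mono[of \<delta> r c] by auto
    have tz: "((\<lambda>F. \<Sum>m\<in>F. A m * Z m) \<longlongrightarrow> f z) (finite_subsets_at_top UNIV)"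
      and tw: "((\<lambda>F. \<Sum>m\<in>F. A m * W m) \<longlongrightarrow> f w) (finite_subsets_at_top UNIV)"
      using A[OF zr(1)] A[OF zr(2)] by (simp_all add: has_sum_def Z_def W_def)
    have "eventually (\<lambda>F. dist (\<Sum>m\<in>F. A m * Z m) (f z) < d \<and> dist (\<Sum>m\<in>F. A m * W m) (f w) < d)
       (finite_subsets_at_top UNIV)"
      by (intro eventually_conj tendstoD[OF tz] tendstoD[OF tw] d)
    then obtain X where X: "finite X"
      and close: "\<And>F. finite F \<Longrightarrow> X \<subseteq> F \<Longrightarrow>
        dist (\<Sum>m\<in>F. A m * Z m) (f z) < d \<and> dist (\<Sum>m\<in>F. A m * W m) (f w) < d"
      unfolding eventually_finite_subsets_at_top by auto
    define F where "F = X \<union> range e"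
    have F: "finite F" "range e \<subseteq> F"
        "absv ((\<Sum>m\<in>F. A m * Z m) - f z) \<le> d" "absv ((\<Sum>m\<in>F. A m * W m) - f w) \<le> d"
      using close[of F] X by (auto simp: F_def simp flip: dist_absv)
    have "(\<Sum>m\<in>F. A m * Z m) - (\<Sum>m\<in>F. A m * W m) = (\<Sum>m\<in>F. A m * (Z m - W m))"
      by (simp add: sum_subtractf right_diff_distrib)
    also have "\<dots> = (\<Sum>m\<in>F - range e. A m * (Z m - W m)) + (\<Sum>m\<in>range e. A m * (Z m - W m))"
      using F by (intro sum.subset_diff) auto
    also have "(\<Sum>m\<in>range e. A m * (Z m - W m)) = (\<Sum>i\<in>UNIV. A (e i) * (Z (e i) - W (e i)))"
      by (simp add: sum.reindex[OF inj_e])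
    also have "\<dots> = (\<Sum>i\<in>UNIV. A (e i) * (z $ i - w $ i))"
      by (simp add: Z_def W_def e_prod)
    finally have split: "f z - f w - (\<Sum>i\<in>UNIV. A (e i) * (z $ i - w $ i)) =
       ((\<Sum>m\<in>F. A m * W m) - f w) - ((\<Sum>m\<in>F. A m * Z m) - f z)
         + (\<Sum>m\<in>F - range e. A m * (Z m - W m))"
      by (simp add: algebra_simps)
    show ?thesis
      unfolding split d_def[symmetric]
      by (rule absv_add_le[OF absv_diff_le[OF F(4,3)] absv_sum_le]) (use small d in auto)
  qed simp
  show ?thesis
  proof (rule that[OF \<delta>(1) _ main])
    show "kball c \<delta> \<subseteq> D" using r(2) \<delta>(2) \<rho>(2) kball_mono[of \<delta> r c] by auto
  qed
qed

text \<open>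
  Analytic functions are continuous, and a perturbation smaller than \<open>absv (f c)\<close> does not change
  this absolute value.
\<close>

lemma kanalytic_on_absv_locally_constant:
  fixes f :: "'k::nonarch_local_field ^ 'n::finite \<Rightarrow> 'k"
  assumes "kanalytic_on D f" "c \<in> D" "f c \<noteq> 0"
  shows "\<exists>\<delta>>0. \<forall>z\<in>kball c \<delta>. absv (f z) = absv (f c)"
proof -
  obtain a \<delta> where \<delta>: "\<delta> > 0" and a: "\<And>z w. z \<in> kball c \<delta> \<Longrightarrow> w \<in> kball c \<delta> \<Longrightarrow>
       absv (f z - f w - (\<Sum>i\<in>UNIV. a i * (z $ i - w $ i))) \<le> maxnorm (z - w)"
    using kanalytic_on_linear_part[OF assms(1,2)] by metis
  define M where "M = Max (insert 1 (range (\<lambda>i. absv (a i))))"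
  have M: "M \<ge> 1" "\<And>i. absv (a i) \<le> M" unfolding M_def by (intro Max_ge; simp)+
  define \<delta>' where "\<delta>' = min \<delta> (absv (f c) / (2 * M))"
  have \<delta>': "\<delta>' > 0" "\<delta>' \<le> \<delta>" "M * \<delta>' < absv (f c)"
  proof -
    show "\<delta>' > 0" "\<delta>' \<le> \<delta>" using M \<delta> assms(3) by (auto simp: \<delta>'_def)
    have "M * \<delta>' \<le> M * (absv (f c) / (2 * M))" using M by (intro mult_left_mono) (auto simp: \<delta>'_def)
    also have "\<dots> < absv (f c)" using M assms(3) by simp
    finally show "M * \<delta>' < absv (f c)" .
  qed
  show ?thesis
  proof (intro exI[of _ \<delta>'] conjI ballI \<delta>'(1))
    fix z assume z: "z \<in> kball c \<delta>'"
    then have zc: "z \<in> kball c \<delta>" "c \<in> kball c \<delta>" using \<delta>'(1,2) kball_mono[of \<delta>' \<delta> c] by auto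
    have "maxnorm (z - c) \<le> \<delta>'" using z by (simp add: kball_def)
    also have "\<dots> \<le> M * \<delta>'" using M \<delta>' by simp
    finally have "absv (f z - f c - (\<Sum>i\<in>UNIV. a i * (z $ i - c $ i))) \<le> M * \<delta>'"
      using a[OF zc] by simp
    moreover have "absv (\<Sum>i\<in>UNIV. a i * (z $ i - c $ i)) \<le> M * \<delta>'"
      using z M \<delta>' by (intro absv_sum_le) (auto simp: absv_mult in_kball_iff intro!: mult_mono)
    ultimately have "absv (f z - f c - (\<Sum>i\<in>UNIV. a i * (z $ i - c $ i))
        + (\<Sum>i\<in>UNIV. a i * (z $ i - c $ i))) \<le> M * \<delta>'" by (rule absv_add_le)
    then have "absv (f z - f c) < absv (f c)" using \<delta>'(3) by simp
    then show "absv (f z) = absv (f c)" by (rule absv_eq_if_close)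
  qed
qed

text \<open>
  The linear part is only asked to be homogeneous, and the error need not be small compared with
  the distance of the arguments: by the ultrametric inequality an error up to this distance is
  harmless when contractions are to be recognised.
\<close>

definition strictly_differentiable ::
    "('k::nonarch_local_field ^ 'n \<Rightarrow> 'k ^ 'n) \<Rightarrow> 'k ^ 'n \<Rightarrow> real \<Rightarrow> bool" where
  "strictly_differentiable F c \<delta> \<longleftrightarrow> (\<exists>L. (\<forall>t h. L (t *s h) = t *s L h) \<and>
     (\<forall>z \<in> kball c \<delta>. \<forall>w \<in> kball c \<delta>. maxnorm (F z - F w - L (z - w)) \<le> maxnorm (z - w)))"

lemma kanalytic_map_on_strictly_differentiable:
  fixes F :: "'k::nonarch_local_field ^ 'n::finite \<Rightarrow> 'k ^ 'n"
  assumes F: "kanalytic_map_on D F" and c: "c \<in> D"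
  shows "\<exists>\<delta>>0. kball c \<delta> \<subseteq> D \<and> strictly_differentiable F c \<delta>"
proof -
  define Q where "Q j a \<delta> \<longleftrightarrow> \<delta> > 0 \<and> kball c \<delta> \<subseteq> D \<and>
    (\<forall>z \<in> kball c \<delta>. \<forall>w \<in> kball c \<delta>.
      absv (F z $ j - F w $ j - (\<Sum>i\<in>UNIV. a i * (z $ i - w $ i))) \<le> maxnorm (z - w))" for j a \<delta>
  have "\<exists>a \<delta>. Q j a \<delta>" for j
  proof -
    have "kanalytic_on D (\<lambda>z. F z $ j)" using F by (simp add: kanalytic_map_on_def)
    then show ?thesis
    proof (rule kanalytic_on_linear_part[OF _ c])
      fix a \<delta>
      assume "\<delta> > 0" "kball c \<delta> \<subseteq> D"
        "\<And>z w. z \<in> kball c \<delta> \<Longrightarrow> w \<in> kball c \<delta> \<Longrightarrow>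
          absv (F z $ j - F w $ j - (\<Sum>i\<in>UNIV. a i * (z $ i - w $ i))) \<le> maxnorm (z - w)"
      then have "Q j a \<delta>" unfolding Q_def by blast
      then show "\<exists>a \<delta>. Q j a \<delta>" by blast
    qed
  qed
  then obtain a \<delta> where Q: "\<And>j. Q j (a j) (\<delta> j)" by metis
  then have \<delta>: "\<And>j. \<delta> j > 0" "\<And>j. kball c (\<delta> j) \<subseteq> D"
    and a: "\<And>j z w. z \<in> kball c (\<delta> j) \<Longrightarrow> w \<in> kball c (\<delta> j) \<Longrightarrow>
      absv (F z $ j - F w $ j - (\<Sum>i\<in>UNIV. a j i * (z $ i - w $ i))) \<le> maxnorm (z - w)"
    unfolding Q_def by blast+
  define \<delta>0 where "\<delta>0 = Min (range \<delta>)"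
  have "\<delta>0 \<in> range \<delta>" unfolding \<delta>0_def by (intro Min_in) auto
  then have pos: "\<delta>0 > 0" using \<delta> by auto
  have le: "\<delta>0 \<le> \<delta> j" for j unfolding \<delta>0_def by (intro Min_le) auto
  define L where "L h = (\<chi> j. \<Sum>i\<in>UNIV. a j i * h $ i)" for h :: "'k ^ 'n"
  have hom: "L (t *s h) = t *s L h" for t h
    by (simp add: L_def vec_eq_iff sum_distrib_left mult.left_commute)
  have "maxnorm (F z - F w - L (z - w)) \<le> maxnorm (z - w)"
    if "z \<in> kball c \<delta>0" "w \<in> kball c \<delta>0" for z w
    unfolding maxnorm_le_iff[of "F z - F w - L (z - w)"]
  proof
    fix j
    have "z \<in> kball c (\<delta> j)" "w \<in> kball c (\<delta> j)" using that le kball_mono by blast+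
    then show "absv ((F z - F w - L (z - w)) $ j) \<le> maxnorm (z - w)"
      using a by (simp add: L_def)
  qed
  moreover have "kball c \<delta>0 \<subseteq> D" using \<delta>(2) le kball_mono by blast
  ultimately show ?thesis
    unfolding strictly_differentiable_def using hom pos by (intro exI[of _ \<delta>0] conjI exI[of _ L]) auto
qed

lemma strictly_differentiable_subball:
  fixes F :: "'k::nonarch_local_field ^ 'n::finite \<Rightarrow> 'k ^ 'n"
  assumes "strictly_differentiable F c \<delta>" "w \<in> kball c \<delta>" "0 < \<delta>'" "\<delta>' \<le> \<delta>"
  shows "strictly_differentiable F w \<delta>'"
proof -
  have "kball w \<delta>' \<subseteq> kball c \<delta>"
    using assms by (intro kball_subset[of w]) auto
  then show ?thesis using assms(1) unfolding strictly_differentiable_def by blast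
qed

text \<open>
  The linear part is homogeneous, so a bound for it at one scale holds at all scales. This is why
  a map that respects one small ball is a contraction on a neighbourhood whose size does not
  depend on the radius of that ball.
\<close>

lemma strictly_differentiable_contraction:
  fixes F :: "'k::nonarch_local_field ^ 'n::finite \<Rightarrow> 'k ^ 'n"
  assumes F: "strictly_differentiable F c \<delta>" and r: "0 < r" "r \<le> \<delta>"
    and ball: "F ` kball c r \<subseteq> kball (F c) r"
    and z: "z \<in> kball c \<delta>" and w: "w \<in> kball c \<delta>"
  shows "maxnorm (F z - F w) \<le> maxnorm (z - w)"
proof -
  obtain L where hom: "\<And>t h. L (t *s h) = t *s L h"
    and L: "\<And>z w. z \<in> kball c \<delta> \<Longrightarrow> w \<in> kball c \<delta> \<Longrightarrow>
      maxnorm (F z - F w - L (z - w)) \<le> maxnorm (z - w)"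
    using F unfolding strictly_differentiable_def by blast
  obtain \<pi> :: 'k where \<pi>: "uniformiser \<pi>" using absv_normalised unfolding uniformiser_def by blast
  have q: "0 < absv \<pi>" "absv \<pi> < 1" using \<pi> by (auto simp: uniformiser_def)
  obtain m where m: "absv \<pi> powi m \<le> r" "\<And>x::'k. absv x \<le> r \<Longrightarrow> absv x \<le> absv \<pi> powi m"
    using ex_value_below[OF \<pi> r(1)] by blast
  \<comment> \<open>The linear part respects the one ball that the map is known to respect.\<close>
  have step: "absv (L h $ i) \<le> absv \<pi> powi m" if h: "maxnorm h \<le> absv \<pi> powi m" for h i
  proof (rule m(2))
    have hr: "maxnorm h \<le> r" using h m(1) by simp
    then have cr: "c + h \<in> kball c r" by (simp add: kball_def)
    then have "c + h \<in> kball c \<delta>" "c \<in> kball c \<delta>" using r kball_mono[of r \<delta> c] by auto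
    then have "maxnorm (F (c + h) - F c - L h) \<le> r" using L[of "c + h" c] hr by simp
    moreover have "F (c + h) \<in> kball (F c) r" using ball cr by blast
    then have "maxnorm (F (c + h) - F c) \<le> r" by (simp add: kball_def)
    ultimately have "absv ((F (c + h) - F c) $ i) \<le> r" "absv ((F (c + h) - F c - L h) $ i) \<le> r"
      by (simp_all only: maxnorm_le_iff)
    then have "absv ((F (c + h) - F c) $ i - (F (c + h) - F c - L h) $ i) \<le> r"
      by (rule absv_diff_le)
    then show "absv (L h $ i) \<le> r" by simp
  qed
  have "maxnorm (L h) \<le> maxnorm h" for h
  proof (cases "h = 0")
    case True
    have "L 0 = 0" using hom[of 0 0] by simp
    with True show ?thesis by simp
  next
    case False
    obtain i0 where i0: "maxnorm h = absv (h $ i0)" using maxnorm_attained by blast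
    have "h $ i0 \<noteq> 0" using False i0 maxnorm_eq_0_iff[of h] by auto
    then obtain j where j: "maxnorm h = absv \<pi> powi j"
      using i0 absv_powi_uniformiser[OF \<pi>] by metis
    let ?t = "\<pi> powi (m - j)"
    have t: "absv ?t * absv \<pi> powi j = absv \<pi> powi m" "absv ?t > 0"
      using q \<pi> by (auto simp: absv_powi uniformiser_def simp flip: power_int_add)
    have "maxnorm (?t *s h) \<le> absv \<pi> powi m"
      unfolding maxnorm_le_iff
    proof
      fix i
      have "absv ?t * absv (h $ i) \<le> absv ?t * absv \<pi> powi j"
        using absv_nth_le_maxnorm[of h i] j by (intro mult_left_mono) auto
      then show "absv ((?t *s h) $ i) \<le> absv \<pi> powi m" using t by (simp add: absv_mult)
    qed
    from step[OF this] have "absv ?t * absv (L h $ i) \<le> absv ?t * absv \<pi> powi j" for i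
      using t by (simp add: hom absv_mult)
    then have "absv (L h $ i) \<le> absv \<pi> powi j" for i
      using t(2) by (simp only: mult_le_cancel_left_pos)
    then show ?thesis unfolding maxnorm_le_iff[of "L h"] using j by simp
  qed
  then have "absv ((F z - F w - L (z - w)) $ i + (L (z - w)) $ i) \<le> maxnorm (z - w)" for i
    using L[OF z w] maxnorm_le_iff by (intro absv_add_le) blast+
  then show ?thesis unfolding maxnorm_le_iff[of "F z - F w"] by simp
qed

section \<open>Haar measure of balls\<close>

lemma kball_translate:
  fixes c :: "'k::nonarch_local_field ^ 'n::finite"
  shows "(\<lambda>z. a + z) ` kball c r = kball (a + c) r"
proof (intro equalityI subsetI)
  fix z assume "z \<in> kball (a + c) r"
  then have "z - a \<in> kball c r" by (simp add: kball_def algebra_simps)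
  then show "z \<in> (\<lambda>z. a + z) ` kball c r" by (intro image_eqI[of _ _ "z - a"]) auto
qed (auto simp: kball_def)

lemma haar_measure_kball:
  fixes c :: "'k::nonarch_local_field ^ 'n::finite"
  assumes "haar_measure \<nu>"
  shows "emeasure \<nu> (kball c r) = emeasure \<nu> (kball 0 r)"
proof -
  have "emeasure \<nu> ((\<lambda>z. c + z) ` kball 0 r) = emeasure \<nu> (kball 0 r)"
    using assms by (simp add: haar_measure_def)
  then show ?thesis by (simp add: kball_translate)
qed

text \<open>A null ball would make all balls null, as each is covered by finitely many translates.\<close>

lemma haar_measure_kball_pos:
  fixes c :: "'k::nonarch_local_field ^ 'n::finite"
  assumes \<nu>: "haar_measure \<nu>" and r: "0 < r"
  shows "0 < emeasure \<nu> (kball c r)"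
proof (rule ccontr)
  assume "\<not> 0 < emeasure \<nu> (kball c r)"
  then have null: "emeasure \<nu> (kball a r) = 0" for a
    using haar_measure_kball[OF \<nu>] by (metis not_gr_zero)
  have sets: "sets \<nu> = sets borel" using \<nu> by (simp add: haar_measure_def)
  have null_kball: "kball (0 :: 'k ^ 'n) (real t) \<in> null_sets \<nu>" for t
  proof -
    obtain F :: "('k ^ 'n) set" where F: "finite F" "kball 0 (real t) \<subseteq> (\<Union>a\<in>F. kball a r)"
      using finite_kball_cover[OF r] by blast
    have "(\<Union>a\<in>F. kball a r) \<in> null_sets \<nu>"
      using F(1) null by (intro null_sets.finite_UN null_setsI) (auto simp: sets)
    then show ?thesis using F(2) sets by (metis kball_borel null_sets_subset)
  qed
  have "(\<Union>t. kball (0 :: 'k ^ 'n) (real t)) \<in> null_sets \<nu>"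
    by (intro null_sets_UN null_kball)
  moreover have "(\<Union>t. kball (0 :: 'k ^ 'n) (real t)) = UNIV"
  proof (intro equalityI subsetI)
    fix z :: "'k ^ 'n"
    obtain t where "maxnorm z \<le> real t" using real_arch_simple by blast
    then show "z \<in> (\<Union>t. kball 0 (real t))" by (auto simp: kball_def)
  qed simp
  ultimately show False using \<nu> by (auto simp: haar_measure_def)
qed

lemma borel_measurable_translate [measurable]:
  "(\<lambda>z. a + z) \<in> borel \<rightarrow>\<^sub>M (borel :: ('k::nonarch_local_field ^ 'n::finite) measure)"
proof (intro borel_measurableI)
  fix S :: "('k ^ 'n) set" assume S: "open S"
  have "open ((\<lambda>z. a + z) -` S)"
  proof (rule open_if_kballs)
    fix z assume "z \<in> (\<lambda>z. a + z) -` S"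
    then obtain r where r: "r > 0" "kball (a + z) r \<subseteq> S" using kball_in_open[OF S] by auto
    then show "\<exists>r>0. kball z r \<subseteq> (\<lambda>z. a + z) -` S"
      using kball_translate[of a z r] by (intro exI[of _ r]) auto
  qed
  then show "(\<lambda>z. a + z) -` S \<inter> space borel \<in> sets borel" by simp
qed


section \<open>Atlases at a fine scale\<close>

text \<open>
  Below the radius \<open>R\<close> everything that a chart shows of the manifold is rigid: balls do not leave
  the overlaps of charts, the density of the measure is constant on them, and transition maps
  are governed by their linear parts.
\<close>

locale fine_atlas =
  fixes \<A> :: "('a::t2_space, 'k::nonarch_local_field, 'n::finite) chart set"
    and \<omega> :: "('a, 'k, 'n) chart \<Rightarrow> 'k ^ 'n \<Rightarrow> 'k"
    and \<nu> :: "('k ^ 'n) measure" and \<mu> :: "'a measure" and R :: real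
  assumes haar: "haar_measure \<nu>"
    and compact_space: "compact (UNIV :: 'a set)"
    and atlas: "analytic_atlas \<A>"
    and finite_atlas: "finite \<A>"
    and compact_cdom: "\<And>\<alpha>. \<alpha> \<in> \<A> \<Longrightarrow> compact (cdom \<alpha>)"
    and nonvanishing: "nowhere_vanishing \<A> \<omega>"
    and form: "form_measure \<nu> \<A> \<omega> \<mu>"
    and R_pos: "0 < R"
    and kball_overlap: "\<And>\<alpha> \<beta> x. \<alpha> \<in> \<A> \<Longrightarrow> \<beta> \<in> \<A> \<Longrightarrow> x \<in> cdom \<alpha> \<Longrightarrow> x \<in> cdom \<beta> \<Longrightarrow>
      kball (cmap \<alpha> x) R \<subseteq> overlap \<alpha> \<beta>"
    and density_constant: "\<And>\<alpha> x z. \<alpha> \<in> \<A> \<Longrightarrow> x \<in> cdom \<alpha> \<Longrightarrow> z \<in> kball (cmap \<alpha> x) R \<Longrightarrow>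
      absv (\<omega> \<alpha> z) = absv (\<omega> \<alpha> (cmap \<alpha> x))"
    and transition_strict: "\<And>\<alpha> \<beta> x. \<alpha> \<in> \<A> \<Longrightarrow> \<beta> \<in> \<A> \<Longrightarrow> x \<in> cdom \<alpha> \<Longrightarrow> x \<in> cdom \<beta> \<Longrightarrow>
      strictly_differentiable (transition \<alpha> \<beta>) (cmap \<alpha> x) R"

lemma fine_atlas_mono:
  assumes "fine_atlas \<A> \<omega> \<nu> \<mu> R" "0 < R'" "R' \<le> R"
  shows "fine_atlas \<A> \<omega> \<nu> \<mu> R'"
proof -
  interpret fine_atlas \<A> \<omega> \<nu> \<mu> R by fact
  have sub: "kball c R' \<subseteq> kball c R" for c :: "('b, 'c) vec"
    using assms(3) by (rule kball_mono)
  show ?thesis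
  proof
    fix \<alpha> \<beta> :: "('a, 'b, 'c) chart" and x
    assume *: "\<alpha> \<in> \<A>" "\<beta> \<in> \<A>" "x \<in> cdom \<alpha>" "x \<in> cdom \<beta>"
    show "kball (cmap \<alpha> x) R' \<subseteq> overlap \<alpha> \<beta>" using kball_overlap[OF *] sub by blast
    show "strictly_differentiable (transition \<alpha> \<beta>) (cmap \<alpha> x) R'"
      using strictly_differentiable_subball[OF transition_strict[OF *]] assms R_pos by simp
  next
    fix \<alpha> :: "('a, 'b, 'c) chart" and x z
    assume "\<alpha> \<in> \<A>" "x \<in> cdom \<alpha>" "z \<in> kball (cmap \<alpha> x) R'"
    then show "absv (\<omega> \<alpha> z) = absv (\<omega> \<alpha> (cmap \<alpha> x))" using density_constant sub by blast
  qed (use assms haar compact_space atlas finite_atlas compact_cdom nonvanishing form in auto)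
qed

lemma analytic_atlas_chart:
  assumes "analytic_atlas \<A>" "\<alpha> \<in> \<A>"
  shows "open (cdom \<alpha>)" "open (cmap \<alpha> ` cdom \<alpha>)" "continuous_on (cdom \<alpha>) (cmap \<alpha>)"
    "inj_on (cmap \<alpha>) (cdom \<alpha>)"
    "continuous_on (cmap \<alpha> ` cdom \<alpha>) (inv_into (cdom \<alpha>) (cmap \<alpha>))"
proof -
  show "open (cdom \<alpha>)" "open (cmap \<alpha> ` cdom \<alpha>)" using assms by (auto simp: analytic_atlas_def)
  obtain g where g: "homeomorphism (cdom \<alpha>) (cmap \<alpha> ` cdom \<alpha>) (cmap \<alpha>) g"
    using assms by (auto simp: analytic_atlas_def)
  then show "continuous_on (cdom \<alpha>) (cmap \<alpha>)" by (simp add: homeomorphism_def)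
  show inj: "inj_on (cmap \<alpha>) (cdom \<alpha>)" 
    using g by (intro inj_on_inverseI[of _ g]) (simp add: homeomorphism_def)
  have "inv_into (cdom \<alpha>) (cmap \<alpha>) z = g z" if "z \<in> cmap \<alpha> ` cdom \<alpha>" for z
    using that g inj by (auto simp: homeomorphism_def)
  then show "continuous_on (cmap \<alpha> ` cdom \<alpha>) (inv_into (cdom \<alpha>) (cmap \<alpha>))"
    using g by (simp add: homeomorphism_def cong: continuous_on_cong)
qed

text \<open>
  The conditions hold near every point of an overlap of two charts and pass to smaller balls. As
  chart domains are compact, hence closed, their overlaps are compact.
\<close>

lemma ex_fine_atlas:
  fixes \<A> :: "('a::t2_space, 'k::nonarch_local_field, 'n::finite) chart set"
  assumes haar: "haar_measure \<nu>" and comp: "compact (UNIV :: 'a set)"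
    and atlas: "analytic_atlas \<A>" and fin: "finite \<A>"
    and compd: "\<forall>\<alpha>\<in>\<A>. compact (cdom \<alpha>)" and an: "analytic_form \<A> \<omega>"
    and nv: "nowhere_vanishing \<A> \<omega>" and form: "form_measure \<nu> \<A> \<omega> \<mu>"
  shows "\<exists>R. fine_atlas \<A> \<omega> \<nu> \<mu> R"
proof -
  define P where "P \<alpha> \<beta> z r \<longleftrightarrow> kball z r \<subseteq> overlap \<alpha> \<beta> \<and>
    (\<forall>w\<in>kball z r. absv (\<omega> \<alpha> w) = absv (\<omega> \<alpha> z)) \<and>
    strictly_differentiable (transition \<alpha> \<beta>) z r" for \<alpha> \<beta> z r
  have PD: "kball z r \<subseteq> overlap \<alpha> \<beta>" "w \<in> kball z r \<Longrightarrow> absv (\<omega> \<alpha> w) = absv (\<omega> \<alpha> z)"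
    "strictly_differentiable (transition \<alpha> \<beta>) z r" if "P \<alpha> \<beta> z r" for \<alpha> \<beta> z r w
    using that unfolding P_def by blast+
  have "\<exists>R>0. \<forall>z\<in>overlap \<alpha> \<beta>. P \<alpha> \<beta> z R" if \<alpha>: "\<alpha> \<in> \<A>" and \<beta>: "\<beta> \<in> \<A>" for \<alpha> \<beta>
  proof (rule uniform_radius)
    have "compact (cdom \<alpha> \<inter> cdom \<beta>)"
      using compd \<alpha> \<beta> by (simp add: compact_Int_closed compact_imp_closed)
    moreover have "continuous_on (cdom \<alpha> \<inter> cdom \<beta>) (cmap \<alpha>)"
      using analytic_atlas_chart(3)[OF atlas \<alpha>] by (rule continuous_on_subset) simp
    ultimately show "compact (overlap \<alpha> \<beta>)" by (rule compact_continuous_image[rotated])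
  next
    fix z assume z: "z \<in> overlap \<alpha> \<beta>"
    have "kanalytic_map_on (overlap \<alpha> \<beta>) (transition \<alpha> \<beta>)"
      using atlas \<alpha> \<beta> by (simp add: analytic_atlas_def)
    from kanalytic_map_on_strictly_differentiable[OF this z]
    obtain r1 where r1: "r1 > 0" "kball z r1 \<subseteq> overlap \<alpha> \<beta>"
        "strictly_differentiable (transition \<alpha> \<beta>) z r1" by blast
    have zc: "z \<in> cmap \<alpha> ` cdom \<alpha>" using z by blast
    then have nz: "\<omega> \<alpha> z \<noteq> 0" using nv \<alpha> unfolding nowhere_vanishing_def by blast
    have "kanalytic_on (cmap \<alpha> ` cdom \<alpha>) (\<omega> \<alpha>)" using an \<alpha> by (simp add: analytic_form_def)
    from kanalytic_on_absv_locally_constant[OF this zc nz] obtain r2 where r2: "r2 > 0" "\<And>w. w \<in> kball z r2 \<Longrightarrow> absv (\<omega> \<alpha> w) = absv (\<omega> \<alpha> z)"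
      by blast
    define r where "r = min r1 r2"
    have r: "0 < r" "r \<le> r1" "r \<le> r2" using r1 r2 by (auto simp: r_def)
    have "kball z r \<subseteq> overlap \<alpha> \<beta>" using kball_mono[OF r(2), of z] r1(2) by blast
    moreover have "\<forall>w\<in>kball z r. absv (\<omega> \<alpha> w) = absv (\<omega> \<alpha> z)"
      using kball_mono[OF r(3), of z] r2(2) by blast
    moreover have "strictly_differentiable (transition \<alpha> \<beta>) z r"
      using r r1(1) by (intro strictly_differentiable_subball[OF r1(3)]) auto
    ultimately have "P \<alpha> \<beta> z r" unfolding P_def by blast
    then show "\<exists>r>0. P \<alpha> \<beta> z r" using r by blast
  next
    fix z w r r' assume *: "P \<alpha> \<beta> z r" "w \<in> kball z r" "0 < r'" "r' \<le> (r::real)"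
    then have sub: "kball w r' \<subseteq> kball z r" by (intro kball_subset[of w]) auto
    have "kball w r' \<subseteq> overlap \<alpha> \<beta>" using sub PD(1)[OF *(1)] by (rule order_trans)
    moreover have "\<forall>v\<in>kball w r'. absv (\<omega> \<alpha> v) = absv (\<omega> \<alpha> w)"
    proof
      fix v assume "v \<in> kball w r'"
      then have "v \<in> kball z r" using sub by blast
      then show "absv (\<omega> \<alpha> v) = absv (\<omega> \<alpha> w)" using PD(2)[OF *(1)] *(2) by metis
    qed
    moreover have "strictly_differentiable (transition \<alpha> \<beta>) w r'"
      by (rule strictly_differentiable_subball[OF PD(3)[OF *(1)] *(2,3,4)])
    ultimately show "P \<alpha> \<beta> w r'" unfolding P_def by blast
  qed
  then have ex: "\<exists>r. r > 0 \<and> (\<forall>z\<in>overlap \<alpha> \<beta>. P \<alpha> \<beta> z r)" if "\<alpha> \<in> \<A>" "\<beta> \<in> \<A>" for \<alpha> \<beta>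
    using that by blast
  define \<rho> where "\<rho> \<alpha> \<beta> = (SOME r. r > 0 \<and> (\<forall>z\<in>overlap \<alpha> \<beta>. P \<alpha> \<beta> z r))" for \<alpha> \<beta>
  have \<rho>: "\<rho> \<alpha> \<beta> > 0" "\<And>z. z \<in> overlap \<alpha> \<beta> \<Longrightarrow> P \<alpha> \<beta> z (\<rho> \<alpha> \<beta>)"
    if "\<alpha> \<in> \<A>" "\<beta> \<in> \<A>" for \<alpha> \<beta>
    using someI_ex[OF ex[OF that]] unfolding \<rho>_def[symmetric] by auto
  define R where "R = Min (insert 1 ((\<lambda>(\<alpha>, \<beta>). \<rho> \<alpha> \<beta>) ` (\<A> \<times> \<A>)))"
  have R: "R > 0" using fin \<rho>(1) unfolding R_def by (subst Min_gr_iff) auto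
  have le: "R \<le> \<rho> \<alpha> \<beta>" if "\<alpha> \<in> \<A>" "\<beta> \<in> \<A>" for \<alpha> \<beta>
    unfolding R_def using fin that by (intro Min_le) auto
  have "fine_atlas \<A> \<omega> \<nu> \<mu> R"
  proof
    fix \<alpha> \<beta> x assume *: "\<alpha> \<in> \<A>" "\<beta> \<in> \<A>" "x \<in> cdom \<alpha>" "x \<in> cdom \<beta>"
    then have P: "P \<alpha> \<beta> (cmap \<alpha> x) (\<rho> \<alpha> \<beta>)" by (intro \<rho>(2)) auto
    show "kball (cmap \<alpha> x) R \<subseteq> overlap \<alpha> \<beta>"
      using PD(1)[OF P] kball_mono[OF le[OF *(1,2)], of "cmap \<alpha> x"] by (rule order_trans[rotated])
    show "strictly_differentiable (transition \<alpha> \<beta>) (cmap \<alpha> x) R"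
      using \<rho>(1)[OF *(1,2)]
      by (intro strictly_differentiable_subball[OF PD(3)[OF P] _ R le[OF *(1,2)]]) simp
  next
    fix \<alpha> x z assume *: "\<alpha> \<in> \<A>" "x \<in> cdom \<alpha>" "z \<in> kball (cmap \<alpha> x) R"
    then have P: "P \<alpha> \<alpha> (cmap \<alpha> x) (\<rho> \<alpha> \<alpha>)" by (intro \<rho>(2)) auto
    show "absv (\<omega> \<alpha> z) = absv (\<omega> \<alpha> (cmap \<alpha> x))"
      using PD(2)[OF P] *(3) kball_mono[OF le[OF *(1,1)], of "cmap \<alpha> x"] by blast
  qed (use assms R in auto)
  then show ?thesis ..
qed

context fine_atlas
begin

lemmas chart = analytic_atlas_chart[OF atlas]

lemma ex_chart: "\<exists>\<alpha>\<in>\<A>. x \<in> cdom \<alpha>"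
  using atlas unfolding analytic_atlas_def by (metis UNIV_I UN_iff)

lemma closed_cdom: "\<alpha> \<in> \<A> \<Longrightarrow> closed (cdom \<alpha>)"
  using compact_cdom compact_imp_closed by blast

lemma cmap_inj: "\<alpha> \<in> \<A> \<Longrightarrow> x \<in> cdom \<alpha> \<Longrightarrow> y \<in> cdom \<alpha> \<Longrightarrow> cmap \<alpha> x = cmap \<alpha> y \<Longrightarrow> x = y"
  using chart(4) by (meson inj_onD)

lemma sets_\<mu> [measurable_cong]: "sets \<mu> = sets borel"
  using form by (simp add: form_measure_def)

lemma space_\<mu> [simp]: "space \<mu> = UNIV"
  using sets_eq_imp_space_eq[OF sets_\<mu>] by simp

lemma sets_\<nu>: "sets \<nu> = sets borel"
  using haar by (simp add: haar_measure_def)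


subsection \<open>Balls in charts\<close>

definition chart_ball :: "('a, 'k, 'n) chart \<Rightarrow> 'a \<Rightarrow> real \<Rightarrow> 'a set" where
  "chart_ball \<alpha> x r = {y \<in> cdom \<alpha>. cmap \<alpha> y \<in> kball (cmap \<alpha> x) r}"

lemma kball_in_chart:
  assumes "\<alpha> \<in> \<A>" "x \<in> cdom \<alpha>" "r \<le> R"
  shows "kball (cmap \<alpha> x) r \<subseteq> cmap \<alpha> ` cdom \<alpha>"
  using kball_overlap[OF assms(1,1,2,2)] kball_mono[OF assms(3), of "cmap \<alpha> x"] by blast

lemma cmap_chart_ball:
  assumes "\<alpha> \<in> \<A>" "x \<in> cdom \<alpha>" "r \<le> R"
  shows "cmap \<alpha> ` chart_ball \<alpha> x r = kball (cmap \<alpha> x) r"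
  using kball_in_chart[OF assms] by (auto simp: chart_ball_def)

lemma centre_in_chart_ball: "x \<in> cdom \<alpha> \<Longrightarrow> 0 \<le> r \<Longrightarrow> x \<in> chart_ball \<alpha> x r"
  by (simp add: chart_ball_def)

lemma chart_ball_subset_cdom: "chart_ball \<alpha> x r \<subseteq> cdom \<alpha>"
  by (auto simp: chart_ball_def)

lemma chart_ball_mono: "r \<le> r' \<Longrightarrow> chart_ball \<alpha> x r \<subseteq> chart_ball \<alpha> x r'"
  using kball_mono[of r r'] by (auto simp: chart_ball_def)

lemma chart_ball_recentre: "y \<in> chart_ball \<alpha> x r \<Longrightarrow> chart_ball \<alpha> y r = chart_ball \<alpha> x r"
  unfolding chart_ball_def using kball_recentre by blast

lemma chart_ball_eqI:
  assumes "\<alpha> \<in> \<A>" "B \<subseteq> cdom \<alpha>" "cmap \<alpha> ` B = kball c r" "x \<in> B"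
  shows "B = chart_ball \<alpha> x r"
proof -
  have "kball (cmap \<alpha> x) r = kball c r" using assms by (intro kball_recentre) auto
  then have "cmap \<alpha> ` B = kball (cmap \<alpha> x) r" using assms by simp
  then show ?thesis using assms(1,2,4) cmap_inj unfolding chart_ball_def by blast
qed

lemma chart_ball_subset_overlap:
  assumes "\<alpha> \<in> \<A>" "\<beta> \<in> \<A>" "x \<in> cdom \<alpha>" "x \<in> cdom \<beta>" "r \<le> R"
  shows "chart_ball \<alpha> x r \<subseteq> cdom \<beta>"
proof
  fix y assume y: "y \<in> chart_ball \<alpha> x r"
  then have "cmap \<alpha> y \<in> overlap \<alpha> \<beta>"
    using kball_overlap[OF assms(1-4)] kball_mono[OF assms(5), of "cmap \<alpha> x"]
    by (auto simp: chart_ball_def)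
  then show "y \<in> cdom \<beta>" using y cmap_inj[OF assms(1)] by (auto simp: chart_ball_def)
qed

lemma chart_ball_cdom_iff:
  assumes "\<alpha> \<in> \<A>" "\<beta> \<in> \<A>" "x \<in> cdom \<alpha>" "0 < r" "r \<le> R" "y \<in> chart_ball \<alpha> x r"
  shows "y \<in> cdom \<beta> \<longleftrightarrow> x \<in> cdom \<beta>"
proof -
  have "y \<in> cdom \<alpha>" "x \<in> chart_ball \<alpha> y r"
    using assms centre_in_chart_ball[of x \<alpha> r] chart_ball_recentre[OF assms(6)]
    by (auto simp: chart_ball_def)
  then show ?thesis using assms chart_ball_subset_overlap by blast
qed

lemma open_chart_ball:
  assumes "\<alpha> \<in> \<A>" "0 < r"
  shows "open (chart_ball \<alpha> x r)"
proof -
  have "open (cmap \<alpha> -` kball (cmap \<alpha> x) r \<inter> cdom \<alpha>)"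
    using chart[OF assms(1)] open_kball[OF assms(2)] by (metis continuous_on_open_vimage)
  also have "cmap \<alpha> -` kball (cmap \<alpha> x) r \<inter> cdom \<alpha> = chart_ball \<alpha> x r"
    by (auto simp: chart_ball_def)
  finally show ?thesis .
qed

lemma closed_chart_ball:
  assumes "\<alpha> \<in> \<A>"
  shows "closed (chart_ball \<alpha> x r)"
proof -
  have "closed (cmap \<alpha> -` kball (cmap \<alpha> x) r \<inter> cdom \<alpha>)"
    using chart(3)[OF assms] closed_cdom[OF assms] closed_kball by (metis continuous_on_closed_vimage)
  also have "cmap \<alpha> -` kball (cmap \<alpha> x) r \<inter> cdom \<alpha> = chart_ball \<alpha> x r"
    by (auto simp: chart_ball_def)
  finally show ?thesis .
qed

lemma chart_ball_sets [measurable]: "\<alpha> \<in> \<A> \<Longrightarrow> chart_ball \<alpha> x r \<in> sets \<mu>"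
  using closed_chart_ball by (simp add: sets_\<mu> borel_closed)

lemma open_contains_chart_ball:
  assumes "open V" "x \<in> V" "\<alpha> \<in> \<A>" "x \<in> cdom \<alpha>"
  obtains r where "0 < r" "r \<le> R" "chart_ball \<alpha> x r \<subseteq> V"
proof -
  have "open (inv_into (cdom \<alpha>) (cmap \<alpha>) -` V \<inter> cmap \<alpha> ` cdom \<alpha>)"
    using chart[OF assms(3)] assms(1) by (metis continuous_on_open_vimage)
  moreover have "cmap \<alpha> x \<in> inv_into (cdom \<alpha>) (cmap \<alpha>) -` V \<inter> cmap \<alpha> ` cdom \<alpha>"
    using assms chart(4)[OF assms(3)] by simp
  ultimately obtain r where r: "0 < r"
    "kball (cmap \<alpha> x) r \<subseteq> inv_into (cdom \<alpha>) (cmap \<alpha>) -` V \<inter> cmap \<alpha> ` cdom \<alpha>"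
    using kball_in_open by blast
  have "chart_ball \<alpha> x (min r R) \<subseteq> V"
  proof
    fix y assume y: "y \<in> chart_ball \<alpha> x (min r R)"
    then have "y \<in> cdom \<alpha>" "cmap \<alpha> y \<in> kball (cmap \<alpha> x) r"
      using kball_mono[of "min r R" r "cmap \<alpha> x"] by (auto simp: chart_ball_def)
    then show "y \<in> V" using r(2) chart(4)[OF assms(3)] by auto
  qed
  then show ?thesis using that[of "min r R"] r(1) R_pos by simp
qed

lemma cmap_image_sets:
  assumes "\<alpha> \<in> \<A>" "S \<in> sets borel" "S \<subseteq> cdom \<alpha>"
  shows "cmap \<alpha> ` S \<in> sets borel"
proof -
  let ?U = "cmap \<alpha> ` cdom \<alpha>" and ?g = "inv_into (cdom \<alpha>) (cmap \<alpha>)"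
  have "?g \<in> borel_measurable (restrict_space borel ?U)"
    using chart(5)[OF assms(1)] by (rule borel_measurable_continuous_on_restrict)
  then have "?g -` S \<inter> space (restrict_space borel ?U) \<in> sets (restrict_space borel ?U)"
    using assms(2) by (rule measurable_sets)
  moreover have "?g -` S \<inter> space (restrict_space borel ?U) = cmap \<alpha> ` S"
    using assms(3) chart(4)[OF assms(1)] by (auto simp: space_restrict_space)
  moreover have "?U \<in> sets borel" using chart(2)[OF assms(1)] by (rule borel_open)
  ultimately show ?thesis by (simp add: sets_restrict_space_iff)
qed

lemma emeasure_in_chart_ball:
  assumes \<alpha>: "\<alpha> \<in> \<A>" and x: "x \<in> cdom \<alpha>" and r: "r \<le> R"
    and S: "S \<in> sets borel" "S \<subseteq> chart_ball \<alpha> x r"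
  shows "emeasure \<mu> S = ennreal (absv (\<omega> \<alpha> (cmap \<alpha> x))) * emeasure \<nu> (cmap \<alpha> ` S)"
proof -
  have S': "S \<subseteq> cdom \<alpha>" using S(2) chart_ball_subset_cdom by blast
  have "emeasure \<mu> S = (\<integral>\<^sup>+z \<in> cmap \<alpha> ` S. ennreal (absv (\<omega> \<alpha> z)) \<partial>\<nu>)"
    using form \<alpha> S S' by (simp add: form_measure_def)
  also have "\<dots> = (\<integral>\<^sup>+z. ennreal (absv (\<omega> \<alpha> (cmap \<alpha> x))) * indicator (cmap \<alpha> ` S) z \<partial>\<nu>)"
  proof (intro nn_integral_cong)
    fix z
    have "cmap \<alpha> ` S \<subseteq> kball (cmap \<alpha> x) R"
      using S(2) kball_mono[OF r, of "cmap \<alpha> x"] by (auto simp: chart_ball_def)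
    then show "ennreal (absv (\<omega> \<alpha> z)) * indicator (cmap \<alpha> ` S) z =
        ennreal (absv (\<omega> \<alpha> (cmap \<alpha> x))) * indicator (cmap \<alpha> ` S) z"
      using density_constant[OF \<alpha> x, of z] by (auto split: split_indicator)
  qed
  also have "\<dots> = ennreal (absv (\<omega> \<alpha> (cmap \<alpha> x))) * emeasure \<nu> (cmap \<alpha> ` S)"
    using cmap_image_sets[OF \<alpha> S(1) S'] by (intro nn_integral_cmult_indicator) (simp add: sets_\<nu>)
  finally show ?thesis .
qed

lemma emeasure_chart_ball:
  assumes "\<alpha> \<in> \<A>" "x \<in> cdom \<alpha>" "r \<le> R"
  shows "emeasure \<mu> (chart_ball \<alpha> x r) =
    ennreal (absv (\<omega> \<alpha> (cmap \<alpha> x))) * emeasure \<nu> (kball 0 r)"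
  using emeasure_in_chart_ball[OF assms, of "chart_ball \<alpha> x r"] cmap_chart_ball[OF assms]
    haar_measure_kball[OF haar, of "cmap \<alpha> x" r] chart_ball_sets[OF assms(1), of x r] by (simp add: sets_\<mu>)

lemma emeasure_chart_ball_pos:
  assumes "\<alpha> \<in> \<A>" "x \<in> cdom \<alpha>" "0 < r" "r \<le> R"
  shows "0 < emeasure \<mu> (chart_ball \<alpha> x r)"
proof -
  have "\<omega> \<alpha> (cmap \<alpha> x) \<noteq> 0" using nonvanishing assms by (simp add: nowhere_vanishing_def)
  then show ?thesis
    using assms haar_measure_kball_pos[OF haar, of r 0] by (simp add: emeasure_chart_ball ennreal_zero_less_mult_iff)
qed

lemma emeasure_chart_ball_finite:
  assumes "\<alpha> \<in> \<A>" "x \<in> cdom \<alpha>" "r \<le> R"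
  shows "emeasure \<mu> (chart_ball \<alpha> x r) < \<infinity>"
proof -
  have "compact (cmap \<alpha> ` cdom \<alpha>)"
    using compact_continuous_image chart(3) compact_cdom assms(1) by blast
  then have "compact (cmap \<alpha> ` cdom \<alpha> \<inter> kball (cmap \<alpha> x) r)"
    using closed_kball by (rule compact_Int_closed)
  moreover have "cmap \<alpha> ` cdom \<alpha> \<inter> kball (cmap \<alpha> x) r = kball (cmap \<alpha> x) r"
    using kball_in_chart[OF assms] by blast
  ultimately have "emeasure \<nu> (kball (cmap \<alpha> x) r) < \<infinity>" using haar by (simp add: haar_measure_def)
  then show ?thesis
    using emeasure_chart_ball[OF assms] haar_measure_kball[OF haar, of "cmap \<alpha> x" r]
    by (simp add: ennreal_mult_less_top)
qed

lemma emeasure_open_pos: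
  assumes "open V" "V \<noteq> {}"
  shows "0 < emeasure \<mu> V"
proof -
  obtain x \<alpha> where x: "x \<in> V" "\<alpha> \<in> \<A>" "x \<in> cdom \<alpha>" using assms ex_chart by blast
  obtain r where r: "0 < r" "r \<le> R" "chart_ball \<alpha> x r \<subseteq> V"
    using open_contains_chart_ball[OF assms(1) x] .
  have "0 < emeasure \<mu> (chart_ball \<alpha> x r)" using emeasure_chart_ball_pos x r by blast
  also have "\<dots> \<le> emeasure \<mu> V" using r assms by (intro emeasure_mono) (auto simp: sets_\<mu>)
  finally show ?thesis .
qed

lemma finite_chart_ball_cover:
  assumes "\<alpha> \<in> \<A>" "0 < r"
  obtains F where "finite F" "F \<subseteq> cdom \<alpha>" "cdom \<alpha> \<subseteq> (\<Union>x\<in>F. chart_ball \<alpha> x r)"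
proof -
  have "cdom \<alpha> \<subseteq> (\<Union>x\<in>cdom \<alpha>. chart_ball \<alpha> x r)"
    using assms centre_in_chart_ball by (metis UN_I less_imp_le subsetI)
  then show ?thesis
    using compactE_image[OF compact_cdom[OF assms(1)], of "cdom \<alpha>" "\<lambda>x. chart_ball \<alpha> x r"]
      open_chart_ball[OF assms] that by metis
qed

lemma finite_measure_\<mu>: "finite_measure \<mu>"
proof
  have "emeasure \<mu> (cdom \<alpha>) < \<infinity>" if \<alpha>: "\<alpha> \<in> \<A>" for \<alpha>
  proof -
    obtain F where F: "finite F" "F \<subseteq> cdom \<alpha>" "cdom \<alpha> \<subseteq> (\<Union>x\<in>F. chart_ball \<alpha> x R)"
      using finite_chart_ball_cover[OF \<alpha> R_pos] .
    have "emeasure \<mu> (cdom \<alpha>) \<le> emeasure \<mu> (\<Union>x\<in>F. chart_ball \<alpha> x R)"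
      using F \<alpha> by (intro emeasure_mono) auto
    also have "\<dots> \<le> (\<Sum>x\<in>F. emeasure \<mu> (chart_ball \<alpha> x R))"
      using F \<alpha> by (intro emeasure_subadditive_finite) auto
    also have "\<dots> < \<infinity>"
      using F emeasure_chart_ball_finite[OF \<alpha> _ order_refl]
      by (simp add: infinity_ennreal_def subset_iff)
    finally show ?thesis .
  qed
  then have "(\<Sum>\<alpha>\<in>\<A>. emeasure \<mu> (cdom \<alpha>)) < \<infinity>" using finite_atlas by (auto simp: infinity_ennreal_def)
  moreover have "emeasure \<mu> (\<Union>\<alpha>\<in>\<A>. cdom \<alpha>) \<le> (\<Sum>\<alpha>\<in>\<A>. emeasure \<mu> (cdom \<alpha>))"
    using finite_atlas chart(1) by (intro emeasure_subadditive_finite) (auto simp: sets_\<mu>)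
  moreover have "(\<Union>\<alpha>\<in>\<A>. cdom \<alpha>) = UNIV" using ex_chart by blast
  ultimately show "emeasure \<mu> (space \<mu>) \<noteq> \<infinity>" by auto
qed

sublocale finite_measure \<mu>
  by (rule finite_measure_\<mu>)

lemma measure_chart_ball_eq:
  assumes "\<alpha> \<in> \<A>" "x \<in> cdom \<alpha>" "r \<le> R" "y \<in> chart_ball \<alpha> x R"
  shows "measure \<mu> (chart_ball \<alpha> y r) = measure \<mu> (chart_ball \<alpha> x r)"
proof -
  have "y \<in> cdom \<alpha>" "cmap \<alpha> y \<in> kball (cmap \<alpha> x) R" using assms(4) by (auto simp: chart_ball_def)
  then show ?thesis
    using assms emeasure_chart_ball density_constant by (simp add: measure_def)
qed

subsection \<open>Translations inside a chart\<close>

definition shift :: "('a, 'k, 'n) chart \<Rightarrow> 'a \<Rightarrow> real \<Rightarrow> 'k ^ 'n \<Rightarrow> 'a \<Rightarrow> 'a" where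
  "shift \<alpha> x r t y = (if y \<in> chart_ball \<alpha> x r then inv_into (cdom \<alpha>) (cmap \<alpha>) (t + cmap \<alpha> y) else y)"

lemma shift_outside: "y \<notin> chart_ball \<alpha> x r \<Longrightarrow> shift \<alpha> x r t y = y"
  by (simp add: shift_def)

lemma shift_inside:
  assumes "\<alpha> \<in> \<A>" "x \<in> cdom \<alpha>" "r \<le> R" "maxnorm t \<le> r" "y \<in> chart_ball \<alpha> x r"
  shows "shift \<alpha> x r t y \<in> chart_ball \<alpha> x r" "cmap \<alpha> (shift \<alpha> x r t y) = t + cmap \<alpha> y"
proof -
  have "t + cmap \<alpha> y \<in> kball (cmap \<alpha> y) r" using assms(4) by (simp add: kball_def)
  also have "kball (cmap \<alpha> y) r = kball (cmap \<alpha> x) r"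
    using assms(5) by (intro kball_recentre) (simp add: chart_ball_def)
  finally have ball: "t + cmap \<alpha> y \<in> kball (cmap \<alpha> x) r" .
  then have "t + cmap \<alpha> y \<in> cmap \<alpha> ` cdom \<alpha>" using kball_in_chart[OF assms(1-3)] by blast
  then have "inv_into (cdom \<alpha>) (cmap \<alpha>) (t + cmap \<alpha> y) \<in> cdom \<alpha>"
    and eq: "cmap \<alpha> (inv_into (cdom \<alpha>) (cmap \<alpha>) (t + cmap \<alpha> y)) = t + cmap \<alpha> y"
    by (auto intro: inv_into_into f_inv_into_f)
  then show "shift \<alpha> x r t y \<in> chart_ball \<alpha> x r" "cmap \<alpha> (shift \<alpha> x r t y) = t + cmap \<alpha> y"
    using ball assms(5) by (auto simp: shift_def chart_ball_def)
qed

lemma cmap_vimage_sets: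
  assumes "\<alpha> \<in> \<A>" "W \<in> sets borel"
  shows "cmap \<alpha> -` W \<inter> cdom \<alpha> \<in> sets borel"
proof -
  have "cmap \<alpha> \<in> borel_measurable (restrict_space borel (cdom \<alpha>))"
    using chart(3)[OF assms(1)] by (rule borel_measurable_continuous_on_restrict)
  then have "cmap \<alpha> -` W \<inter> space (restrict_space borel (cdom \<alpha>)) \<in> sets (restrict_space borel (cdom \<alpha>))"
    using assms(2) by (rule measurable_sets)
  moreover have "cdom \<alpha> \<in> sets borel" using chart(1)[OF assms(1)] by (rule borel_open)
  ultimately show ?thesis by (simp add: sets_restrict_space_iff space_restrict_space)
qed

text \<open>
  In a chart the measure is a constant multiple of Haar measure on small balls, hence invariant
  under translations.
\<close>

lemma
  assumes \<alpha>: "\<alpha> \<in> \<A>" and x: "x \<in> cdom \<alpha>" and r: "0 < r" "r \<le> R" and t: "maxnorm t \<le> r"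
  shows measurable_shift: "shift \<alpha> x r t \<in> \<mu> \<rightarrow>\<^sub>M \<mu>"
    and distr_shift: "distr \<mu> \<mu> (shift \<alpha> x r t) = \<mu>"
proof -
  let ?B = "chart_ball \<alpha> x r" and ?T = "shift \<alpha> x r t"
  have B: "?B \<in> sets borel" using chart_ball_sets[OF \<alpha>] by (simp add: sets_\<mu>)
  have key: "?T -` S \<in> sets borel \<and> emeasure \<mu> (?T -` S) = emeasure \<mu> S" if S: "S \<in> sets borel" for S
  proof -
    let ?W = "cmap \<alpha> ` (S \<inter> ?B)"
    let ?V = "(cmap \<alpha> -` ((\<lambda>z. t + z) -` ?W) \<inter> cdom \<alpha>) \<inter> ?B"
    have SB: "S \<inter> ?B \<in> sets borel" using S B by auto
    then have W: "?W \<in> sets borel"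
      using cmap_image_sets[OF \<alpha>] chart_ball_subset_cdom by (metis inf.coboundedI2)
    have "(\<lambda>z. t + z) -` ?W \<inter> space borel \<in> sets borel"
      using borel_measurable_translate W by (rule measurable_sets)
    then have V: "?V \<in> sets borel" using cmap_vimage_sets[OF \<alpha>] B by auto
    have V_eq: "?V = {y \<in> ?B. ?T y \<in> S}"
    proof (intro equalityI subsetI)
      fix y assume y: "y \<in> ?V"
      then obtain s where s: "s \<in> S" "s \<in> ?B" "t + cmap \<alpha> y = cmap \<alpha> s" by auto
      have "?T y = s"
        using shift_inside[OF \<alpha> x r(2) t, of y] y s by (intro cmap_inj[OF \<alpha>]) (auto simp: chart_ball_def)
      then show "y \<in> {y \<in> ?B. ?T y \<in> S}" using y s by simp
    next
      fix y assume y: "y \<in> {y \<in> ?B. ?T y \<in> S}"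
      then have "t + cmap \<alpha> y \<in> ?W"
        using shift_inside[OF \<alpha> x r(2) t, of y] by (intro image_eqI[of _ _ "?T y"]) auto
      then show "y \<in> ?V" using y by (auto simp: chart_ball_def)
    qed
    have split: "?T -` S = ?V \<union> (S - ?B)"
    proof (rule set_eqI)
      fix y
      show "y \<in> ?T -` S \<longleftrightarrow> y \<in> ?V \<union> (S - ?B)"
        unfolding V_eq by (cases "y \<in> ?B") (simp_all add: shift_outside)
    qed
    have "cmap \<alpha> ` ?V = (\<lambda>z. - t + z) ` ?W"
    proof (intro equalityI subsetI)
      fix z assume "z \<in> (\<lambda>z. - t + z) ` ?W"
      then obtain s where s: "s \<in> S" "s \<in> ?B" "z = - t + cmap \<alpha> s" by auto
      have t': "maxnorm (- t) \<le> r" using t by (simp add: maxnorm_def)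
      note sh = shift_inside[OF \<alpha> x r(2) t' s(2)]
      show "z \<in> cmap \<alpha> ` ?V"
      proof (intro image_eqI[of _ _ "shift \<alpha> x r (- t) s"])
        show "z = cmap \<alpha> (shift \<alpha> x r (- t) s)" using sh(2) s(3) by simp
        have "t + cmap \<alpha> (shift \<alpha> x r (- t) s) = cmap \<alpha> s" using sh(2) by simp
        then show "shift \<alpha> x r (- t) s \<in> ?V" using sh(1) s by (auto simp: chart_ball_def)
      qed
    next
      fix z assume "z \<in> cmap \<alpha> ` ?V"
      then obtain y where y: "z = cmap \<alpha> y" "t + cmap \<alpha> y \<in> ?W" by auto
      then show "z \<in> (\<lambda>z. - t + z) ` ?W" by (intro image_eqI[of _ _ "t + cmap \<alpha> y"]) auto
    qed
    moreover have "emeasure \<nu> ((\<lambda>z. - t + z) ` ?W) = emeasure \<nu> ?W"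
      using haar W unfolding haar_measure_def by blast
    ultimately have "emeasure \<nu> (cmap \<alpha> ` ?V) = emeasure \<nu> ?W" by (simp only:)
    then have "emeasure \<mu> ?V = emeasure \<mu> (S \<inter> ?B)"
      using emeasure_in_chart_ball[OF \<alpha> x r(2) V] emeasure_in_chart_ball[OF \<alpha> x r(2) SB] by simp
    moreover have "emeasure \<mu> (?V \<union> (S - ?B)) = emeasure \<mu> ?V + emeasure \<mu> (S - ?B)"
      using V S B by (intro plus_emeasure[symmetric]) (auto simp: sets_\<mu>)
    moreover have "emeasure \<mu> (S \<inter> ?B) + emeasure \<mu> (S - ?B) = emeasure \<mu> ((S \<inter> ?B) \<union> (S - ?B))"
      using SB S B by (intro plus_emeasure) (auto simp: sets_\<mu>)
    moreover have "(S \<inter> ?B) \<union> (S - ?B) = S" by blast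
    ultimately have "emeasure \<mu> (?T -` S) = emeasure \<mu> S" using split by simp
    moreover have "?T -` S \<in> sets borel" using split V S B by auto
    ultimately show ?thesis by simp
  qed
  show T: "?T \<in> \<mu> \<rightarrow>\<^sub>M \<mu>" using key by (intro measurableI) (auto simp: sets_\<mu>)
  show "distr \<mu> \<mu> ?T = \<mu>"
    using key by (intro measure_eqI) (simp_all add: emeasure_distr[OF T] sets_\<mu>)
qed

lemma integral_shift:
  fixes f :: "'a \<Rightarrow> 'b::{banach, second_countable_topology}"
  assumes "\<alpha> \<in> \<A>" "x \<in> cdom \<alpha>" "0 < r" "r \<le> R" "maxnorm t \<le> r" "f \<in> borel_measurable \<mu>"
  shows "(\<integral>y. f (shift \<alpha> x r t y) \<partial>\<mu>) = (\<integral>y. f y \<partial>\<mu>)"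
  using integral_distr[OF measurable_shift[OF assms(1-5)] assms(6)]
  by (simp add: distr_shift[OF assms(1-5)])


subsection \<open>Small balls of the manifold\<close>

lemma mball_radius_pos: "mball_radius \<A> r B \<Longrightarrow> 0 < r"
  by (simp add: mball_radius_def)

lemma mball_radius_chart: "mball_radius \<A> r B \<Longrightarrow> \<exists>\<alpha>\<in>\<A>. B \<subseteq> cdom \<alpha>"
  unfolding mball_radius_def by (elim conjE)

lemma mball_radius_image:
  "mball_radius \<A> r B \<Longrightarrow> \<alpha> \<in> \<A> \<Longrightarrow> B \<subseteq> cdom \<alpha> \<Longrightarrow> \<exists>c. cmap \<alpha> ` B = kball c r"
  unfolding mball_radius_def by (elim conjE) (drule (1) bspec, erule (1) mp)

lemma mball_radius_nonempty:
  assumes "mball_radius \<A> r B"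
  shows "B \<noteq> {}"
proof
  assume "B = {}"
  obtain \<alpha> where "\<alpha> \<in> \<A>" "B \<subseteq> cdom \<alpha>" using mball_radius_chart[OF assms] by blast
  then obtain c where "cmap \<alpha> ` B = kball c r" using mball_radius_image[OF assms] by blast
  moreover have "c \<in> kball c r" using mball_radius_pos[OF assms] by (intro centre_in_kball) simp
  ultimately show False using \<open>B = {}\<close> by simp
qed

lemma mball_in_chart:
  assumes "mball_radius \<A> r B" "\<alpha> \<in> \<A>" "B \<subseteq> cdom \<alpha>" "x \<in> B"
  shows "B = chart_ball \<alpha> x r"
proof -
  obtain c where "cmap \<alpha> ` B = kball c r" using mball_radius_image[OF assms(1-3)] by blast
  then show ?thesis using assms by (intro chart_ball_eqI[of \<alpha> B c r x])
qed

lemma small_mball_eq: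
  assumes B: "mball_radius \<A> r B" "r \<le> R" and x: "x \<in> B" and \<alpha>: "\<alpha> \<in> \<A>" "x \<in> cdom \<alpha>"
  shows "B = chart_ball \<alpha> x r"
proof -
  obtain \<beta> where \<beta>: "\<beta> \<in> \<A>" "B \<subseteq> cdom \<beta>" using mball_radius_chart[OF B(1)] by blast
  then have "B = chart_ball \<beta> x r" using mball_in_chart[OF B(1)] x by blast
  then have "B \<subseteq> cdom \<alpha>"
    using chart_ball_subset_overlap[OF \<beta>(1) \<alpha>(1) _ \<alpha>(2) B(2)] x \<beta>(2) by blast
  then show ?thesis using mball_in_chart[OF B(1) \<alpha>(1)] x by blast
qed

text \<open>
  A small ball is contained in every chart that it meets. So it can be compared in one chart with
  any ball of the manifold, however large.
\<close>

lemma small_mball_nested: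
  assumes B: "mball_radius \<A> r B" "r \<le> R" and B': "mball_radius \<A> r' B'" and x: "x \<in> B" "x \<in> B'"
  shows "if r \<le> r' then B \<subseteq> B' else B' \<subseteq> B"
proof -
  obtain \<beta> where \<beta>: "\<beta> \<in> \<A>" "B' \<subseteq> cdom \<beta>" using mball_radius_chart[OF B'] by blast
  then have "B' = chart_ball \<beta> x r'" using mball_in_chart[OF B'] x by blast
  moreover have "B = chart_ball \<beta> x r" using small_mball_eq[OF B x(1) \<beta>(1)] \<beta>(2) x(2) by blast
  ultimately show ?thesis using chart_ball_mono by (auto simp: not_le less_imp_le)
qed

lemma no_partial_overlap: "no_partial_overlap \<A> R"
  unfolding no_partial_overlap_def
proof (intro allI impI)
  fix B B' r r'
  assume *: "r \<le> R \<and> r' \<le> R \<and> mball_radius \<A> r B \<and> mball_radius \<A> r' B'"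
  show "B \<inter> B' = {} \<or> B \<subseteq> B' \<or> B' \<subseteq> B"
  proof (cases "B \<inter> B' = {}")
    case False
    then obtain x where "x \<in> B" "x \<in> B'" by blast
    then show ?thesis using small_mball_nested[of r B r' B' x] * by (simp split: if_splits)
  qed simp
qed

lemma transition_cmap: "\<alpha> \<in> \<A> \<Longrightarrow> y \<in> cdom \<alpha> \<Longrightarrow> transition \<alpha> \<beta> (cmap \<alpha> y) = cmap \<beta> y"
  using chart(4) by (simp add: transition_def)

text \<open>
  The transition maps between charts around \<open>x\<close> respect one small ball at \<open>x\<close>. So by homogeneity
  of their linear parts they are contractions at the scale \<open>R\<close>, in both directions, and thus
  respect all balls at this scale. It follows that the maximal balls of radius at most \<open>R\<close> all
  have radius \<open>R\<close>.
\<close>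

lemma chart_ball_subset_if_mball:
  assumes B: "mball_radius \<A> r B" "r \<le> R" "x \<in> B"
    and \<alpha>: "\<alpha> \<in> \<A>" "x \<in> cdom \<alpha>" and \<beta>: "\<beta> \<in> \<A>" "x \<in> cdom \<beta>" and r': "r' \<le> R"
  shows "chart_ball \<alpha> x r' \<subseteq> chart_ball \<beta> x r'"
proof
  fix y assume y: "y \<in> chart_ball \<alpha> x r'"
  have y\<alpha>: "y \<in> cdom \<alpha>" using y by (simp add: chart_ball_def)
  have y\<beta>: "y \<in> cdom \<beta>" using y chart_ball_subset_overlap[OF \<alpha>(1) \<beta>(1) \<alpha>(2) \<beta>(2) r'] by blast
  let ?F = "transition \<alpha> \<beta>"
  have Fx: "?F (cmap \<alpha> x) = cmap \<beta> x" and Fy: "?F (cmap \<alpha> y) = cmap \<beta> y"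
    using transition_cmap \<alpha> y\<alpha> by auto
  have "maxnorm (?F (cmap \<alpha> y) - ?F (cmap \<alpha> x)) \<le> maxnorm (cmap \<alpha> y - cmap \<alpha> x)"
  proof (rule strictly_differentiable_contraction[OF transition_strict[OF \<alpha>(1) \<beta>(1) \<alpha>(2) \<beta>(2)]
      mball_radius_pos[OF B(1)] B(2)])
    show "?F ` kball (cmap \<alpha> x) r \<subseteq> kball (?F (cmap \<alpha> x)) r"
    proof
      fix w assume "w \<in> ?F ` kball (cmap \<alpha> x) r"
      then have "w \<in> ?F ` cmap \<alpha> ` chart_ball \<alpha> x r" by (simp only: cmap_chart_ball[OF \<alpha> B(2)])
      then obtain z where z: "z \<in> chart_ball \<alpha> x r" "w = ?F (cmap \<alpha> z)" by (elim imageE) simp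
      have "chart_ball \<alpha> x r = chart_ball \<beta> x r"
        using small_mball_eq[OF B \<alpha>] small_mball_eq[OF B \<beta>] by simp
      then have "cmap \<beta> z \<in> kball (cmap \<beta> x) r" using z(1) by (auto simp: chart_ball_def)
      moreover have "w = cmap \<beta> z" using z transition_cmap \<alpha> by (auto simp: chart_ball_def)
      ultimately show "w \<in> kball (?F (cmap \<alpha> x)) r" using Fx by simp
    qed
    show "cmap \<alpha> y \<in> kball (cmap \<alpha> x) R"
      using y kball_mono[OF r', of "cmap \<alpha> x"] by (auto simp: chart_ball_def)
    show "cmap \<alpha> x \<in> kball (cmap \<alpha> x) R" using R_pos by simp
  qed
  then show "y \<in> chart_ball \<beta> x r'" using y y\<beta> Fx Fy by (simp add: chart_ball_def kball_def)
qed

lemma mball_chart_ball: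
  assumes B: "mball_radius \<A> r B" "r \<le> R" "x \<in> B" and \<alpha>: "\<alpha> \<in> \<A>" "x \<in> cdom \<alpha>"
    and r': "0 < r'" "r' \<le> R"
  shows "mball_radius \<A> r' (chart_ball \<alpha> x r')"
  unfolding mball_radius_def
proof (intro conjI ballI impI r')
  show "\<exists>\<beta>\<in>\<A>. chart_ball \<alpha> x r' \<subseteq> cdom \<beta>" using chart_ball_subset_cdom \<alpha> by blast
  fix \<beta> assume \<beta>: "\<beta> \<in> \<A>" "chart_ball \<alpha> x r' \<subseteq> cdom \<beta>"
  then have x\<beta>: "x \<in> cdom \<beta>" using centre_in_chart_ball[OF \<alpha>(2), of r'] r' by auto
  then have "chart_ball \<alpha> x r' = chart_ball \<beta> x r'"
    using chart_ball_subset_if_mball[OF B \<alpha> \<beta>(1) x\<beta> r'(2)]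
      chart_ball_subset_if_mball[OF B \<beta>(1) x\<beta> \<alpha> r'(2)] by blast
  then show "\<exists>c. cmap \<beta> ` chart_ball \<alpha> x r' = kball c r'"
    using cmap_chart_ball[OF \<beta>(1) x\<beta> r'(2)] by auto
qed

lemma mball_open:
  assumes "mball_radius \<A> r B"
  shows "open B"
proof -
  obtain \<beta> where \<beta>: "\<beta> \<in> \<A>" "B \<subseteq> cdom \<beta>" using mball_radius_chart[OF assms] by blast
  moreover obtain x where "x \<in> B" using mball_radius_nonempty[OF assms] by blast
  ultimately have "B = chart_ball \<beta> x r" using mball_in_chart[OF assms] by blast
  then show ?thesis using open_chart_ball[OF \<beta>(1) mball_radius_pos[OF assms]] by simp
qed

lemma mball_closed:
  assumes "mball_radius \<A> r B"
  shows "closed B"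
proof -
  obtain \<beta> where \<beta>: "\<beta> \<in> \<A>" "B \<subseteq> cdom \<beta>" using mball_radius_chart[OF assms] by blast
  moreover obtain x where "x \<in> B" using mball_radius_nonempty[OF assms] by blast
  ultimately have "B = chart_ball \<beta> x r" using mball_in_chart[OF assms] by blast
  then show ?thesis using closed_chart_ball[OF \<beta>(1)] by simp
qed

lemma mball_sets [measurable]: "mball_radius \<A> r B \<Longrightarrow> B \<in> sets \<mu>"
  using mball_closed by (simp add: sets_\<mu> borel_closed)

text \<open>
  Finitely many balls of radius \<open>\<rho>\<close> cover the manifold, and a small ball of larger radius is
  determined by which of them it contains.
\<close>

lemma finite_mballs_above:
  assumes "0 < \<rho>"
  shows "finite {B. \<exists>r. \<rho> \<le> r \<and> r \<le> R \<and> mball_radius \<A> r B}"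
proof -
  define net where "net \<alpha> F \<longleftrightarrow> finite F \<and> F \<subseteq> cdom \<alpha> \<and> cdom \<alpha> \<subseteq> (\<Union>x\<in>F. chart_ball \<alpha> x \<rho>)"
    for \<alpha> F
  have ex: "\<exists>F. net \<alpha> F" if "\<alpha> \<in> \<A>" for \<alpha>
    by (rule finite_chart_ball_cover[OF that assms]) (auto simp: net_def)
  define F where "F \<alpha> = (SOME F. net \<alpha> F)" for \<alpha>
  have "net \<alpha> (F \<alpha>)" if "\<alpha> \<in> \<A>" for \<alpha>
    using someI_ex[OF ex[OF that]] by (simp add: F_def)
  then have F: "finite (F \<alpha>)" "F \<alpha> \<subseteq> cdom \<alpha>" "cdom \<alpha> \<subseteq> (\<Union>x\<in>F \<alpha>. chart_ball \<alpha> x \<rho>)"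
    if "\<alpha> \<in> \<A>" for \<alpha>
    using that by (auto simp: net_def)
  let ?f = "\<lambda>(\<alpha>, G). \<Union>x\<in>G. chart_ball \<alpha> x \<rho>"
  have "{B. \<exists>r. \<rho> \<le> r \<and> r \<le> R \<and> mball_radius \<A> r B} \<subseteq> ?f ` (SIGMA \<alpha>:\<A>. Pow (F \<alpha>))"
  proof
    fix B assume "B \<in> {B. \<exists>r. \<rho> \<le> r \<and> r \<le> R \<and> mball_radius \<A> r B}"
    then obtain r where r: "\<rho> \<le> r" "r \<le> R" and B: "mball_radius \<A> r B" by blast
    obtain \<alpha> where \<alpha>: "\<alpha> \<in> \<A>" "B \<subseteq> cdom \<alpha>" using mball_radius_chart[OF B] by blast
    have "B = (\<Union>x\<in>F \<alpha> \<inter> B. chart_ball \<alpha> x \<rho>)"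
    proof (intro equalityI subsetI)
      fix y assume y: "y \<in> B"
      then obtain x where x: "x \<in> F \<alpha>" "y \<in> chart_ball \<alpha> x \<rho>" using F[OF \<alpha>(1)] \<alpha>(2) by blast
      have "x \<in> chart_ball \<alpha> y \<rho>"
        using chart_ball_recentre[OF x(2)] x(1) F[OF \<alpha>(1)] assms centre_in_chart_ball[of x \<alpha> \<rho>] by auto
      also have "\<dots> \<subseteq> B" using mball_in_chart[OF B \<alpha> y] chart_ball_mono[OF r(1)] by blast
      finally show "y \<in> (\<Union>x\<in>F \<alpha> \<inter> B. chart_ball \<alpha> x \<rho>)" using x by blast
    next
      fix y assume "y \<in> (\<Union>x\<in>F \<alpha> \<inter> B. chart_ball \<alpha> x \<rho>)"
      then obtain x where "x \<in> B" "y \<in> chart_ball \<alpha> x \<rho>" by blast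
      then show "y \<in> B" using mball_in_chart[OF B \<alpha>, of x] chart_ball_mono[OF r(1)] by blast
    qed
    then show "B \<in> ?f ` (SIGMA \<alpha>:\<A>. Pow (F \<alpha>))"
      using \<alpha>(1) by (intro image_eqI[of _ _ "(\<alpha>, F \<alpha> \<inter> B)"]) auto
  qed
  moreover have "finite (SIGMA \<alpha>:\<A>. Pow (F \<alpha>))" using F finite_atlas by (intro finite_SigmaI) auto
  ultimately show ?thesis by (meson finite_imageI finite_subset)
qed

end

section \<open>Test functions on a compact space\<close>

lemma test_functions_locally_constant:
  "h \<in> test_functions \<Longrightarrow> \<exists>V. open V \<and> x \<in> V \<and> (\<forall>y\<in>V. h y = h x)"
  by (simp add: test_functions_def)

context fine_atlas
begin

lemma test_functionsI:
  fixes h :: "'a \<Rightarrow> complex"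
  assumes "\<And>x. \<exists>V. open V \<and> x \<in> V \<and> (\<forall>y\<in>V. h y = h x)"
  shows "h \<in> test_functions"
proof -
  have "compact (UNIV \<inter> closure {x. h x \<noteq> 0})"
    by (rule compact_Int_closed[OF compact_space closed_closure])
  then show ?thesis using assms by (simp add: test_functions_def)
qed

lemma test_functions_binop:
  fixes g h :: "'a \<Rightarrow> complex"
  assumes "g \<in> test_functions" "h \<in> test_functions"
  shows "(\<lambda>x. F (g x) (h x)) \<in> test_functions"
proof (rule test_functionsI)
  fix x
  obtain V where V: "open V" "x \<in> V" "\<forall>y\<in>V. g y = g x"
    using test_functions_locally_constant[OF assms(1)] by blast
  obtain W where W: "open W" "x \<in> W" "\<forall>y\<in>W. h y = h x"
    using test_functions_locally_constant[OF assms(2)] by blast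
  show "\<exists>V. open V \<and> x \<in> V \<and> (\<forall>y\<in>V. F (g y) (h y) = F (g x) (h x))"
  proof (intro exI[of _ "V \<inter> W"] conjI ballI)
    fix y assume "y \<in> V \<inter> W"
    then have "g y = g x" "h y = h x" using V(3) W(3) by blast+
    then show "F (g y) (h y) = F (g x) (h x)" by simp
  qed (use V(1,2) W(1,2) in auto)
qed

lemma test_functions_const: "(\<lambda>x :: 'a. c) \<in> test_functions"
  by (rule test_functionsI) (auto intro: exI[of _ UNIV])

lemma test_functions_sum:
  fixes f :: "'i \<Rightarrow> 'a \<Rightarrow> complex"
  assumes "\<And>i. i \<in> S \<Longrightarrow> f i \<in> test_functions"
  shows "(\<lambda>x. \<Sum>i\<in>S. f i x) \<in> test_functions"
  using assms
proof (induction S rule: infinite_finite_induct)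
  case (insert i S)
  then show ?case using test_functions_binop[of "f i" "\<lambda>x. \<Sum>i\<in>S. f i x" "(+)"] by simp
qed (auto simp: test_functions_const)

lemma test_functions_continuous:
  assumes "h \<in> test_functions"
  shows "continuous_on UNIV (h :: 'a \<Rightarrow> complex)"
proof -
  have "open (h -` S)" for S
  proof (subst open_subopen, intro ballI)
    fix x assume x: "x \<in> h -` S"
    obtain V where V: "open V" "x \<in> V" "\<forall>y\<in>V. h y = h x"
      using test_functions_locally_constant[OF assms] by blast
    have "V \<subseteq> h -` S"
    proof
      fix y assume "y \<in> V"
      then have "h y = h x" using V(3) by blast
      then show "y \<in> h -` S" using x by simp
    qed
    then show "\<exists>T. open T \<and> x \<in> T \<and> T \<subseteq> h -` S" using V(1,2) by blast
  qed
  then show ?thesis by (simp add: continuous_on_open_vimage)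
qed

lemma test_functions_measurable:
  "h \<in> test_functions \<Longrightarrow> (h :: 'a \<Rightarrow> complex) \<in> borel_measurable \<mu>"
  using borel_measurable_continuous_onI[OF test_functions_continuous]
  by (simp add: measurable_cong_sets[OF sets_\<mu> refl])

lemma test_functions_bounded:
  assumes "h \<in> test_functions"
  obtains M where "\<And>x :: 'a. cmod (h x) \<le> M"
proof -
  have "compact (h ` UNIV)"
    using compact_continuous_image[OF test_functions_continuous[OF assms] compact_space] .
  then have "bounded (range h)" by (rule compact_imp_bounded)
  then obtain M where M: "\<forall>z\<in>range h. norm z \<le> M" unfolding bounded_iff by blast
  show ?thesis by (rule that[of M]) (use M in simp)
qed

lemma test_functions_integrable:
  assumes "h \<in> test_functions"
  shows "integrable \<mu> (h :: 'a \<Rightarrow> complex)"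
proof -
  obtain M where "\<And>x :: 'a. cmod (h x) \<le> M" using test_functions_bounded[OF assms] by blast
  then show ?thesis
    by (intro integrable_const_bound[where B = M] test_functions_measurable assms) auto
qed

lemma test_functions_L2:
  assumes "h \<in> test_functions"
  shows "(h :: 'a \<Rightarrow> complex) \<in> L2 \<mu>"
proof -
  obtain M where M: "\<And>x :: 'a. cmod (h x) \<le> M" using test_functions_bounded[OF assms] by blast
  have "(\<lambda>x. (cmod (h x))\<^sup>2) \<in> borel_measurable \<mu>"
    using test_functions_measurable[OF assms] by measurable
  moreover have "AE x in \<mu>. norm ((cmod (h x))\<^sup>2) \<le> M\<^sup>2"
    using M by (intro AE_I2) (simp add: power_mono)
  ultimately have "integrable \<mu> (\<lambda>x. (cmod (h x))\<^sup>2)" by (intro integrable_const_bound[where B = "M\<^sup>2"])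
  then show ?thesis using test_functions_measurable[OF assms] by (simp add: L2_def)
qed

text \<open>The measure has full support, so null sets cannot contain the support of a test function.\<close>

lemma test_functions_AE_0:
  assumes h: "h \<in> test_functions" and ae: "AE x in \<mu>. h x = (0::complex)"
  shows "h x = 0"
proof (rule ccontr)
  assume x: "h x \<noteq> 0"
  obtain V where V: "open V" "x \<in> V" "\<forall>y\<in>V. h y = h x"
    using test_functions_locally_constant[OF h] by blast
  obtain N where N: "{x \<in> space \<mu>. h x \<noteq> 0} \<subseteq> N" "emeasure \<mu> N = 0" "N \<in> sets \<mu>"
    using ae by (rule AE_E)
  have "V \<subseteq> N"
  proof
    fix y assume "y \<in> V"
    then have "h y = h x" using V(3) by blast
    then show "y \<in> N" using N(1) x by auto
  qed
  then have "emeasure \<mu> V \<le> emeasure \<mu> N" using N(3) by (intro emeasure_mono) auto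
  then show False using N(2) emeasure_open_pos[OF V(1)] V(2) by auto
qed

text \<open>The Lebesgue number lemma in each of the finitely many charts.\<close>

lemma test_functions_uniformly_constant:
  fixes h :: "'a \<Rightarrow> complex"
  assumes h: "h \<in> test_functions"
  shows "\<exists>\<rho>>0. \<forall>\<alpha>\<in>\<A>. \<forall>x\<in>cdom \<alpha>. \<forall>y\<in>chart_ball \<alpha> x \<rho>. h y = h x"
proof -
  have unif: "\<exists>\<rho>>0. \<forall>z\<in>cmap \<alpha> ` cdom \<alpha>. \<forall>y\<in>cdom \<alpha>. \<forall>x\<in>cdom \<alpha>.
      cmap \<alpha> y \<in> kball z \<rho> \<and> cmap \<alpha> x \<in> kball z \<rho> \<longrightarrow> h y = h x" if \<alpha>: "\<alpha> \<in> \<A>" for \<alpha>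
  proof (rule uniform_radius)
    show "compact (cmap \<alpha> ` cdom \<alpha>)"
      using compact_continuous_image[OF chart(3)[OF \<alpha>] compact_cdom[OF \<alpha>]] .
  next
    fix z assume "z \<in> cmap \<alpha> ` cdom \<alpha>"
    then obtain x where x: "x \<in> cdom \<alpha>" "z = cmap \<alpha> x" by blast
    obtain V where V: "open V" "x \<in> V" "\<forall>y\<in>V. h y = h x"
      using test_functions_locally_constant[OF h] by blast
    obtain r where r: "0 < r" "chart_ball \<alpha> x r \<subseteq> V"
      using open_contains_chart_ball[OF V(1,2) \<alpha> x(1)] by metis
    have "h y = h x" if "y \<in> cdom \<alpha>" "cmap \<alpha> y \<in> kball z r" for y
      using that r(2) V(3) x(2) unfolding chart_ball_def by blast
    then have "\<forall>y\<in>cdom \<alpha>. \<forall>x\<in>cdom \<alpha>. cmap \<alpha> y \<in> kball z r \<and> cmap \<alpha> x \<in> kball z r \<longrightarrow> h y = h x"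
      by metis
    then show "\<exists>r>0. \<forall>y\<in>cdom \<alpha>. \<forall>x\<in>cdom \<alpha>. cmap \<alpha> y \<in> kball z r \<and> cmap \<alpha> x \<in> kball z r \<longrightarrow> h y = h x"
      using r(1) by blast
  next
    fix z w and r r' :: real
    assume *: "\<forall>y\<in>cdom \<alpha>. \<forall>x\<in>cdom \<alpha>. cmap \<alpha> y \<in> kball z r \<and> cmap \<alpha> x \<in> kball z r \<longrightarrow> h y = h x"
      and "w \<in> kball z r" "0 < r'" "r' \<le> r"
    then have "kball w r' \<subseteq> kball z r" by (intro kball_subset[of w]) auto
    then show "\<forall>y\<in>cdom \<alpha>. \<forall>x\<in>cdom \<alpha>. cmap \<alpha> y \<in> kball w r' \<and> cmap \<alpha> x \<in> kball w r' \<longrightarrow> h y = h x"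
      using * by blast
  qed
  have ex: "\<exists>\<rho>. \<rho> > 0 \<and> (\<forall>x\<in>cdom \<alpha>. \<forall>y\<in>chart_ball \<alpha> x \<rho>. h y = h x)" if \<alpha>: "\<alpha> \<in> \<A>" for \<alpha>
  proof -
    obtain \<rho> where \<rho>: "\<rho> > 0" "\<forall>z\<in>cmap \<alpha> ` cdom \<alpha>. \<forall>y\<in>cdom \<alpha>. \<forall>x\<in>cdom \<alpha>.
        cmap \<alpha> y \<in> kball z \<rho> \<and> cmap \<alpha> x \<in> kball z \<rho> \<longrightarrow> h y = h x"
      using unif[OF \<alpha>] by blast
    have "h y = h x" if x: "x \<in> cdom \<alpha>" and y: "y \<in> chart_ball \<alpha> x \<rho>" for x y
    proof -
      have "cmap \<alpha> x \<in> kball (cmap \<alpha> x) \<rho>" using \<rho>(1) by (intro centre_in_kball) simp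
      then show ?thesis using \<rho>(2) x y unfolding chart_ball_def by blast
    qed
    then show ?thesis using \<rho>(1) by blast
  qed
  define \<rho> where "\<rho> \<alpha> = (SOME \<rho>. \<rho> > 0 \<and> (\<forall>x\<in>cdom \<alpha>. \<forall>y\<in>chart_ball \<alpha> x \<rho>. h y = h x))" for \<alpha>
  have \<rho>: "\<rho> \<alpha> > 0 \<and> (\<forall>x\<in>cdom \<alpha>. \<forall>y\<in>chart_ball \<alpha> x (\<rho> \<alpha>). h y = h x)" if "\<alpha> \<in> \<A>" for \<alpha>
    using someI_ex[OF ex[OF that]] unfolding \<rho>_def .
  define \<rho>0 where "\<rho>0 = Min (insert 1 (\<rho> ` \<A>))"
  have "\<rho>0 > 0" using \<rho> finite_atlas unfolding \<rho>0_def by (subst Min_gr_iff) auto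
  moreover have "h y = h x" if "\<alpha> \<in> \<A>" "x \<in> cdom \<alpha>" "y \<in> chart_ball \<alpha> x \<rho>0" for \<alpha> x y
  proof -
    have "\<rho>0 \<le> \<rho> \<alpha>" using that(1) finite_atlas unfolding \<rho>0_def by (intro Min_le) auto
    then have "y \<in> chart_ball \<alpha> x (\<rho> \<alpha>)" using that(3) chart_ball_mono by blast
    then show ?thesis using \<rho>[OF that(1)] that(2) by blast
  qed
  ultimately show ?thesis by blast
qed

lemma l2_inner_commute: "l2_inner \<mu> g h = cnj (l2_inner \<mu> h g)"
proof -
  have "cnj (l2_inner \<mu> h g) = (\<integral>x. cnj (h x * cnj (g x)) \<partial>\<mu>)"
    unfolding l2_inner_def by (rule Bochner_Integration.integral_cnj[symmetric])
  then show ?thesis by (simp add: l2_inner_def mult.commute)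
qed

lemma l2_inner_self: "l2_inner \<mu> h h = complex_of_real ((l2_norm \<mu> h)\<^sup>2)"
proof -
  have "(\<integral>x. h x * cnj (h x) \<partial>\<mu>) = (\<integral>x. complex_of_real ((cmod (h x))\<^sup>2) \<partial>\<mu>)"
    by (simp only: complex_norm_square)
  also have "\<dots> = complex_of_real (\<integral>x. (cmod (h x))\<^sup>2 \<partial>\<mu>)" by (rule integral_complex_of_real)
  also have "(\<integral>x. (cmod (h x))\<^sup>2 \<partial>\<mu>) = (l2_norm \<mu> h)\<^sup>2"
    by (simp add: l2_norm_def)
  finally show ?thesis by (simp add: l2_inner_def)
qed

end


section \<open>Wavelets\<close>

text \<open>The argument of the character in a Kozyrev wavelet of frequency \<open>\<eta>\<close> at level \<open>m\<close>.\<close>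

definition phase :: "'k::nonarch_local_field \<Rightarrow> 'k ^ 'n \<Rightarrow> int \<Rightarrow> 'k ^ 'n \<Rightarrow> 'k" where
  "phase \<pi> \<eta> m z = \<pi> powi (- m - 1) * (\<Sum>i\<in>UNIV. \<eta> $ i * z $ i)"

lemma phase_add: "phase \<pi> \<eta> m (z + w) = phase \<pi> \<eta> m z + phase \<pi> \<eta> m w"
  by (simp add: phase_def algebra_simps sum.distrib)

lemma phase_diff_left: "phase \<pi> (\<eta> - \<eta>') m z = phase \<pi> \<eta> m z - phase \<pi> \<eta>' m z"
  by (simp add: phase_def algebra_simps sum_subtractf)

lemma absv_phase_le_1:
  fixes z :: "'k::nonarch_local_field ^ 'n::finite"
  assumes \<pi>: "uniformiser \<pi>" and *: "\<And>i. absv (\<eta> $ i) * absv (z $ i) \<le> absv \<pi> powi (m + 1)"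
  shows "absv (phase \<pi> \<eta> m z) \<le> 1"
proof -
  have q: "0 < absv \<pi>" using \<pi> by (simp add: uniformiser_def)
  have "absv (\<Sum>i\<in>UNIV. \<eta> $ i * z $ i) \<le> absv \<pi> powi (m + 1)"
    using * q by (intro absv_sum_le) (auto simp: absv_mult)
  then have "absv (phase \<pi> \<eta> m z) \<le> absv \<pi> powi (- m - 1) * absv \<pi> powi (m + 1)"
    using q by (simp add: phase_def absv_mult absv_powi)
  also have "\<dots> = 1" using q by (simp flip: power_int_add)
  finally show ?thesis .
qed

lemma phase_axis:
  fixes \<pi> :: "'k::nonarch_local_field"
  assumes \<pi>: "\<pi> \<noteq> 0" and i: "\<eta> $ i \<noteq> 0"
  shows "phase \<pi> \<eta> m (axis i (u * \<pi> powi m / \<eta> $ i)) = u / \<pi>"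
proof -
  have "(\<Sum>j\<in>UNIV. \<eta> $ j * axis i (u * \<pi> powi m / \<eta> $ i) $ j) =
      (\<Sum>j\<in>UNIV. if j = i then u * \<pi> powi m else 0)"
    using i by (intro sum.cong) (auto simp: axis_def)
  also have "\<dots> = u * \<pi> powi m" by simp
  finally show ?thesis
    using \<pi> by (simp add: phase_def power_int_diff power_int_minus field_simps)
qed

lemma wavelet_character_0: "wavelet_character \<pi> \<theta> \<Longrightarrow> absv u \<le> 1 \<Longrightarrow> \<theta> u = 1"
  and wavelet_character_add: "wavelet_character \<pi> \<theta> \<Longrightarrow> \<theta> (u + v) = \<theta> u * \<theta> v"
  and wavelet_character_norm: "wavelet_character \<pi> \<theta> \<Longrightarrow> cmod (\<theta> u) = 1"
  by (auto simp: wavelet_character_def)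

lemma wavelet_character_diff:
  assumes "wavelet_character \<pi> \<theta>"
  shows "\<theta> (u - v) = \<theta> u * cnj (\<theta> v)"
proof -
  have "\<theta> u = \<theta> (u - v) * \<theta> v" using wavelet_character_add[OF assms, of "u - v" v] by simp
  moreover have "\<theta> v * cnj (\<theta> v) = 1"
    using wavelet_character_norm[OF assms, of v] complex_norm_square[of "\<theta> v"] by simp
  ultimately show ?thesis by (metis mult.assoc mult.right_neutral)
qed

lemma kball_subset_imp_powi_le:
  fixes c :: "'k::nonarch_local_field ^ 'n::finite" and \<pi> :: 'k
  assumes \<pi>: "\<pi> \<noteq> 0" and sub: "kball c (absv \<pi> powi m) \<subseteq> kball c' r"
  shows "absv \<pi> powi m \<le> r"
proof -
  let ?e = "axis undefined (\<pi> powi m) :: 'k ^ 'n"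
  have "0 < absv \<pi>" using \<pi> by simp
  then have q: "0 \<le> absv \<pi> powi m" by simp
  have "c + ?e \<in> kball c (absv \<pi> powi m)" using q by (auto simp: in_kball_iff axis_def absv_powi)
  moreover have "c \<in> kball c (absv \<pi> powi m)" using q by simp
  ultimately have "c + ?e \<in> kball c' r" "c \<in> kball c' r" using sub by blast+
  then have "c + ?e \<in> kball c r" using kball_recentre by blast
  then have "absv ((c + ?e) $ undefined - c $ undefined) \<le> r" unfolding in_kball_iff by blast
  then show ?thesis by (simp add: axis_def absv_powi)
qed

locale wavelet_atlas = fine_atlas \<A> \<omega> \<nu> \<mu> R
  for \<A> :: "('a::t2_space, 'k::nonarch_local_field, 'n::finite) chart set"
    and \<omega> :: "('a, 'k, 'n) chart \<Rightarrow> 'k ^ 'n \<Rightarrow> 'k"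
    and \<nu> :: "('k ^ 'n) measure" and \<mu> :: "'a measure" and R :: real +
  fixes \<pi> :: 'k and \<theta> :: "'k \<Rightarrow> complex"
  assumes uniformiser: "uniformiser \<pi>"
    and character: "wavelet_character \<pi> \<theta>"
begin

lemma pi_nz: "\<pi> \<noteq> 0" and absv_pi: "0 < absv \<pi>" "absv \<pi> < 1"
  using uniformiser by (auto simp: uniformiser_def)

text \<open>
  What remains of the definition of a wavelet on \<open>B\<close> when it is read in one chart that contains
  \<open>B\<close>. The centre of the ball is left out, so that every point of \<open>B\<close> can serve as one.
\<close>

definition wavelet_form :: "('a, 'k, 'n) chart \<Rightarrow> 'a set \<Rightarrow> ('a \<Rightarrow> complex) \<Rightarrow>
    complex \<Rightarrow> 'k ^ 'n \<Rightarrow> int \<Rightarrow> bool" where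
  "wavelet_form \<alpha> B \<psi> C \<eta> m \<longleftrightarrow> C \<noteq> 0 \<and> (\<forall>i. absv (\<eta> $ i) \<le> 1) \<and> (\<exists>i. \<not> absv (\<eta> $ i) \<le> absv \<pi>) \<and>
     absv \<pi> powi m \<le> R \<and> (\<forall>y. \<psi> y = (if y \<in> B then C * \<theta> (phase \<pi> \<eta> m (cmap \<alpha> y)) else 0))"

lemma wavelet_on_form:
  assumes \<psi>: "wavelet_on \<A> \<mu> \<pi> \<theta> B \<psi>" and B: "mball_radius \<A> r B" "r \<le> R"
    and x: "x \<in> B" and \<alpha>: "\<alpha> \<in> \<A>" "x \<in> cdom \<alpha>"
  obtains C \<eta> m where "wavelet_form \<alpha> B \<psi> C \<eta> m" "B = chart_ball \<alpha> x (absv \<pi> powi m)"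
proof -
  have eq: "B = chart_ball \<alpha> x r" using small_mball_eq[OF B x \<alpha>] .
  then have sub: "B \<subseteq> cdom \<alpha>" using chart_ball_subset_cdom by blast
  obtain a where a: "a \<in> B" and "\<exists>m k. kozyrev_wavelet \<pi> \<theta> (cmap \<alpha> a) m k \<and>
      kball (cmap \<alpha> a) (absv \<pi> powi m) = cmap \<alpha> ` B \<and>
      (\<forall>z \<in> cmap \<alpha> ` cdom \<alpha>. \<psi> (inv_into (cdom \<alpha>) (cmap \<alpha>) z) = k z)"
    using \<psi> \<alpha>(1) sub unfolding wavelet_on_def by blast
  then obtain m k where k: "kozyrev_wavelet \<pi> \<theta> (cmap \<alpha> a) m k"
    and ball: "kball (cmap \<alpha> a) (absv \<pi> powi m) = cmap \<alpha> ` B"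
    and val: "\<And>z. z \<in> cmap \<alpha> ` cdom \<alpha> \<Longrightarrow> \<psi> (inv_into (cdom \<alpha>) (cmap \<alpha>) z) = k z" by blast
  obtain C \<eta> where \<eta>: "\<forall>i. absv (\<eta> $ i) \<le> 1" "\<exists>i. \<not> absv (\<eta> $ i) \<le> absv \<pi>"
    and k_eq: "k = (\<lambda>z. C * \<theta> (\<pi> powi (- m - 1) * (\<Sum>i\<in>UNIV. \<eta> $ i * z $ i)) *
                  indicator (kball (cmap \<alpha> a) (absv \<pi> powi m)) z)"
    using k unfolding kozyrev_wavelet_def by blast
  have inside: "\<psi> y = C * \<theta> (phase \<pi> \<eta> m (cmap \<alpha> y))" if y: "y \<in> B" for y
  proof -
    have "y \<in> cdom \<alpha>" using y sub by blast
    then have "\<psi> y = k (cmap \<alpha> y)" using val[of "cmap \<alpha> y"] chart(4)[OF \<alpha>(1)] by simp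
    moreover have "cmap \<alpha> y \<in> kball (cmap \<alpha> a) (absv \<pi> powi m)" using ball y by blast
    ultimately show ?thesis by (simp add: k_eq phase_def)
  qed
  have outside: "\<psi> y = 0" if "y \<notin> B" for y using \<psi> that unfolding wavelet_on_def by blast
  have "C \<noteq> 0"
  proof
    assume "C = 0"
    then have "\<psi> y = 0" for y using inside outside by (cases "y \<in> B") auto
    then have "l2_norm \<mu> \<psi> = 0" by (simp add: l2_norm_def)
    then show False using \<psi> unfolding wavelet_on_def by simp
  qed
  moreover have "absv \<pi> powi m \<le> R"
  proof -
    have "kball (cmap \<alpha> a) (absv \<pi> powi m) \<subseteq> kball (cmap \<alpha> x) r"
      using ball cmap_chart_ball[OF \<alpha> B(2)] eq by simp
    from kball_subset_imp_powi_le[OF pi_nz this] show ?thesis using B(2) by simp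
  qed
  ultimately have "wavelet_form \<alpha> B \<psi> C \<eta> m"
    unfolding wavelet_form_def using \<eta> inside outside by simp
  moreover have "B = chart_ball \<alpha> x (absv \<pi> powi m)"
    using ball by (intro chart_ball_eqI[OF \<alpha>(1) sub _ x]) auto
  ultimately show ?thesis using that by blast
qed

lemma wavelet_form_level:
  assumes \<alpha>: "\<alpha> \<in> \<A>" "x \<in> cdom \<alpha>"
    and \<psi>: "wavelet_form \<alpha> B \<psi> C \<eta> m" "B = chart_ball \<alpha> x (absv \<pi> powi m)"
    and \<psi>': "wavelet_form \<alpha> B \<psi>' C' \<eta>' m'" "B = chart_ball \<alpha> x (absv \<pi> powi m')"
  shows "m' = m"
proof -
  have r: "absv \<pi> powi m \<le> R" "absv \<pi> powi m' \<le> R"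
    using \<psi>(1) \<psi>'(1) unfolding wavelet_form_def by auto
  have "kball (cmap \<alpha> x) (absv \<pi> powi m) = kball (cmap \<alpha> x) (absv \<pi> powi m')"
    using \<psi>(2) \<psi>'(2) cmap_chart_ball[OF \<alpha> r(1)] cmap_chart_ball[OF \<alpha> r(2)] by simp
  then have "absv \<pi> powi m = absv \<pi> powi m'"
    using kball_subset_imp_powi_le[OF pi_nz] by (metis antisym order_refl)
  then show ?thesis using powi_le_iff[OF absv_pi] by (metis antisym order_refl)
qed

lemma wavelet_form_near:
  assumes \<psi>: "wavelet_form \<alpha> B \<psi> C \<eta> m" and y: "y \<in> B" "y' \<in> B"
    and near: "maxnorm (cmap \<alpha> y' - cmap \<alpha> y) \<le> absv \<pi> powi (m + 1)"
  shows "\<psi> y' = \<psi> y"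
proof -
  let ?h = "cmap \<alpha> y' - cmap \<alpha> y"
  have "absv (phase \<pi> \<eta> m ?h) \<le> 1"
  proof (rule absv_phase_le_1[OF uniformiser])
    fix i
    have "absv (\<eta> $ i) * absv (?h $ i) \<le> 1 * absv \<pi> powi (m + 1)"
      using \<psi> near absv_pi unfolding wavelet_form_def
      by (intro mult_mono) (auto simp: maxnorm_le_iff)
    then show "absv (\<eta> $ i) * absv (?h $ i) \<le> absv \<pi> powi (m + 1)" by simp
  qed
  then have "\<theta> (phase \<pi> \<eta> m (cmap \<alpha> y + ?h)) = \<theta> (phase \<pi> \<eta> m (cmap \<alpha> y))"
    unfolding phase_add wavelet_character_add[OF character]
    by (simp add: wavelet_character_0[OF character])
  then have "\<theta> (phase \<pi> \<eta> m (cmap \<alpha> y')) = \<theta> (phase \<pi> \<eta> m (cmap \<alpha> y))" by simp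
  then show ?thesis using \<psi> y unfolding wavelet_form_def by simp
qed

text \<open>
  Translating by a vector that turns the character multiplies an oscillating function by a
  constant different from 1, yet does not change its integral.
\<close>

lemma integral_oscillating:
  assumes \<alpha>: "\<alpha> \<in> \<A>" "x \<in> cdom \<alpha>" and m: "absv \<pi> powi m \<le> R"
    and i: "\<not> absv (\<eta> $ i) \<le> absv \<pi>" and f: "f \<in> borel_measurable \<mu>"
    and f_eq: "\<And>y. f y = (if y \<in> chart_ball \<alpha> x (absv \<pi> powi m)
      then C * \<theta> (phase \<pi> \<eta> m (cmap \<alpha> y)) else (0::complex))"
  shows "(\<integral>y. f y \<partial>\<mu>) = 0"
proof -
  let ?r = "absv \<pi> powi m" and ?B = "chart_ball \<alpha> x (absv \<pi> powi m)"
  have r: "0 < ?r" using absv_pi by simp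
  obtain u where u: "absv u \<le> 1" "\<theta> (u / \<pi>) \<noteq> 1" using character unfolding wavelet_character_def by blast
  have \<eta>: "1 \<le> absv (\<eta> $ i)" 
  proof (rule ccontr)
    assume "\<not> 1 \<le> absv (\<eta> $ i)"
    then have "absv (\<eta> $ i) < 1" by simp
    then show False using i uniformiser unfolding uniformiser_def by blast
  qed
  define t where "t = (axis i (u * \<pi> powi m / \<eta> $ i) :: 'k ^ 'n)"
  have t: "maxnorm t \<le> ?r"
    unfolding maxnorm_le_iff
  proof
    fix j
    have "absv u * ?r / absv (\<eta> $ i) \<le> 1 * ?r / 1"
      using u \<eta> r by (intro frac_le mult_right_mono) auto
    then show "absv (t $ j) \<le> ?r"
      using r by (auto simp: t_def axis_def absv_divide absv_mult absv_powi)
  qed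
  have "\<eta> $ i \<noteq> 0" using \<eta> by auto
  then have turn: "phase \<pi> \<eta> m t = u / \<pi>" unfolding t_def by (rule phase_axis[OF pi_nz])
  have "f (shift \<alpha> x ?r t y) = \<theta> (u / \<pi>) * f y" for y
  proof (cases "y \<in> ?B")
    case True
    then show ?thesis
      using shift_inside[OF \<alpha> m t True]
      by (simp add: f_eq phase_add wavelet_character_add[OF character] turn)
  qed (simp add: shift_outside f_eq)
  then have "(\<integral>y. \<theta> (u / \<pi>) * f y \<partial>\<mu>) = (\<integral>y. f y \<partial>\<mu>)"
    using integral_shift[OF \<alpha> r m t f] by simp
  then have "\<theta> (u / \<pi>) * (\<integral>y. f y \<partial>\<mu>) = (\<integral>y. f y \<partial>\<mu>)"
    by (simp only: integral_mult_right_zero)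
  then show ?thesis using u(2) by simp
qed

abbreviation "W \<equiv> wavelets_upto \<A> \<mu> \<pi> \<theta> R"

lemma wavelets_uptoE:
  assumes "\<psi> \<in> W"
  obtains B r x where "r \<le> R" "mball_radius \<A> r B" "wavelet_on \<A> \<mu> \<pi> \<theta> B \<psi>" "x \<in> B"
proof -
  obtain B r where B: "r \<le> R" "mball_radius \<A> r B" "wavelet_on \<A> \<mu> \<pi> \<theta> B \<psi>"
    using assms unfolding wavelets_upto_def by blast
  obtain x where "x \<in> B" using mball_radius_nonempty[OF B(2)] by blast
  then show ?thesis using that B by blast
qed

lemma wavelet_test_function:
  assumes "\<psi> \<in> W"
  shows "\<psi> \<in> test_functions"
proof -
  obtain B r x0 where B: "r \<le> R" "mball_radius \<A> r B" "wavelet_on \<A> \<mu> \<pi> \<theta> B \<psi>" "x0 \<in> B"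
    using wavelets_uptoE[OF assms] .
  show ?thesis
  proof (rule test_functionsI)
    fix x
    show "\<exists>V. open V \<and> x \<in> V \<and> (\<forall>y\<in>V. \<psi> y = \<psi> x)"
    proof (cases "x \<in> B")
      case True
      obtain \<alpha> where \<alpha>: "\<alpha> \<in> \<A>" "x \<in> cdom \<alpha>" using ex_chart by blast
      obtain C \<eta> m where \<psi>: "wavelet_form \<alpha> B \<psi> C \<eta> m" "B = chart_ball \<alpha> x (absv \<pi> powi m)"
        using wavelet_on_form[OF B(3,2,1) True \<alpha>] .
      let ?V = "chart_ball \<alpha> x (absv \<pi> powi (m + 1))"
      have V: "?V \<subseteq> B" unfolding \<psi>(2) using powi_le_iff[OF absv_pi] by (intro chart_ball_mono) simp
      have "open ?V" using open_chart_ball[OF \<alpha>(1)] absv_pi by simp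
      moreover have "x \<in> ?V" using centre_in_chart_ball[OF \<alpha>(2)] absv_pi by simp
      moreover have "\<psi> y = \<psi> x" if "y \<in> ?V" for y
        using wavelet_form_near[OF \<psi>(1) True] that V by (auto simp: chart_ball_def kball_def)
      ultimately show ?thesis by blast
    next
      case False
      have "open (- B)" using mball_closed[OF B(2)] by (simp add: open_Compl)
      moreover have "\<psi> y = 0" if "y \<notin> B" for y using B(3) that unfolding wavelet_on_def by blast
      ultimately show ?thesis using False by (intro exI[of _ "- B"]) auto
    qed
  qed
qed

lemma wavelet_integral_0:
  assumes \<psi>: "\<psi> \<in> W"
  shows "(\<integral>y. \<psi> y \<partial>\<mu>) = 0"
proof -
  obtain B r x where B: "r \<le> R" "mball_radius \<A> r B" "wavelet_on \<A> \<mu> \<pi> \<theta> B \<psi>" "x \<in> B"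
    using wavelets_uptoE[OF \<psi>] .
  obtain \<alpha> where \<alpha>: "\<alpha> \<in> \<A>" "x \<in> cdom \<alpha>" using ex_chart by blast
  obtain C \<eta> m where form: "wavelet_form \<alpha> B \<psi> C \<eta> m" "B = chart_ball \<alpha> x (absv \<pi> powi m)"
    using wavelet_on_form[OF B(3,2,1,4) \<alpha>] .
  obtain i where "\<not> absv (\<eta> $ i) \<le> absv \<pi>" using form(1) unfolding wavelet_form_def by blast
  then show ?thesis
    using form test_functions_measurable[OF wavelet_test_function[OF \<psi>]]
    by (intro integral_oscillating[OF \<alpha>, of m \<eta> i \<psi> C]) (auto simp: wavelet_form_def)
qed

lemma wavelet_form_proportional:
  assumes \<psi>: "wavelet_form \<alpha> B \<psi> C \<eta> m" and \<psi>': "wavelet_form \<alpha> B \<psi>' C' \<eta>' m"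
    and B: "B = chart_ball \<alpha> x (absv \<pi> powi m)" and x: "x \<in> B"
    and \<eta>: "\<And>i. absv ((\<eta>' - \<eta>) $ i) \<le> absv \<pi>"
  shows "\<exists>c. c \<noteq> 0 \<and> \<psi>' = (\<lambda>y. c * \<psi> y)"
proof -
  define c0 where "c0 = \<theta> (phase \<pi> (\<eta>' - \<eta>) m (cmap \<alpha> x))"
  have "\<theta> (phase \<pi> \<eta>' m (cmap \<alpha> y)) = c0 * \<theta> (phase \<pi> \<eta> m (cmap \<alpha> y))" if y: "y \<in> B" for y
  proof -
    let ?h = "cmap \<alpha> y - cmap \<alpha> x"
    have "absv (phase \<pi> (\<eta>' - \<eta>) m ?h) \<le> 1"
    proof (rule absv_phase_le_1[OF uniformiser])
      fix i
      have "absv (?h $ i) \<le> absv \<pi> powi m" using y B by (simp add: chart_ball_def in_kball_iff)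
      then have "absv ((\<eta>' - \<eta>) $ i) * absv (?h $ i) \<le> absv \<pi> * absv \<pi> powi m"
        using \<eta> by (intro mult_mono) auto
      also have "\<dots> = absv \<pi> powi (m + 1)" using absv_pi by (simp add: power_int_add)
      finally show "absv ((\<eta>' - \<eta>) $ i) * absv (?h $ i) \<le> absv \<pi> powi (m + 1)" .
    qed
    then have "\<theta> (phase \<pi> (\<eta>' - \<eta>) m (cmap \<alpha> x + ?h)) = c0"
      unfolding phase_add wavelet_character_add[OF character] c0_def
      by (simp add: wavelet_character_0[OF character])
    then have "\<theta> (phase \<pi> (\<eta>' - \<eta>) m (cmap \<alpha> y)) = c0" by simp
    moreover have "phase \<pi> \<eta>' m (cmap \<alpha> y) =
        phase \<pi> (\<eta>' - \<eta>) m (cmap \<alpha> y) + phase \<pi> \<eta> m (cmap \<alpha> y)"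
      by (simp add: phase_diff_left)
    ultimately show ?thesis by (simp only: wavelet_character_add[OF character])
  qed
  then have "\<psi>' = (\<lambda>y. (C' / C * c0) * \<psi> y)"
    using \<psi> \<psi>' unfolding wavelet_form_def by (intro ext) simp
  moreover have "c0 \<noteq> 0" using wavelet_character_norm[OF character] by (metis c0_def norm_zero zero_neq_one)
  ultimately show ?thesis using \<psi> \<psi>' unfolding wavelet_form_def by (intro exI[of _ "C' / C * c0"]) simp
qed

lemma wavelet_orthogonal_subset:
  assumes \<psi>: "\<psi> \<in> W" "wavelet_on \<A> \<mu> \<pi> \<theta> B \<psi>" "mball_radius \<A> r B" "r \<le> R"
    and \<psi>': "\<psi>' \<in> W" "wavelet_on \<A> \<mu> \<pi> \<theta> B' \<psi>'" "mball_radius \<A> r' B'" "r' \<le> R"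
    and sub: "B' \<subset> B"
  shows "l2_inner \<mu> \<psi> \<psi>' = 0"
proof -
  obtain x where x: "x \<in> B'" using mball_radius_nonempty[OF \<psi>'(3)] by blast
  have xB: "x \<in> B" using x sub by blast
  obtain \<alpha> where \<alpha>: "\<alpha> \<in> \<A>" "x \<in> cdom \<alpha>" using ex_chart by blast
  obtain C \<eta> m where f: "wavelet_form \<alpha> B \<psi> C \<eta> m" "B = chart_ball \<alpha> x (absv \<pi> powi m)"
    using wavelet_on_form[OF \<psi>(2,3,4) xB \<alpha>] .
  obtain C' \<eta>' m' where f': "wavelet_form \<alpha> B' \<psi>' C' \<eta>' m'" "B' = chart_ball \<alpha> x (absv \<pi> powi m')"
    using wavelet_on_form[OF \<psi>'(2,3,4) x \<alpha>] .
  have "\<not> absv \<pi> powi m \<le> absv \<pi> powi m'" using sub f(2) f'(2) chart_ball_mono by blast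
  then have le: "absv \<pi> powi m' \<le> absv \<pi> powi (m + 1)" using powi_le_iff[OF absv_pi] by simp
  have const: "\<psi> y = \<psi> x" if y: "y \<in> B'" for y
  proof (rule wavelet_form_near[OF f(1) xB])
    show "y \<in> B" using y sub by blast
    show "maxnorm (cmap \<alpha> y - cmap \<alpha> x) \<le> absv \<pi> powi (m + 1)"
      using y f'(2) le by (simp add: chart_ball_def kball_def)
  qed
  have eq: "\<psi> y * cnj (\<psi>' y) = \<psi> x * cnj (\<psi>' y)" for y
  proof (cases "y \<in> B'")
    case False
    then have "\<psi>' y = 0" using \<psi>'(2) unfolding wavelet_on_def by blast
    then show ?thesis by simp
  qed (simp only: const)
  have "l2_inner \<mu> \<psi> \<psi>' = (\<integral>y. \<psi> x * cnj (\<psi>' y) \<partial>\<mu>)"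
    unfolding l2_inner_def by (rule Bochner_Integration.integral_cong[OF refl eq])
  also have "\<dots> = \<psi> x * cnj (\<integral>y. \<psi>' y \<partial>\<mu>)" by simp
  also have "\<dots> = 0" using wavelet_integral_0[OF \<psi>'(1)] by simp
  finally show ?thesis .
qed

text \<open>
  On the same ball the product of one wavelet with the conjugate of another oscillates, unless
  their frequencies agree modulo the maximal ideal. On nested balls the wavelet with the larger
  support is constant on the smaller ball, and the other one has integral zero.
\<close>

lemma wavelets_orthogonal_or_proportional:
  assumes \<psi>W: "\<psi> \<in> W" and \<psi>'W: "\<psi>' \<in> W"
  shows "l2_inner \<mu> \<psi> \<psi>' = 0 \<or> (\<exists>c. c \<noteq> 0 \<and> \<psi>' = (\<lambda>y. c * \<psi> y))"
proof -
  obtain B r x0 where B: "r \<le> R" "mball_radius \<A> r B" "wavelet_on \<A> \<mu> \<pi> \<theta> B \<psi>" "x0 \<in> B"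
    using wavelets_uptoE[OF \<psi>W] .
  obtain B' r' x1 where B': "r' \<le> R" "mball_radius \<A> r' B'" "wavelet_on \<A> \<mu> \<pi> \<theta> B' \<psi>'" "x1 \<in> B'"
    using wavelets_uptoE[OF \<psi>'W] .
  consider "B \<inter> B' = {}" | "B = B'" | "B' \<subset> B" | "B \<subset> B'"
    using no_partial_overlap B B' unfolding no_partial_overlap_def by blast
  then show ?thesis
  proof cases
    case 1
    have eq: "\<psi> y * cnj (\<psi>' y) = 0" for y
    proof (cases "y \<in> B")
      case True
      then have "\<psi>' y = 0" using 1 B'(3) unfolding wavelet_on_def by blast
      then show ?thesis by simp
    next
      case False
      then have "\<psi> y = 0" using B(3) unfolding wavelet_on_def by blast
      then show ?thesis by simp
    qed
    have "l2_inner \<mu> \<psi> \<psi>' = (\<integral>y. 0 \<partial>\<mu>)"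
      unfolding l2_inner_def by (rule Bochner_Integration.integral_cong[OF refl eq])
    then show ?thesis by simp
  next
    case 2
    obtain \<alpha> where \<alpha>: "\<alpha> \<in> \<A>" "x0 \<in> cdom \<alpha>" using ex_chart by blast
    obtain C \<eta> m where f: "wavelet_form \<alpha> B \<psi> C \<eta> m" "B = chart_ball \<alpha> x0 (absv \<pi> powi m)"
      using wavelet_on_form[OF B(3,2,1,4) \<alpha>] .
    obtain C' \<eta>' m' where f': "wavelet_form \<alpha> B \<psi>' C' \<eta>' m'" "B = chart_ball \<alpha> x0 (absv \<pi> powi m')"
      using wavelet_on_form[OF B'(3,2,1) _ \<alpha>] B(4) 2 by blast
    have rm: "absv \<pi> powi m \<le> R" using f(1) unfolding wavelet_form_def by simp
    have m: "m' = m" by (rule wavelet_form_level[OF \<alpha> f f'])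
    show ?thesis
    proof (cases "\<forall>i. absv ((\<eta>' - \<eta>) $ i) \<le> absv \<pi>")
      case True
      then show ?thesis using wavelet_form_proportional[OF f(1) _ f(2) B(4)] f'(1) m by blast
    next
      case False
      then obtain i where i: "\<not> absv ((\<eta> - \<eta>') $ i) \<le> absv \<pi>"
        by (auto simp: absv_minus_commute)
      have "(\<integral>y. \<psi> y * cnj (\<psi>' y) \<partial>\<mu>) = 0"
      proof (rule integral_oscillating[OF \<alpha> rm i, where C = "C * cnj C'"])
        show "(\<lambda>y. \<psi> y * cnj (\<psi>' y)) \<in> borel_measurable \<mu>"
          using test_functions_measurable[OF test_functions_binop[OF wavelet_test_function[OF \<psi>W]
              wavelet_test_function[OF \<psi>'W], of "\<lambda>u v. u * cnj v"]] .
        fix y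
        show "\<psi> y * cnj (\<psi>' y) = (if y \<in> chart_ball \<alpha> x0 (absv \<pi> powi m)
            then C * cnj C' * \<theta> (phase \<pi> (\<eta> - \<eta>') m (cmap \<alpha> y)) else 0)"
          using f f' m unfolding wavelet_form_def
          by (simp add: phase_diff_left wavelet_character_diff[OF character])
      qed
      then show ?thesis by (simp add: l2_inner_def)
    qed
  next
    case 3
    then show ?thesis using wavelet_orthogonal_subset[OF \<psi>W B(3,2,1) \<psi>'W B'(3,2,1)] by blast
  next
    case 4
    then have "l2_inner \<mu> \<psi>' \<psi> = 0"
      using wavelet_orthogonal_subset[OF \<psi>'W B'(3,2,1) \<psi>W B(3,2,1)] by blast
    then show ?thesis using l2_inner_commute[of \<psi> \<psi>'] by simp
  qed
qed

lemma wavelet_norm: "\<psi> \<in> W \<Longrightarrow> l2_norm \<mu> \<psi> = 1"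
  unfolding wavelets_upto_def wavelet_on_def by blast

end

section \<open>The geodetic distance near a small ball\<close>

context fine_atlas
begin

text \<open>
  Both cases in the definition of the distance refer to the two points only through the balls and
  the charts that contain them. All invariance properties of the distance come from this.
\<close>

lemma geodetic_dist_cong:
  assumes balls: "\<And>r B. mball_radius \<A> r B \<Longrightarrow> x \<in> B \<and> y \<in> B \<longleftrightarrow> x' \<in> B \<and> y' \<in> B"
    and x: "\<And>\<alpha>. \<alpha> \<in> \<A> \<Longrightarrow> x \<in> cdom \<alpha> \<longleftrightarrow> x' \<in> cdom \<alpha>"
    and y: "\<And>\<alpha>. \<alpha> \<in> \<A> \<Longrightarrow> y \<in> cdom \<alpha> \<longleftrightarrow> y' \<in> cdom \<alpha>"
  shows "geodetic_dist \<A> \<mu> x y = geodetic_dist \<A> \<mu> x' y'"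
proof -
  have top: "top_simplex \<A> u = top_simplex \<A> v"
    if "\<And>\<alpha>. \<alpha> \<in> \<A> \<Longrightarrow> u \<in> cdom \<alpha> \<longleftrightarrow> v \<in> cdom \<alpha>" for u v
  proof -
    have "(J \<in> nerve \<A> \<and> u \<in> simplex_set J) = (J \<in> nerve \<A> \<and> v \<in> simplex_set J)" for J
      using that unfolding nerve_def simplex_set_def by blast
    then show ?thesis unfolding top_simplex_def by presburger
  qed
  have eq: "mball \<A> B \<and> x \<in> B \<and> y \<in> B \<longleftrightarrow> mball \<A> B \<and> x' \<in> B \<and> y' \<in> B" for B
    using balls unfolding mball_def by blast
  have "join \<A> x y = join \<A> x' y'" unfolding join_def by (simp only: eq)
  then show ?thesis
    unfolding geodetic_dist_def using top[OF x] top[OF y] by (simp only: eq)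
qed

lemma mball_cdom_iff:
  assumes B: "mball_radius \<A> r B" "r \<le> R" and y: "y \<in> B" "y' \<in> B" and \<beta>: "\<beta> \<in> \<A>"
  shows "y \<in> cdom \<beta> \<longleftrightarrow> y' \<in> cdom \<beta>"
proof -
  obtain \<alpha> where \<alpha>: "\<alpha> \<in> \<A>" "y \<in> cdom \<alpha>" using ex_chart by blast
  have "y' \<in> chart_ball \<alpha> y r" using small_mball_eq[OF B y(1) \<alpha>] y(2) by blast
  from chart_ball_cdom_iff[OF \<alpha>(1) \<beta> \<alpha>(2) mball_radius_pos[OF B(1)] B(2) this]
  show ?thesis by blast
qed

lemma mball_leaving_small_mball:
  assumes B: "mball_radius \<A> r B" "r \<le> R" and y: "y \<in> B" "y' \<in> B" and x: "x \<notin> B"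
    and B': "mball_radius \<A> r' B'" "x \<in> B'" "y \<in> B'"
  shows "y' \<in> B'"
  using small_mball_nested[OF B B'(1) y(1) B'(3)] x y B'(2) by (auto split: if_splits)

lemma geodetic_dist_constant_right:
  assumes B: "mball_radius \<A> r B" "r \<le> R" and y: "y \<in> B" "y' \<in> B" and x: "x \<notin> B"
  shows "geodetic_dist \<A> \<mu> x y = geodetic_dist \<A> \<mu> x y'"
proof (rule geodetic_dist_cong)
  fix r' B' assume B': "mball_radius \<A> r' B'"
  show "x \<in> B' \<and> y \<in> B' \<longleftrightarrow> x \<in> B' \<and> y' \<in> B'"
    using mball_leaving_small_mball[OF B y x B'] mball_leaving_small_mball[OF B y(2,1) x B'] by iprover
qed (use mball_cdom_iff[OF B y] in simp_all)

lemma geodetic_dist_constant_left: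
  assumes B: "mball_radius \<A> r B" "r \<le> R" and y: "y \<in> B" "y' \<in> B" and x: "x \<notin> B"
  shows "geodetic_dist \<A> \<mu> y x = geodetic_dist \<A> \<mu> y' x"
proof (rule geodetic_dist_cong)
  fix r' B' assume B': "mball_radius \<A> r' B'"
  show "y \<in> B' \<and> x \<in> B' \<longleftrightarrow> y' \<in> B' \<and> x \<in> B'"
    using mball_leaving_small_mball[OF B y x B'] mball_leaving_small_mball[OF B y(2,1) x B'] by iprover
qed (use mball_cdom_iff[OF B y] in simp_all)

text \<open>
  The smallest chart ball around the two points is itself a ball of the manifold, and any other
  ball that contains both points is comparable with it. So it is their join.
\<close>

lemma geodetic_dist_inside:
  assumes B: "mball_radius \<A> r B" "r \<le> R" and x: "x \<in> B" and y: "y \<in> B" "y \<noteq> x"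
    and \<alpha>: "\<alpha> \<in> \<A>" "x \<in> cdom \<alpha>"
  shows "geodetic_dist \<A> \<mu> x y = measure \<mu> (chart_ball \<alpha> x (maxnorm (cmap \<alpha> y - cmap \<alpha> x)))"
proof -
  let ?\<rho> = "maxnorm (cmap \<alpha> y - cmap \<alpha> x)"
  let ?C = "chart_ball \<alpha> x ?\<rho>"
  have yB: "y \<in> chart_ball \<alpha> x r" using small_mball_eq[OF B x \<alpha>] y(1) by blast
  then have y\<alpha>: "y \<in> cdom \<alpha>" and \<rho>r: "?\<rho> \<le> r" by (auto simp: chart_ball_def kball_def)
  have "cmap \<alpha> y - cmap \<alpha> x \<noteq> 0" using cmap_inj[OF \<alpha>(1) y\<alpha> \<alpha>(2)] y(2) by auto
  then have "?\<rho> \<noteq> 0" by simp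
  then have \<rho>: "0 < ?\<rho>" using maxnorm_nonneg[of "cmap \<alpha> y - cmap \<alpha> x"] by linarith
  have C: "mball_radius \<A> ?\<rho> ?C" using mball_chart_ball[OF B x \<alpha> \<rho>] \<rho>r B(2) by simp
  have xy: "x \<in> ?C" "y \<in> ?C"
    using centre_in_chart_ball[OF \<alpha>(2), of ?\<rho>] \<rho> y\<alpha> by (simp_all add: chart_ball_def kball_def)
  have "?C \<subseteq> B'" if B': "mball_radius \<A> r' B'" "x \<in> B'" "y \<in> B'" for r' B'
  proof (cases "?\<rho> \<le> r'")
    case True
    then show ?thesis using small_mball_nested[OF C _ B'(1) xy(1) B'(2)] \<rho>r B(2) by simp
  next
    case False
    then have "B' = chart_ball \<alpha> x r'"
      using \<rho>r B(2) by (intro small_mball_eq[OF B'(1) _ B'(2) \<alpha>]) simp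
    then have "?\<rho> \<le> r'" using B'(3) by (simp add: chart_ball_def kball_def)
    with False show ?thesis by simp
  qed
  then have "join \<A> x y = ?C" unfolding join_def mball_def using C xy by blast
  moreover have "\<exists>B. mball \<A> B \<and> x \<in> B \<and> y \<in> B" unfolding mball_def using C xy by blast
  ultimately show ?thesis unfolding geodetic_dist_def by simp
qed


subsection \<open>The truncated kernel\<close>

text \<open>
  The kernel of the operator at a point of \<open>B\<close>, but with the distances inside \<open>B\<close> replaced by their
  maximum. A wavelet on \<open>B\<close> cannot tell the difference: it takes equal values at points that are
  closer.
\<close>

definition kernel :: "real \<Rightarrow> 'a set \<Rightarrow> 'a \<Rightarrow> 'a \<Rightarrow> real" where
  "kernel s B x y = (if y \<in> B then measure \<mu> B else geodetic_dist \<A> \<mu> x y) powr (- s)"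

definition eigenvalue :: "real \<Rightarrow> 'a set \<Rightarrow> 'a \<Rightarrow> real" where
  "eigenvalue s B x = (\<integral>y. kernel s B x y \<partial>\<mu>)"

lemma eigenvalue_cong:
  assumes "mball_radius \<A> r B" "r \<le> R" "x \<in> B" "x' \<in> B"
  shows "eigenvalue s B x = eigenvalue s B x'"
proof -
  have "kernel s B x y = kernel s B x' y" for y
    unfolding kernel_def using geodetic_dist_constant_left[OF assms] by simp
  then show ?thesis unfolding eigenvalue_def by presburger
qed

text \<open>
  Away from \<open>B\<close> the distance from a point of \<open>B\<close> is locally constant: a ball that contains this
  point and leaves \<open>B\<close> contains \<open>B\<close>, and so its radius is bounded below.
\<close>

lemma kernel_test_function:
  assumes B: "mball_radius \<A> r B" "r \<le> R" "x \<in> B"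
  shows "(\<lambda>y. complex_of_real (kernel s B x y)) \<in> test_functions"
proof (rule test_functionsI)
  fix y
  show "\<exists>V. open V \<and> y \<in> V \<and>
      (\<forall>y'\<in>V. complex_of_real (kernel s B x y') = complex_of_real (kernel s B x y))"
  proof (cases "y \<in> B")
    case True
    then show ?thesis using mball_open[OF B(1)] by (intro exI[of _ B]) (simp add: kernel_def)
  next
    case False
    have r: "0 < r" using mball_radius_pos[OF B(1)] .
    \<comment> \<open>Points near \<open>y\<close>: in the same charts as \<open>y\<close>, and in the ball of radius \<open>r\<close> around \<open>y\<close> in each of them.\<close>
    define N where "N \<beta> = (if y \<in> cdom \<beta> then chart_ball \<beta> y r else - cdom \<beta>)" for \<beta> :: "('a, 'k, 'n) chart"
    define V where "V = - B \<inter> (\<Inter>\<beta>\<in>\<A>. N \<beta>)"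
    have "open V"
      unfolding V_def N_def using finite_atlas mball_closed[OF B(1)] open_chart_ball[OF _ r] closed_cdom
      by (intro open_Int open_INT ballI) (auto simp: open_Compl)
    moreover have "y \<in> V"
      unfolding V_def N_def using False r by (auto simp: centre_in_chart_ball)
    moreover have dist: "geodetic_dist \<A> \<mu> x y' = geodetic_dist \<A> \<mu> x y" if y': "y' \<in> V" for y'
    proof (rule geodetic_dist_cong)
      have N: "y' \<in> N \<beta>" if "\<beta> \<in> \<A>" for \<beta> using y' that by (simp add: V_def)
      have y'B: "y' \<notin> B" using y' by (simp add: V_def)
      show dom: "y' \<in> cdom \<beta> \<longleftrightarrow> y \<in> cdom \<beta>" if \<beta>: "\<beta> \<in> \<A>" for \<beta>
        using N[OF \<beta>] by (auto simp: N_def chart_ball_def split: if_splits)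
      fix r' B' assume B': "mball_radius \<A> r' B'"
      show "x \<in> B' \<and> y' \<in> B' \<longleftrightarrow> x \<in> B' \<and> y \<in> B'"
      proof (cases "x \<in> B' \<and> (y' \<in> B' \<or> y \<in> B')")
        case True
        then have xB': "x \<in> B'" by blast
        have "\<not> B' \<subseteq> B" using True False y'B by blast
        then have le: "r \<le> r'" using small_mball_nested[OF B(1,2) B' B(3) xB'] by (auto split: if_splits)
        obtain \<beta> where \<beta>: "\<beta> \<in> \<A>" "B' \<subseteq> cdom \<beta>" using mball_radius_chart[OF B'] by blast
        then have y\<beta>: "y \<in> cdom \<beta>" using True dom[OF \<beta>(1)] by blast
        then have "y' \<in> chart_ball \<beta> y r" using N[OF \<beta>(1)] by (simp add: N_def)
        then have near: "y' \<in> chart_ball \<beta> y r'" using chart_ball_mono[OF le] by blast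
        have mutual: "y \<in> chart_ball \<beta> y r'" "chart_ball \<beta> y' r' = chart_ball \<beta> y r'"
          using centre_in_chart_ball[OF y\<beta>] r le chart_ball_recentre[OF near] by auto
        have "y' \<in> B'" if "y \<in> B'"
          using mball_in_chart[OF B' \<beta> that] near by blast
        moreover have "y \<in> B'" if "y' \<in> B'"
          using mball_in_chart[OF B' \<beta> that] mutual by blast
        ultimately show ?thesis by blast
      qed blast
    qed simp
    moreover have "complex_of_real (kernel s B x y') = complex_of_real (kernel s B x y)"
      if y': "y' \<in> V" for y'
    proof -
      have "y' \<notin> B" using y' by (simp add: V_def)
      then show ?thesis using False dist[OF y'] by (simp add: kernel_def)
    qed
    ultimately show ?thesis by (intro exI[of _ V] conjI ballI)
  qed
qed

lemma kernel_integrable: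
  assumes "mball_radius \<A> r B" "r \<le> R" "x \<in> B"
  shows "integrable \<mu> (kernel s B x)"
  using test_functions_integrable[OF kernel_test_function[OF assms]]
  by (simp add: complex_of_real_integrable_eq)

lemma small_mball_measure_pos:
  assumes "mball_radius \<A> r B"
  shows "0 < measure \<mu> B"
  using emeasure_open_pos[OF mball_open[OF assms] mball_radius_nonempty[OF assms]]
  by (simp add: emeasure_eq_measure)

lemma integral_less_if_gap:
  fixes f g :: "'a \<Rightarrow> real"
  assumes "integrable \<mu> f" "integrable \<mu> g" and le: "\<And>y. f y \<le> g y"
    and gap: "\<And>y. y \<in> S \<Longrightarrow> f y + c \<le> g y" "0 < c" and S: "S \<in> sets \<mu>" "0 < measure \<mu> S"
  shows "(\<integral>y. f y \<partial>\<mu>) < (\<integral>y. g y \<partial>\<mu>)"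
proof -
  have int: "integrable \<mu> (\<lambda>y. c * indicator S y)" using S by (simp add: emeasure_eq_measure)
  have "(\<integral>y. f y \<partial>\<mu>) < (\<integral>y. f y \<partial>\<mu>) + c * measure \<mu> S" using gap(2) S by simp
  also have "\<dots> = (\<integral>y. f y + c * indicator S y \<partial>\<mu>)"
    using assms(1) int S by (subst Bochner_Integration.integral_add) auto
  also have "\<dots> \<le> (\<integral>y. g y \<partial>\<mu>)"
    using assms(1,2) int le gap(1)
    by (intro integral_mono) (auto split: split_indicator)
  finally show ?thesis .
qed

text \<open>
  For nested balls one truncated kernel dominates the other, strictly so on the smaller ball. So
  the eigenvalues along a chain of balls are pairwise distinct, unless the exponent is zero.
\<close>

lemma eigenvalue_nested_distinct:
  assumes B: "mball_radius \<A> r B" "r \<le> R" and B': "mball_radius \<A> r' B'" "r' \<le> R"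
    and sub: "B' \<subset> B" and x: "x \<in> B'" and s: "s \<noteq> 0"
  shows "eigenvalue s B' x \<noteq> eigenvalue s B x"
proof -
  define D where "D B y = (if y \<in> B then measure \<mu> B else geodetic_dist \<A> \<mu> x y)" for B y
  have D: "kernel s B x y = D B y powr (- s)" "kernel s B' x y = D B' y powr (- s)" for y
    by (simp_all add: D_def kernel_def)
  have xB: "x \<in> B" using x sub by blast
  have pos: "0 < measure \<mu> B'" "0 < measure \<mu> B" using small_mball_measure_pos B B' by auto
  have less: "measure \<mu> B' < measure \<mu> B"
  proof -
    have "open (B - B')" using mball_open[OF B(1)] mball_closed[OF B'(1)] by (rule open_Diff)
    moreover have "B - B' \<noteq> {}" using sub by blast
    ultimately have "0 < emeasure \<mu> (B - B')" by (rule emeasure_open_pos)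
    then have "0 < measure \<mu> (B - B')" by (simp add: emeasure_eq_measure)
    moreover have "measure \<mu> (B - B') = measure \<mu> B - measure \<mu> B'"
      using sub mball_sets B(1) B'(1) by (intro finite_measure_Diff) auto
    ultimately show ?thesis by simp
  qed
  have mono: "D B' y \<le> D B y \<and> (D B' y = D B y \<or> 0 < D B' y)" for y
  proof (cases "y \<in> B - B'")
    case True
    obtain \<alpha> where \<alpha>: "\<alpha> \<in> \<A>" "x \<in> cdom \<alpha>" using ex_chart by blast
    let ?\<rho> = "maxnorm (cmap \<alpha> y - cmap \<alpha> x)"
    have "y \<noteq> x" using True x by blast
    then have d: "geodetic_dist \<A> \<mu> x y = measure \<mu> (chart_ball \<alpha> x ?\<rho>)"
      using geodetic_dist_inside[OF B xB _ _ \<alpha>] True by blast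
    have B_eq: "B = chart_ball \<alpha> x r" using small_mball_eq[OF B xB \<alpha>] .
    have B'_eq: "B' = chart_ball \<alpha> x r'" using small_mball_eq[OF B' x \<alpha>] .
    have "y \<in> chart_ball \<alpha> x r" "y \<notin> chart_ball \<alpha> x r'" using True B_eq B'_eq by blast+
    then have \<rho>: "?\<rho> \<le> r" "r' < ?\<rho>" by (auto simp: chart_ball_def kball_def)
    have sub1: "chart_ball \<alpha> x ?\<rho> \<subseteq> B" unfolding B_eq by (rule chart_ball_mono[OF \<rho>(1)])
    have sub2: "B' \<subseteq> chart_ball \<alpha> x ?\<rho>" unfolding B'_eq using \<rho>(2) by (intro chart_ball_mono) simp
    have "measure \<mu> (chart_ball \<alpha> x ?\<rho>) \<le> measure \<mu> B"
      using sub1 mball_sets[OF B(1)] by (rule finite_measure_mono)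
    moreover have "measure \<mu> B' \<le> measure \<mu> (chart_ball \<alpha> x ?\<rho>)"
      using sub2 chart_ball_sets[OF \<alpha>(1)] by (rule finite_measure_mono)
    ultimately show ?thesis using True d pos by (simp add: D_def)
  next
    case False
    then show ?thesis using less pos sub by (auto simp: D_def)
  qed
  have int: "integrable \<mu> (kernel s B x)" "integrable \<mu> (kernel s B' x)"
    using kernel_integrable[OF B xB] kernel_integrable[OF B' x] by auto
  have S: "B' \<in> sets \<mu>" using mball_sets[OF B'(1)] .
  have DB': "D B' y = measure \<mu> B'" "D B y = measure \<mu> B" if "y \<in> B'" for y
    using that sub by (auto simp: D_def)
  show ?thesis
  proof (cases "0 < s")
    case True
    have "(\<integral>y. kernel s B x y \<partial>\<mu>) < (\<integral>y. kernel s B' x y \<partial>\<mu>)"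
    proof (rule integral_less_if_gap[OF int _ _ _ S pos(1),
          where c = "measure \<mu> B' powr (- s) - measure \<mu> B powr (- s)"])
      show "kernel s B x y \<le> kernel s B' x y" for y
        unfolding D using mono[of y] True powr_mono2'[of "- s" "D B' y" "D B y"] by auto
      show "kernel s B x y + (measure \<mu> B' powr (- s) - measure \<mu> B powr (- s)) \<le> kernel s B' x y"
        if "y \<in> B'" for y unfolding D DB'[OF that] by simp
      show "0 < measure \<mu> B' powr (- s) - measure \<mu> B powr (- s)"
        using powr_less_mono2_neg[OF _ pos(1) less, of "- s"] True by simp
    qed
    then show ?thesis by (simp add: eigenvalue_def)
  next
    case False
    then have s: "s < 0" using s by simp
    have "(\<integral>y. kernel s B' x y \<partial>\<mu>) < (\<integral>y. kernel s B x y \<partial>\<mu>)"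
    proof (rule integral_less_if_gap[OF int(2,1) _ _ _ S pos(1),
          where c = "measure \<mu> B powr (- s) - measure \<mu> B' powr (- s)"])
      show "kernel s B' x y \<le> kernel s B x y" for y
        unfolding D using mono[of y] s powr_mono2[of "- s" "D B' y" "D B y"] by auto
      show "kernel s B' x y + (measure \<mu> B powr (- s) - measure \<mu> B' powr (- s)) \<le> kernel s B x y"
        if "y \<in> B'" for y unfolding D DB'[OF that] by simp
      show "0 < measure \<mu> B powr (- s) - measure \<mu> B' powr (- s)"
        using powr_less_mono2[of "- s", OF _ _ less] s pos by simp
    qed
    then show ?thesis by (simp add: eigenvalue_def)
  qed
qed

text \<open>
  Translations inside a maximal ball preserve the measure and the distance. So there the
  eigenvalue depends only on the radius.
\<close>

lemma eigenvalue_translate: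
  assumes B0: "mball_radius \<A> R B0" and x: "x \<in> B0" "x' \<in> B0"
    and \<alpha>: "\<alpha> \<in> \<A>" "x \<in> cdom \<alpha>" and r: "0 < r" "r \<le> R"
  shows "eigenvalue s (chart_ball \<alpha> x r) x = eigenvalue s (chart_ball \<alpha> x' r) x'"
proof -
  have B0_eq: "B0 = chart_ball \<alpha> x R" "B0 = chart_ball \<alpha> x' R"
  proof -
    show eq: "B0 = chart_ball \<alpha> x R" using small_mball_eq[OF B0 order_refl x(1) \<alpha>] .
    then show "B0 = chart_ball \<alpha> x' R" using chart_ball_recentre[of x' \<alpha> x R] x(2) by simp
  qed
  have x'\<alpha>: "x' \<in> cdom \<alpha>" using x(2) B0_eq(1) by (simp add: chart_ball_def)
  define t where "t = cmap \<alpha> x' - cmap \<alpha> x"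
  have t: "maxnorm t \<le> R" using x(2) B0_eq(1) by (simp add: t_def chart_ball_def kball_def)
  \<comment> \<open>This translation maps \<open>x\<close> to \<open>x'\<close>.\<close>
  define T where "T = shift \<alpha> x R t"
  let ?B = "chart_ball \<alpha> x r" and ?B' = "chart_ball \<alpha> x' r"
  have sub: "?B \<subseteq> B0" "?B' \<subseteq> B0" using chart_ball_mono[OF r(2)] B0_eq by blast+
  have meas: "measure \<mu> (chart_ball \<alpha> x' \<rho>) = measure \<mu> (chart_ball \<alpha> x \<rho>)" if "\<rho> \<le> R" for \<rho>
    using x(2) B0_eq(1) that by (intro measure_chart_ball_eq[OF \<alpha>]) auto
  have "kernel s ?B' x' (T y) = kernel s ?B x y" for y
  proof (cases "y \<in> B0")
    case True
    then have y: "y \<in> chart_ball \<alpha> x R" using B0_eq by simp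
    note Ty = shift_inside[OF \<alpha> order_refl t y, folded T_def]
    have TyB0: "T y \<in> B0" using Ty(1) B0_eq by simp
    have diff: "cmap \<alpha> (T y) - cmap \<alpha> x' = cmap \<alpha> y - cmap \<alpha> x" using Ty(2) by (simp add: t_def)
    have dom: "y \<in> cdom \<alpha>" "T y \<in> cdom \<alpha>" using y Ty(1) by (auto simp: chart_ball_def)
    have iff: "T y \<in> ?B' \<longleftrightarrow> y \<in> ?B" using dom diff by (simp add: chart_ball_def kball_def)
    show ?thesis
    proof (cases "y \<in> ?B")
      case True
      then show ?thesis using iff meas[OF r(2)] by (simp add: kernel_def)
    next
      case False
      have "x \<in> ?B" using centre_in_chart_ball[OF \<alpha>(2)] r by simp
      then have ne: "y \<noteq> x" using False by blast
      have "x' \<in> ?B'" using centre_in_chart_ball[OF x'\<alpha>] r by simp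
      then have ne': "T y \<noteq> x'" using False iff by blast
      have "maxnorm (cmap \<alpha> y - cmap \<alpha> x) \<le> R" using y by (simp add: chart_ball_def kball_def)
      from meas[OF this] have "geodetic_dist \<A> \<mu> x' (T y) = geodetic_dist \<A> \<mu> x y"
        using geodetic_dist_inside[OF B0 order_refl x(1) True ne \<alpha>]
          geodetic_dist_inside[OF B0 order_refl x(2) TyB0 ne' \<alpha>(1) x'\<alpha>] diff by simp
      then show ?thesis using False iff by (simp add: kernel_def)
    qed
  next
    case False
    then have "T y = y" using B0_eq by (simp add: T_def shift_outside)
    moreover have "y \<notin> ?B" "y \<notin> ?B'" using False sub by blast+
    moreover have "geodetic_dist \<A> \<mu> x' y = geodetic_dist \<A> \<mu> x y"
      using geodetic_dist_constant_left[OF B0 order_refl x(2,1) False] .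
    ultimately show ?thesis by (simp add: kernel_def)
  qed
  note inv = this
  have B': "mball_radius \<A> r ?B'" using mball_chart_ball[OF B0 order_refl x(2) \<alpha>(1) x'\<alpha> r] .
  have meas_kernel: "kernel s ?B' x' \<in> borel_measurable \<mu>"
    using kernel_integrable[OF B' r(2)] centre_in_chart_ball[OF x'\<alpha>, of r] r
    by (intro borel_measurable_integrable) simp
  have "eigenvalue s ?B' x' = (\<integral>y. kernel s ?B' x' (shift \<alpha> x R t y) \<partial>\<mu>)"
    unfolding eigenvalue_def using integral_shift[OF \<alpha> R_pos order_refl t meas_kernel] by simp
  also have "\<dots> = (\<integral>y. kernel s ?B x y \<partial>\<mu>)"
    by (rule Bochner_Integration.integral_cong[OF refl inv[unfolded T_def]])
  finally show ?thesis by (simp add: eigenvalue_def)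
qed

text \<open>
  A maximal ball thus contains only balls of one radius with a given eigenvalue, and there are
  finitely many maximal balls.
\<close>

lemma finite_mballs_with_eigenvalue:
  assumes s: "s \<noteq> 0"
  shows "finite {B. \<exists>r\<le>R. mball_radius \<A> r B \<and> (\<exists>x\<in>B. eigenvalue s B x = \<kappa>)}"
    (is "finite ?S")
proof -
  define ev where "ev B \<longleftrightarrow> (\<exists>r\<le>R. mball_radius \<A> r B \<and> (\<exists>x\<in>B. eigenvalue s B x = \<kappa>))" for B
  have fin: "finite {B. ev B \<and> B \<subseteq> B0}" if B0: "mball_radius \<A> R B0" for B0
  proof (cases "{B. ev B \<and> B \<subseteq> B0} = {}")
    case False
    then obtain B1 where "ev B1" "B1 \<subseteq> B0" by blast
    then obtain r1 x1 where B1: "B1 \<subseteq> B0" "r1 \<le> R" "mball_radius \<A> r1 B1" "x1 \<in> B1"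
        "eigenvalue s B1 x1 = \<kappa>" unfolding ev_def by blast
    obtain \<alpha> where \<alpha>: "\<alpha> \<in> \<A>" "x1 \<in> cdom \<alpha>" using ex_chart by blast
    have r1: "0 < r1" using mball_radius_pos[OF B1(3)] .
    have x1: "x1 \<in> B0" using B1 by blast
    have "{B. ev B \<and> B \<subseteq> B0} \<subseteq> {B. \<exists>r. r1 \<le> r \<and> r \<le> R \<and> mball_radius \<A> r B}"
    proof
      fix B assume "B \<in> {B. ev B \<and> B \<subseteq> B0}"
      then have "ev B" and BB0: "B \<subseteq> B0" by blast+
      then obtain r x where B: "B \<subseteq> B0" "r \<le> R" "mball_radius \<A> r B" "x \<in> B"
          "eigenvalue s B x = \<kappa>" unfolding ev_def by blast
      show "B \<in> {B. \<exists>r. r1 \<le> r \<and> r \<le> R \<and> mball_radius \<A> r B}"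
      proof (cases "r1 \<le> r")
        case True
        then show ?thesis using B by blast
      next
        case False
        have x: "x \<in> B0" using B by blast
        have x\<alpha>: "x \<in> cdom \<alpha>" using mball_cdom_iff[OF B0 order_refl x1 x \<alpha>(1)] \<alpha>(2) by blast
        \<comment> \<open>A ball around \<open>x\<close> as large as \<open>B1\<close> has the same eigenvalue, so \<open>B\<close> cannot be smaller.\<close>
        let ?B' = "chart_ball \<alpha> x r1"
        have B': "mball_radius \<A> r1 ?B'" using mball_chart_ball[OF B0 order_refl x \<alpha>(1) x\<alpha> r1 B1(2)] .
        have "B1 = chart_ball \<alpha> x1 r1" using small_mball_eq[OF B1(3,2,4) \<alpha>] .
        then have ev: "eigenvalue s ?B' x = \<kappa>"
          using eigenvalue_translate[OF B0 x1 x \<alpha> r1 B1(2)] B1(5) by simp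
        have "B = chart_ball \<alpha> x r" using small_mball_eq[OF B(3,2,4) \<alpha>(1) x\<alpha>] .
        then have "B \<subseteq> ?B'" using False chart_ball_mono[of r r1 \<alpha> x] by simp
        moreover have "\<not> B \<subset> ?B'"
          using eigenvalue_nested_distinct[OF B' B1(2) B(3,2) _ B(4) s] ev B(5) by blast
        ultimately have "B = ?B'" by blast
        then show ?thesis using B' B1(2) by blast
      qed
    qed
    then show ?thesis using finite_mballs_above[OF r1] by (rule finite_subset)
  next
    case True
    then show ?thesis by (simp only: finite.emptyI)
  qed
  have "{B. ev B} \<subseteq> (\<Union>B0\<in>{B0. mball_radius \<A> R B0}. {B. ev B \<and> B \<subseteq> B0})"
  proof
    fix B assume "B \<in> {B. ev B}"
    then have BS: "ev B" by simp
    then obtain r x where B: "r \<le> R" "mball_radius \<A> r B" "x \<in> B" unfolding ev_def by blast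
    obtain \<alpha> where \<alpha>: "\<alpha> \<in> \<A>" "x \<in> cdom \<alpha>" using ex_chart by blast
    have "mball_radius \<A> R (chart_ball \<alpha> x R)" using mball_chart_ball[OF B(2,1,3) \<alpha> R_pos order_refl] .
    moreover have "B \<subseteq> chart_ball \<alpha> x R"
      using small_mball_eq[OF B(2,1,3) \<alpha>] chart_ball_mono[OF B(1)] by blast
    ultimately show "B \<in> (\<Union>B0\<in>{B0. mball_radius \<A> R B0}. {B. ev B \<and> B \<subseteq> B0})" using BS by blast
  qed
  moreover have "finite {B0. mball_radius \<A> R B0}"
    using finite_mballs_above[OF R_pos] by (rule rev_finite_subset) auto
  then have "finite (\<Union>B0\<in>{B0. mball_radius \<A> R B0}. {B. ev B \<and> B \<subseteq> B0})"
    by (rule finite_UN_I) (rule fin, simp)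
  ultimately have "finite {B. ev B}" by (rule finite_subset)
  then show ?thesis by (simp only: ev_def)
qed

end

section \<open>Wavelets are eigenfunctions\<close>

context wavelet_atlas
begin

text \<open>
  On the support of a wavelet the integrand of the operator only involves the truncated kernel;
  at a point off the support the distance to the points of the support is constant. In both cases all that is left of
  the wavelet inside the integral is its mean, which vanishes.
\<close>

lemma laplacian_integrand:
  fixes s :: real
  assumes \<psi>: "\<psi> \<in> W" and on: "wavelet_on \<A> \<mu> \<pi> \<theta> B \<psi>" and B: "mball_radius \<A> r B" "r \<le> R"
    and x0: "x0 \<in> B"
  defines "f \<equiv> \<lambda>x y. complex_of_real (geodetic_dist \<A> \<mu> x y powr (- s)) * (\<psi> x - \<psi> y)"
  shows "f x \<in> test_functions" "(\<integral>y. f x y \<partial>\<mu>) = complex_of_real (eigenvalue s B x0) * \<psi> x"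
proof -
  have out: "\<psi> y = 0" if "y \<notin> B" for y using on that unfolding wavelet_on_def by blast
  have \<psi>_test: "\<psi> \<in> test_functions" using wavelet_test_function[OF \<psi>] .
  have "f x \<in> test_functions \<and> (\<integral>y. f x y \<partial>\<mu>) = complex_of_real (eigenvalue s B x0) * \<psi> x"
  proof (cases "x \<in> B")
    case True
    obtain \<alpha> where \<alpha>: "\<alpha> \<in> \<A>" "x \<in> cdom \<alpha>" using ex_chart by blast
    obtain C \<eta> m where form: "wavelet_form \<alpha> B \<psi> C \<eta> m" "B = chart_ball \<alpha> x (absv \<pi> powi m)"
      using wavelet_on_form[OF on B True \<alpha>] .
    let ?K = "\<lambda>y. complex_of_real (kernel s B x y)"
    have K: "?K \<in> test_functions" using kernel_test_function[OF B True] .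
    have far: "geodetic_dist \<A> \<mu> x y = measure \<mu> B" if y: "y \<in> B" and ne: "\<psi> y \<noteq> \<psi> x" for y
    proof -
      let ?\<rho> = "maxnorm (cmap \<alpha> y - cmap \<alpha> x)"
      have "\<not> ?\<rho> \<le> absv \<pi> powi (m + 1)" using wavelet_form_near[OF form(1) True y] ne by blast
      moreover obtain i where i: "?\<rho> = absv ((cmap \<alpha> y - cmap \<alpha> x) $ i)" using maxnorm_attained by blast
      ultimately have "\<not> ?\<rho> < absv \<pi> powi m" using absv_less_uniformiser[OF uniformiser] by metis
      moreover have "?\<rho> \<le> absv \<pi> powi m" using y form(2) by (simp add: chart_ball_def kball_def)
      ultimately have "?\<rho> = absv \<pi> powi m" by simp
      moreover have "y \<noteq> x" using ne by blast
      ultimately show ?thesis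
        using geodetic_dist_inside[OF B True y _ \<alpha>] form(2) by simp
    qed
    have f_eq: "f x = (\<lambda>y. ?K y * (\<psi> x - \<psi> y))"
    proof
      fix y show "f x y = ?K y * (\<psi> x - \<psi> y)"
      proof (cases "y \<in> B \<and> \<psi> y \<noteq> \<psi> x")
        case True
        then show ?thesis using far[of y] by (simp add: f_def kernel_def)
      next
        case False
        then show ?thesis by (cases "y \<in> B") (simp_all add: f_def kernel_def)
      qed
    qed
    have diff: "(\<lambda>y. \<psi> x - \<psi> y) \<in> test_functions"
      using test_functions_binop[OF \<psi>_test \<psi>_test, of "\<lambda>u v. \<psi> x - u"] .
    have 1: "f x \<in> test_functions"
      unfolding f_eq using test_functions_binop[OF K diff, of "(*)"] .
    have K\<psi>: "?K y * \<psi> y = complex_of_real (measure \<mu> B powr (- s)) * \<psi> y" for y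
      by (cases "y \<in> B") (simp_all add: kernel_def out)
    have "(\<integral>y. f x y \<partial>\<mu>) = (\<integral>y. ?K y * \<psi> x - ?K y * \<psi> y \<partial>\<mu>)"
      by (simp only: f_eq right_diff_distrib)
    also have "\<dots> = (\<integral>y. ?K y * \<psi> x \<partial>\<mu>) - (\<integral>y. ?K y * \<psi> y \<partial>\<mu>)"
      using test_functions_integrable[OF K]
        test_functions_integrable[OF test_functions_binop[OF K \<psi>_test, of "(*)"]]
      by (intro Bochner_Integration.integral_diff integrable_mult_left) auto
    also have "(\<integral>y. ?K y * \<psi> x \<partial>\<mu>) = complex_of_real (eigenvalue s B x) * \<psi> x"
      by (simp only: integral_mult_left_zero eigenvalue_def integral_complex_of_real)
    also have "(\<integral>y. ?K y * \<psi> y \<partial>\<mu>) = complex_of_real (measure \<mu> B powr (- s)) * (\<integral>y. \<psi> y \<partial>\<mu>)"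
      by (simp only: K\<psi> integral_mult_right_zero)
    also have "(\<integral>y. \<psi> y \<partial>\<mu>) = 0" using wavelet_integral_0[OF \<psi>] .
    also have "eigenvalue s B x = eigenvalue s B x0" using eigenvalue_cong[OF B True x0] .
    finally show ?thesis using 1 by simp
  next
    case False
    define c where "c = - complex_of_real (geodetic_dist \<A> \<mu> x x0 powr (- s))"
    have f_eq: "f x = (\<lambda>y. c * \<psi> y)"
    proof
      fix y show "f x y = c * \<psi> y"
      proof (cases "y \<in> B")
        case True
        then show ?thesis
          using geodetic_dist_constant_right[OF B True x0 False] out[OF False] by (simp add: f_def c_def)
      qed (simp add: f_def out False)
    qed
    have "(\<lambda>y. c * \<psi> y) \<in> test_functions"
      using test_functions_binop[OF \<psi>_test \<psi>_test, of "\<lambda>u v. c * u"] .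
    moreover have "(\<integral>y. c * \<psi> y \<partial>\<mu>) = 0" using wavelet_integral_0[OF \<psi>] by simp
    ultimately show ?thesis using out[OF False] by (simp only: f_eq) simp
  qed
  then show "f x \<in> test_functions" "(\<integral>y. f x y \<partial>\<mu>) = complex_of_real (eigenvalue s B x0) * \<psi> x"
    by auto
qed

lemma wavelet_nonzero:
  assumes "\<psi> \<in> W"
  shows "\<exists>x. \<psi> x \<noteq> 0"
proof (rule ccontr)
  assume "\<nexists>x. \<psi> x \<noteq> 0"
  then have "l2_norm \<mu> \<psi> = 0" by (simp add: l2_norm_def)
  then show False using wavelet_norm[OF assms] by simp
qed

definition wavelet_eigenvalue :: "real \<Rightarrow> ('a \<Rightarrow> complex) \<Rightarrow> complex" where
  "wavelet_eigenvalue s \<psi> = (SOME \<kappa>. \<forall>x. geodetic_laplacian \<A> \<mu> s \<psi> x = \<kappa> * \<psi> x)"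

lemma laplacian_wavelet:
  assumes "\<psi> \<in> W"
  shows "geodetic_laplacian \<A> \<mu> s \<psi> x = wavelet_eigenvalue s \<psi> * \<psi> x"
proof -
  obtain B r x0 where B: "r \<le> R" "mball_radius \<A> r B" "wavelet_on \<A> \<mu> \<pi> \<theta> B \<psi>" "x0 \<in> B"
    using wavelets_uptoE[OF assms] .
  have "\<exists>\<kappa>. \<forall>x. geodetic_laplacian \<A> \<mu> s \<psi> x = \<kappa> * \<psi> x"
    using laplacian_integrand(2)[OF assms B(3,2,1,4)] unfolding geodetic_laplacian_def by blast
  from someI_ex[OF this] show ?thesis unfolding wavelet_eigenvalue_def by blast
qed

lemma wavelet_eigenvalue_eq:
  assumes "\<psi> \<in> W" "wavelet_on \<A> \<mu> \<pi> \<theta> B \<psi>" "mball_radius \<A> r B" "r \<le> R" "x0 \<in> B"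
  shows "wavelet_eigenvalue s \<psi> = complex_of_real (eigenvalue s B x0)"
proof -
  obtain x where x: "\<psi> x \<noteq> 0" using wavelet_nonzero[OF assms(1)] by blast
  have "geodetic_laplacian \<A> \<mu> s \<psi> x = complex_of_real (eigenvalue s B x0) * \<psi> x"
    using laplacian_integrand(2)[OF assms] unfolding geodetic_laplacian_def .
  then show ?thesis using laplacian_wavelet[OF assms(1), of s x] x by simp
qed

lemma laplacian_sum:
  assumes S: "finite S" "S \<subseteq> W"
  shows "geodetic_laplacian \<A> \<mu> s (\<lambda>x. \<Sum>\<psi>\<in>S. c \<psi> * \<psi> x) x =
    (\<Sum>\<psi>\<in>S. c \<psi> * (wavelet_eigenvalue s \<psi> * \<psi> x))"
proof -
  let ?k = "\<lambda>y. complex_of_real (geodetic_dist \<A> \<mu> x y powr (- s))"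
  have int: "integrable \<mu> (\<lambda>y. ?k y * (\<psi> x - \<psi> y))" if "\<psi> \<in> S" for \<psi>
  proof -
    have \<psi>: "\<psi> \<in> W" using that S by blast
    obtain B r x0 where B: "r \<le> R" "mball_radius \<A> r B" "wavelet_on \<A> \<mu> \<pi> \<theta> B \<psi>" "x0 \<in> B"
      using wavelets_uptoE[OF \<psi>] .
    show ?thesis
      using test_functions_integrable[OF laplacian_integrand(1)[OF \<psi> B(3,2,1,4)]] .
  qed
  have "geodetic_laplacian \<A> \<mu> s (\<lambda>x. \<Sum>\<psi>\<in>S. c \<psi> * \<psi> x) x =
      (\<integral>y. (\<Sum>\<psi>\<in>S. c \<psi> * (?k y * (\<psi> x - \<psi> y))) \<partial>\<mu>)"
    unfolding geodetic_laplacian_def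
    by (intro Bochner_Integration.integral_cong refl)
      (simp add: sum_distrib_left sum_subtractf right_diff_distrib mult.left_commute)
  also have "\<dots> = (\<Sum>\<psi>\<in>S. \<integral>y. c \<psi> * (?k y * (\<psi> x - \<psi> y)) \<partial>\<mu>)"
    using int by (intro Bochner_Integration.integral_sum integrable_mult_right) auto
  also have "\<dots> = (\<Sum>\<psi>\<in>S. c \<psi> * geodetic_laplacian \<A> \<mu> s \<psi> x)"
    by (simp only: integral_mult_right_zero geodetic_laplacian_def)
  also have "\<dots> = (\<Sum>\<psi>\<in>S. c \<psi> * (wavelet_eigenvalue s \<psi> * \<psi> x))"
    using S(2) by (intro sum.cong refl) (simp add: laplacian_wavelet subset_iff)
  finally show ?thesis .
qed

end


section \<open>An orthonormal basis of wavelets\<close>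

lemma lin_spanI:
  assumes "finite S" "S \<subseteq> W"
  shows "(\<lambda>x. \<Sum>\<psi>\<in>S. c \<psi> * \<psi> x) \<in> lin_span W"
  unfolding lin_span_def by (rule CollectI, rule exI[of _ S], rule exI[of _ c]) (use assms in simp)

lemma lin_spanE:
  assumes "u \<in> lin_span W"
  obtains S c where "finite S" "S \<subseteq> W" "u = (\<lambda>x. \<Sum>\<psi>\<in>S. c \<psi> * \<psi> x)"
  using assms unfolding lin_span_def mem_Collect_eq by (elim exE conjE)

lemma lin_span_base:
  assumes "\<psi> \<in> W"
  shows "\<psi> \<in> lin_span W"
  using lin_spanI[of "{\<psi>}" W "\<lambda>_. 1"] assms by simp

lemma lin_span_add_scaled:
  assumes "u \<in> lin_span W" "v \<in> lin_span W"
  shows "(\<lambda>x. u x + b * v x) \<in> lin_span W"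
proof -
  obtain S c where S: "finite S" "S \<subseteq> W" "u = (\<lambda>x. \<Sum>\<psi>\<in>S. c \<psi> * \<psi> x)"
    using lin_spanE[OF assms(1)] .
  obtain T d where T: "finite T" "T \<subseteq> W" "v = (\<lambda>x. \<Sum>\<psi>\<in>T. d \<psi> * \<psi> x)"
    using lin_spanE[OF assms(2)] .
  let ?c = "\<lambda>\<psi>. (if \<psi> \<in> S then c \<psi> else 0) + b * (if \<psi> \<in> T then d \<psi> else 0)"
  have u: "u x = (\<Sum>\<psi>\<in>S \<union> T. (if \<psi> \<in> S then c \<psi> else 0) * \<psi> x)" for x
    unfolding S(3) using S T by (intro sum.mono_neutral_cong_left) auto
  have v: "v x = (\<Sum>\<psi>\<in>S \<union> T. (if \<psi> \<in> T then d \<psi> else 0) * \<psi> x)" for x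
    unfolding T(3) using S T by (intro sum.mono_neutral_cong_left) auto
  have "(\<lambda>x. u x + b * v x) = (\<lambda>x. \<Sum>\<psi>\<in>S \<union> T. ?c \<psi> * \<psi> x)"
    by (simp only: u v sum_distrib_left ring_distribs sum.distrib mult.assoc)
  moreover have "(\<lambda>x. \<Sum>\<psi>\<in>S \<union> T. ?c \<psi> * \<psi> x) \<in> lin_span W"
    using S T by (intro lin_spanI) auto
  ultimately show ?thesis by (simp only:)
qed

lemma lin_span_0: "(\<lambda>x. 0) \<in> lin_span W"
  using lin_spanI[of "{}" W] by simp

lemma lin_span_sum:
  assumes "\<And>i. i \<in> I \<Longrightarrow> f i \<in> lin_span W"
  shows "(\<lambda>x. \<Sum>i\<in>I. c i * f i x) \<in> lin_span W"
  using assms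
proof (induction I rule: infinite_finite_induct)
  case (insert i I)
  have "(\<lambda>x. (\<Sum>i\<in>I. c i * f i x) + c i * f i x) \<in> lin_span W"
    using insert by (intro lin_span_add_scaled) auto
  then show ?case using insert(1,2) by (simp add: add.commute)
qed (simp_all add: lin_span_0)

lemma lin_span_subset:
  assumes "V \<subseteq> lin_span W"
  shows "lin_span V \<subseteq> lin_span W"
proof
  fix u assume "u \<in> lin_span V"
  then obtain S c where S: "finite S" "S \<subseteq> V" "u = (\<lambda>x. \<Sum>\<psi>\<in>S. c \<psi> * \<psi> x)"
    by (rule lin_spanE)
  show "u \<in> lin_span W" unfolding S(3) using S(2) assms by (intro lin_span_sum) blast
qed

context fine_atlas
begin

lemma test_functions_inner_integrable:
  fixes g h :: "'a \<Rightarrow> complex"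
  assumes "g \<in> test_functions" "h \<in> test_functions"
  shows "integrable \<mu> (\<lambda>x. g x * cnj (h x))"
  using test_functions_integrable[OF test_functions_binop[OF assms, of "\<lambda>u v. u * cnj v"]] .

lemma l2_inner_diff_left:
  assumes "g \<in> test_functions" "g' \<in> test_functions" "h \<in> test_functions"
  shows "l2_inner \<mu> (\<lambda>x. g x - g' x) h = l2_inner \<mu> g h - l2_inner \<mu> g' h"
proof -
  have "l2_inner \<mu> (\<lambda>x. g x - g' x) h = (\<integral>x. g x * cnj (h x) - g' x * cnj (h x) \<partial>\<mu>)"
    by (simp only: l2_inner_def left_diff_distrib)
  also have "\<dots> = l2_inner \<mu> g h - l2_inner \<mu> g' h"
    unfolding l2_inner_def using assms
    by (intro Bochner_Integration.integral_diff test_functions_inner_integrable)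
  finally show ?thesis .
qed

lemma l2_inner_sum_left:
  assumes "\<And>\<psi>. \<psi> \<in> S \<Longrightarrow> f \<psi> \<in> test_functions" "h \<in> test_functions"
  shows "l2_inner \<mu> (\<lambda>x. \<Sum>\<psi>\<in>S. c \<psi> * f \<psi> x) h = (\<Sum>\<psi>\<in>S. c \<psi> * l2_inner \<mu> (f \<psi>) h)"
proof -
  have "l2_inner \<mu> (\<lambda>x. \<Sum>\<psi>\<in>S. c \<psi> * f \<psi> x) h = (\<integral>x. (\<Sum>\<psi>\<in>S. c \<psi> * (f \<psi> x * cnj (h x))) \<partial>\<mu>)"
    by (simp only: l2_inner_def sum_distrib_right mult.assoc)
  also have "\<dots> = (\<Sum>\<psi>\<in>S. \<integral>x. c \<psi> * (f \<psi> x * cnj (h x)) \<partial>\<mu>)"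
    using assms by (intro Bochner_Integration.integral_sum integrable_mult_right test_functions_inner_integrable)
  also have "\<dots> = (\<Sum>\<psi>\<in>S. c \<psi> * l2_inner \<mu> (f \<psi>) h)"
    by (simp only: integral_mult_right_zero l2_inner_def)
  finally show ?thesis .
qed

lemma l2_norm_0_imp_AE:
  assumes "h \<in> L2 \<mu>" "l2_norm \<mu> h = 0"
  shows "AE x in \<mu>. h x = 0"
proof -
  have int: "integrable \<mu> (\<lambda>x. (cmod (h x))\<^sup>2)" using assms(1) by (simp add: L2_def)
  have "(\<integral>x. (cmod (h x))\<^sup>2 \<partial>\<mu>) = 0" using assms(2) by (simp add: l2_norm_def)
  then have "AE x in \<mu>. (cmod (h x))\<^sup>2 = 0"
    using integral_nonneg_eq_0_iff_AE[OF int] by simp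
  then show ?thesis by simp
qed

end

context wavelet_atlas
begin

abbreviation orthonormal :: "('a \<Rightarrow> complex) set \<Rightarrow> bool" where
  "orthonormal \<Psi> \<equiv> (\<forall>\<psi>\<in>\<Psi>. \<forall>\<psi>'\<in>\<Psi>. l2_inner \<mu> \<psi> \<psi>' = (if \<psi> = \<psi>' then 1 else 0))"

text \<open>One representative from each class of proportional wavelets.\<close>

lemma ex_orthonormal_wavelets:
  obtains \<Psi> where "\<Psi> \<subseteq> W" "orthonormal \<Psi>" "lin_span \<Psi> = lin_span W"
proof -
  define parallel where "parallel \<psi> \<psi>' \<longleftrightarrow> (\<exists>c. c \<noteq> 0 \<and> (\<forall>y. \<psi>' y = c * \<psi> y))"
    for \<psi> \<psi>' :: "'a \<Rightarrow> complex"
  have refl: "parallel \<psi> \<psi>" for \<psi> unfolding parallel_def by (rule exI[of _ 1]) simp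
  have sym: "parallel \<psi>' \<psi>" if p: "parallel \<psi> \<psi>'" for \<psi> \<psi>'
  proof -
    obtain c where c: "c \<noteq> 0" "\<And>y. \<psi>' y = c * \<psi> y" using p unfolding parallel_def by blast
    then have "inverse c \<noteq> 0 \<and> (\<forall>y. \<psi> y = inverse c * \<psi>' y)" by simp
    then show ?thesis unfolding parallel_def by blast
  qed
  have trans: "parallel \<psi> \<psi>''" if p: "parallel \<psi> \<psi>'" "parallel \<psi>' \<psi>''" for \<psi> \<psi>' \<psi>''
  proof -
    obtain c where "c \<noteq> 0" "\<And>y. \<psi>' y = c * \<psi> y" using p(1) unfolding parallel_def by blast
    moreover obtain d where "d \<noteq> 0" "\<And>y. \<psi>'' y = d * \<psi>' y" using p(2) unfolding parallel_def by blast
    ultimately have "d * c \<noteq> 0 \<and> (\<forall>y. \<psi>'' y = (d * c) * \<psi> y)" by simp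
    then show ?thesis unfolding parallel_def by blast
  qed
  define rep where "rep \<psi> = (SOME \<psi>'. \<psi>' \<in> W \<and> parallel \<psi> \<psi>')" for \<psi>
  have rep: "rep \<psi> \<in> W \<and> parallel \<psi> (rep \<psi>)" if "\<psi> \<in> W" for \<psi>
    unfolding rep_def by (rule someI[of _ \<psi>]) (use that refl in blast)
  have rep_eq: "rep \<psi> = rep \<psi>'" if "parallel \<psi> \<psi>'" for \<psi> \<psi>'
  proof -
    have "parallel \<psi> = parallel \<psi>'" using that sym trans by (intro ext) blast
    then show ?thesis unfolding rep_def by simp
  qed
  have sub: "rep ` W \<subseteq> W" using rep by blast
  moreover have "orthonormal (rep ` W)"
  proof (intro ballI)
    fix \<psi> \<psi>' assume "\<psi> \<in> rep ` W" "\<psi>' \<in> rep ` W"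
    then obtain \<phi> \<phi>' where \<phi>: "\<phi> \<in> W" "\<psi> = rep \<phi>" "\<phi>' \<in> W" "\<psi>' = rep \<phi>'" by blast
    have \<psi>: "\<psi> \<in> W" "parallel \<phi> \<psi>" "\<psi>' \<in> W" "parallel \<phi>' \<psi>'" using rep \<phi> by auto
    show "l2_inner \<mu> \<psi> \<psi>' = (if \<psi> = \<psi>' then 1 else 0)"
    proof (cases "\<psi> = \<psi>'")
      case True
      then show ?thesis using wavelet_norm[OF \<psi>(1)] by (simp add: l2_inner_self)
    next
      case False
      have "\<not> parallel \<psi> \<psi>'"
      proof
        assume "parallel \<psi> \<psi>'"
        then have "parallel \<phi> \<phi>'" using \<psi>(2) sym[OF \<psi>(4)] trans by blast
        then show False using rep_eq \<phi> False by blast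
      qed
      then show ?thesis
        using wavelets_orthogonal_or_proportional[OF \<psi>(1,3)] False unfolding parallel_def
        by (metis (no_types, lifting))
    qed
  qed
  moreover have "lin_span (rep ` W) = lin_span W"
  proof
    show "lin_span (rep ` W) \<subseteq> lin_span W"
      using sub lin_span_base by (intro lin_span_subset) blast
    show "lin_span W \<subseteq> lin_span (rep ` W)"
    proof (rule lin_span_subset, rule subsetI)
      fix \<psi> assume \<psi>: "\<psi> \<in> W"
      then have "parallel (rep \<psi>) \<psi>" using rep sym by blast
      then obtain c where c: "\<And>y. \<psi> y = c * rep \<psi> y" unfolding parallel_def by blast
      have "(\<lambda>y. 0 + c * rep \<psi> y) \<in> lin_span (rep ` W)"
        using \<psi> by (intro lin_span_add_scaled lin_span_0 lin_span_base) blast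
      moreover have "\<psi> = (\<lambda>y. 0 + c * rep \<psi> y)" by (rule ext) (subst c, simp)
      ultimately show "\<psi> \<in> lin_span (rep ` W)" by (simp only:)
    qed
  qed
  ultimately show ?thesis using that by blast
qed

text \<open>
  Wavelets on one ball are determined up to proportionality by their frequencies modulo the
  maximal ideal.
\<close>

lemma finite_orthonormal_on_mball:
  assumes \<Psi>: "\<Psi> \<subseteq> W" "orthonormal \<Psi>" and B: "mball_radius \<A> r B" "r \<le> R"
  shows "finite {\<psi> \<in> \<Psi>. wavelet_on \<A> \<mu> \<pi> \<theta> B \<psi>}"
proof -
  obtain x where x: "x \<in> B" using mball_radius_nonempty[OF B(1)] by blast
  obtain \<alpha> where \<alpha>: "\<alpha> \<in> \<A>" "x \<in> cdom \<alpha>" using ex_chart by blast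
  obtain F :: "('k ^ 'n) set" where F: "finite F" "kball 0 1 \<subseteq> (\<Union>c\<in>F. kball c (absv \<pi>))"
    using finite_kball_cover[OF absv_pi(1)] .
  let ?S = "{\<psi> \<in> \<Psi>. wavelet_on \<A> \<mu> \<pi> \<theta> B \<psi>}"
  \<comment> \<open>The frequency of a wavelet modulo the maximal ideal, represented by a point of \<open>F\<close>.\<close>
  define freq where "freq \<psi> c \<longleftrightarrow> c \<in> F \<and> (\<exists>C \<eta> m. wavelet_form \<alpha> B \<psi> C \<eta> m \<and>
    B = chart_ball \<alpha> x (absv \<pi> powi m) \<and> \<eta> \<in> kball c (absv \<pi>))" for \<psi> c
  have ex: "\<exists>c. freq \<psi> c" if \<psi>: "\<psi> \<in> ?S" for \<psi>
  proof -
    have on: "wavelet_on \<A> \<mu> \<pi> \<theta> B \<psi>" using \<psi> by simp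
    obtain C \<eta> m where f: "wavelet_form \<alpha> B \<psi> C \<eta> m" "B = chart_ball \<alpha> x (absv \<pi> powi m)"
      using wavelet_on_form[OF on B x \<alpha>] .
    have "\<eta> \<in> kball 0 1" using f(1) by (simp add: wavelet_form_def in_kball_iff)
    then obtain c where "c \<in> F" "\<eta> \<in> kball c (absv \<pi>)" using F(2) by blast
    then show ?thesis unfolding freq_def using f by blast
  qed
  define g where "g \<psi> = (SOME c. freq \<psi> c)" for \<psi>
  have g: "freq \<psi> (g \<psi>)" if "\<psi> \<in> ?S" for \<psi> unfolding g_def by (rule someI_ex[OF ex[OF that]])
  have "inj_on g ?S"
  proof (rule inj_onI)
    fix \<psi> \<psi>' assume \<psi>: "\<psi> \<in> ?S" and \<psi>': "\<psi>' \<in> ?S" and eq: "g \<psi> = g \<psi>'"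
    obtain C \<eta> m where f: "wavelet_form \<alpha> B \<psi> C \<eta> m" "B = chart_ball \<alpha> x (absv \<pi> powi m)"
        "\<eta> \<in> kball (g \<psi>) (absv \<pi>)"
      using g[OF \<psi>] unfolding freq_def by blast
    obtain C' \<eta>' m' where f': "wavelet_form \<alpha> B \<psi>' C' \<eta>' m'" "B = chart_ball \<alpha> x (absv \<pi> powi m')"
        "\<eta>' \<in> kball (g \<psi>) (absv \<pi>)"
      using g[OF \<psi>'] eq unfolding freq_def by metis
    have m: "m' = m" by (rule wavelet_form_level[OF \<alpha> f(1,2) f'(1,2)])
    have "\<eta>' \<in> kball \<eta> (absv \<pi>)" using f(3) f'(3) kball_recentre by blast
    then have "absv ((\<eta>' - \<eta>) $ i) \<le> absv \<pi>" for i by (simp add: in_kball_iff)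
    then obtain c where c: "c \<noteq> 0" "\<psi>' = (\<lambda>y. c * \<psi> y)"
      using wavelet_form_proportional[OF f(1) _ f(2) x] f'(1) m by blast
    have "l2_inner \<mu> \<psi>' \<psi> = c * l2_inner \<mu> \<psi> \<psi>"
      unfolding c(2) l2_inner_def by (simp only: mult.assoc integral_mult_right_zero)
    also have "\<dots> = c" using \<Psi>(2) \<psi> by simp
    finally show "\<psi> = \<psi>'" using \<Psi>(2) \<psi> \<psi>' c(1) by (auto split: if_splits)
  qed
  moreover have "g ` ?S \<subseteq> F"
  proof (rule image_subsetI)
    fix \<psi> assume "\<psi> \<in> ?S"
    from g[OF this] show "g \<psi> \<in> F" unfolding freq_def by blast
  qed
  ultimately show ?thesis using F(1) by (rule inj_on_finite)
qed

lemma finite_orthonormal_on_mballs: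
  assumes \<Psi>: "\<Psi> \<subseteq> W" "orthonormal \<Psi>" and fin: "finite \<B>"
    and \<B>: "\<And>B. B \<in> \<B> \<Longrightarrow> \<exists>r\<le>R. mball_radius \<A> r B"
  shows "finite {\<psi> \<in> \<Psi>. \<exists>B\<in>\<B>. wavelet_on \<A> \<mu> \<pi> \<theta> B \<psi>}"
proof -
  have "finite (\<Union>B\<in>\<B>. {\<psi> \<in> \<Psi>. wavelet_on \<A> \<mu> \<pi> \<theta> B \<psi>})"
    using fin
  proof (rule finite_UN_I)
    fix B assume "B \<in> \<B>"
    then obtain r where "r \<le> R" "mball_radius \<A> r B" using \<B> by blast
    then show "finite {\<psi> \<in> \<Psi>. wavelet_on \<A> \<mu> \<pi> \<theta> B \<psi>}" by (intro finite_orthonormal_on_mball[OF \<Psi>])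
  qed
  then show ?thesis by (rule rev_finite_subset) blast
qed

text \<open>
  A test function is orthogonal to all wavelets with sufficiently small support, as it is constant
  there. So its wavelet expansion is finite, and it holds pointwise since the measure has full
  support.
\<close>

lemma test_function_expansion:
  assumes \<Psi>: "\<Psi> \<subseteq> W" "orthonormal \<Psi>" and h: "h \<in> test_functions"
    and cl: "h \<in> l2_closure \<mu> (lin_span \<Psi>)"
  obtains S c where "finite S" "S \<subseteq> \<Psi>" "h = (\<lambda>x. \<Sum>\<psi>\<in>S. c \<psi> * \<psi> x)"
proof -
  have \<Psi>_test: "\<psi> \<in> test_functions" if "\<psi> \<in> \<Psi>" for \<psi> using that \<Psi>(1) wavelet_test_function by blast
  obtain \<rho> where \<rho>: "\<rho> > 0" "\<forall>\<alpha>\<in>\<A>. \<forall>x\<in>cdom \<alpha>. \<forall>y\<in>chart_ball \<alpha> x \<rho>. h y = h x"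
    using test_functions_uniformly_constant[OF h] by blast
  define S where "S = {\<psi> \<in> \<Psi>. \<exists>B\<in>{B. \<exists>r. \<rho> \<le> r \<and> r \<le> R \<and> mball_radius \<A> r B}. wavelet_on \<A> \<mu> \<pi> \<theta> B \<psi>}"
  have "finite S"
    unfolding S_def by (rule finite_orthonormal_on_mballs[OF \<Psi> finite_mballs_above[OF \<rho>(1)]]) blast
  moreover have "S \<subseteq> \<Psi>" unfolding S_def by blast
  ultimately have S: "finite S" "S \<subseteq> \<Psi>" .
  have small: "l2_inner \<mu> h \<psi> = 0" if \<psi>: "\<psi> \<in> \<Psi>" "\<psi> \<notin> S" for \<psi>
  proof -
    have \<psi>W: "\<psi> \<in> W" using \<psi>(1) \<Psi>(1) by blast
    obtain B r x where B: "r \<le> R" "mball_radius \<A> r B" "wavelet_on \<A> \<mu> \<pi> \<theta> B \<psi>" "x \<in> B"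
      using wavelets_uptoE[OF \<psi>W] .
    have "r \<le> \<rho>"
    proof (rule ccontr)
      assume "\<not> r \<le> \<rho>"
      then have "\<rho> \<le> r" by simp
      then have "B \<in> {B. \<exists>r. \<rho> \<le> r \<and> r \<le> R \<and> mball_radius \<A> r B}" using B(1,2) by blast
      then have "\<psi> \<in> S" unfolding S_def using \<psi>(1) B(3) by blast
      then show False using \<psi>(2) by simp
    qed
    obtain \<alpha> where \<alpha>: "\<alpha> \<in> \<A>" "x \<in> cdom \<alpha>" using ex_chart by blast
    have "B \<subseteq> chart_ball \<alpha> x \<rho>"
      using small_mball_eq[OF B(2,1,4) \<alpha>] chart_ball_mono[OF \<open>r \<le> \<rho>\<close>] by blast
    then have const: "h y = h x" if "y \<in> B" for y using that \<rho>(2) \<alpha> by blast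
    have eq: "h y * cnj (\<psi> y) = h x * cnj (\<psi> y)" for y
    proof (cases "y \<in> B")
      case False
      then have "\<psi> y = 0" using B(3) unfolding wavelet_on_def by blast
      then show ?thesis by simp
    qed (simp only: const)
    have "l2_inner \<mu> h \<psi> = (\<integral>y. h x * cnj (\<psi> y) \<partial>\<mu>)"
      unfolding l2_inner_def by (rule Bochner_Integration.integral_cong[OF refl eq])
    also have "\<dots> = h x * cnj (\<integral>y. \<psi> y \<partial>\<mu>)" by simp
    finally show ?thesis using wavelet_integral_0[OF \<psi>W] by simp
  qed
  \<comment> \<open>The projection of \<open>h\<close> to the span of the wavelets with large support.\<close>
  define g where "g x = (\<Sum>\<psi>\<in>S. l2_inner \<mu> h \<psi> * \<psi> x)" for x
  define h' where "h' x = h x - g x" for x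
  have g_span: "g \<in> lin_span \<Psi>" unfolding g_def[abs_def] using S by (rule lin_spanI)
  have span_test: "u \<in> test_functions" if u: "u \<in> lin_span \<Psi>" for u
  proof -
    obtain T d where "finite T" and T: "T \<subseteq> \<Psi>" "u = (\<lambda>x. \<Sum>\<psi>\<in>T. d \<psi> * \<psi> x)"
      using lin_spanE[OF u] .
    show ?thesis
      unfolding T(2)
    proof (rule test_functions_sum)
      fix \<psi> assume "\<psi> \<in> T"
      then have "\<psi> \<in> test_functions" using T(1) \<Psi>_test by blast
      from test_functions_binop[OF this this, of "\<lambda>u v. d \<psi> * u"]
      show "(\<lambda>x. d \<psi> * \<psi> x) \<in> test_functions" .
    qed
  qed
  have g_test: "g \<in> test_functions" using span_test[OF g_span] .
  have h'_test: "h' \<in> test_functions"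
    unfolding h'_def[abs_def] using test_functions_binop[OF h g_test, of "(-)"] .
  have orth: "l2_inner \<mu> h' \<psi> = 0" if \<psi>: "\<psi> \<in> \<Psi>" for \<psi>
  proof -
    have "l2_inner \<mu> g \<psi> = (\<Sum>\<phi>\<in>S. l2_inner \<mu> h \<phi> * l2_inner \<mu> \<phi> \<psi>)"
      unfolding g_def[abs_def] using S(2) \<Psi>_test \<psi> by (intro l2_inner_sum_left) blast+
    also have "\<dots> = (\<Sum>\<phi>\<in>S. if \<phi> = \<psi> then l2_inner \<mu> h \<psi> else 0)"
    proof (rule sum.cong[OF refl])
      fix \<phi> assume "\<phi> \<in> S"
      then have "l2_inner \<mu> \<phi> \<psi> = (if \<phi> = \<psi> then 1 else 0)" using S(2) \<Psi>(2) \<psi> by blast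
      then show "l2_inner \<mu> h \<phi> * l2_inner \<mu> \<phi> \<psi> = (if \<phi> = \<psi> then l2_inner \<mu> h \<psi> else 0)" by simp
    qed
    also have "\<dots> = l2_inner \<mu> h \<psi>" using S(1) small[OF \<psi>] by simp
    finally show ?thesis
      unfolding h'_def[abs_def] using l2_inner_diff_left[OF h g_test \<Psi>_test[OF \<psi>]] by simp
  qed
  have orth_span: "l2_inner \<mu> h' u = 0" if u: "u \<in> lin_span \<Psi>" for u
  proof -
    obtain T d where "finite T" and T: "T \<subseteq> \<Psi>" "u = (\<lambda>x. \<Sum>\<psi>\<in>T. d \<psi> * \<psi> x)"
      using lin_spanE[OF u] .
    have "l2_inner \<mu> u h' = (\<Sum>\<psi>\<in>T. d \<psi> * l2_inner \<mu> \<psi> h')"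
      unfolding T(2) using T(1) \<Psi>_test h'_test by (intro l2_inner_sum_left) blast+
    also have "\<dots> = 0"
    proof (intro sum.neutral ballI)
      fix \<psi> assume "\<psi> \<in> T"
      then have "l2_inner \<mu> h' \<psi> = 0" using orth T(1) by blast
      then show "d \<psi> * l2_inner \<mu> \<psi> h' = 0" using l2_inner_commute[of \<psi> h'] by simp
    qed
    finally show ?thesis using l2_inner_commute[of h' u] by simp
  qed
  have "l2_norm \<mu> h' < \<epsilon>" if \<epsilon>: "\<epsilon> > 0" for \<epsilon>
  proof -
    obtain u where u: "u \<in> lin_span \<Psi>" "l2_norm \<mu> (\<lambda>x. h x - u x) < \<epsilon>"
      using cl \<epsilon> unfolding l2_closure_def by blast
    define v where "v x = u x + (-1) * g x" for x
    have v: "v \<in> lin_span \<Psi>" unfolding v_def[abs_def] using u(1) g_span by (rule lin_span_add_scaled)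
    note tests = h'_test span_test[OF v]
    let ?w = "\<lambda>x. h' x - v x"
    have w_eq: "?w = (\<lambda>x. h x - u x)" by (simp add: h'_def v_def)
    have w: "?w \<in> test_functions" using test_functions_binop[OF tests, of "(-)"] .
    have "l2_inner \<mu> ?w ?w = l2_inner \<mu> h' ?w - l2_inner \<mu> v ?w"
      by (rule l2_inner_diff_left[OF tests w])
    moreover have "l2_inner \<mu> ?w h' = l2_inner \<mu> h' h'" "l2_inner \<mu> ?w v = - l2_inner \<mu> v v"
      using l2_inner_diff_left[OF tests h'_test] l2_inner_diff_left[OF tests tests(2)]
        orth_span[OF v] l2_inner_commute[of v h'] by simp_all
    then have "l2_inner \<mu> h' ?w = l2_inner \<mu> h' h'" "l2_inner \<mu> v ?w = - l2_inner \<mu> v v"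
      using l2_inner_commute[of h' ?w] l2_inner_commute[of v ?w]
      by (simp_all add: l2_inner_self)
    ultimately have "l2_inner \<mu> ?w ?w = l2_inner \<mu> h' h' + l2_inner \<mu> v v" by simp
    then have "complex_of_real ((l2_norm \<mu> ?w)\<^sup>2) = complex_of_real ((l2_norm \<mu> h')\<^sup>2 + (l2_norm \<mu> v)\<^sup>2)"
      by (simp only: l2_inner_self of_real_add)
    then have "(l2_norm \<mu> ?w)\<^sup>2 = (l2_norm \<mu> h')\<^sup>2 + (l2_norm \<mu> v)\<^sup>2" by (simp only: of_real_eq_iff)
    then have "(l2_norm \<mu> h')\<^sup>2 \<le> (l2_norm \<mu> ?w)\<^sup>2" by simp
    moreover have "0 \<le> l2_norm \<mu> ?w" by (simp add: l2_norm_def)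
    ultimately have "l2_norm \<mu> h' \<le> l2_norm \<mu> ?w" by (rule power2_le_imp_le)
    then show ?thesis using u(2) w_eq by simp
  qed
  then have "l2_norm \<mu> h' \<le> 0" by (meson dense_ge less_imp_le)
  moreover have "0 \<le> l2_norm \<mu> h'" by (simp add: l2_norm_def)
  ultimately have "l2_norm \<mu> h' = 0" by simp
  then have "AE x in \<mu>. h' x = 0" by (rule l2_norm_0_imp_AE[OF test_functions_L2[OF h'_test]])
  then have "h' x = 0" for x by (rule test_functions_AE_0[OF h'_test])
  then have "h x = g x" for x using h'_def[of x] by simp
  then have "h = (\<lambda>x. \<Sum>\<psi>\<in>S. l2_inner \<mu> h \<psi> * \<psi> x)" by (simp add: fun_eq_iff g_def)
  then show ?thesis using that[of S "l2_inner \<mu> h"] S by blast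
qed

lemma finite_wavelets_with_eigenvalue:
  assumes \<Psi>: "\<Psi> \<subseteq> W" "orthonormal \<Psi>" and s: "s \<noteq> 0"
  shows "finite {\<psi> \<in> \<Psi>. wavelet_eigenvalue s \<psi> = \<kappa>}"
proof -
  let ?\<B> = "{B. \<exists>r\<le>R. mball_radius \<A> r B \<and> (\<exists>x\<in>B. eigenvalue s B x = Re \<kappa>)}"
  have "finite {\<psi> \<in> \<Psi>. \<exists>B\<in>?\<B>. wavelet_on \<A> \<mu> \<pi> \<theta> B \<psi>}"
    by (rule finite_orthonormal_on_mballs[OF \<Psi> finite_mballs_with_eigenvalue[OF s]]) blast
  moreover have "{\<psi> \<in> \<Psi>. wavelet_eigenvalue s \<psi> = \<kappa>} \<subseteq> {\<psi> \<in> \<Psi>. \<exists>B\<in>?\<B>. wavelet_on \<A> \<mu> \<pi> \<theta> B \<psi>}"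
  proof
    fix \<psi> assume "\<psi> \<in> {\<psi> \<in> \<Psi>. wavelet_eigenvalue s \<psi> = \<kappa>}"
    then have \<psi>: "\<psi> \<in> \<Psi>" "\<psi> \<in> W" "wavelet_eigenvalue s \<psi> = \<kappa>" using \<Psi>(1) by blast+
    obtain B r x where B: "r \<le> R" "mball_radius \<A> r B" "wavelet_on \<A> \<mu> \<pi> \<theta> B \<psi>" "x \<in> B"
      using wavelets_uptoE[OF \<psi>(2)] .
    have "Re \<kappa> = eigenvalue s B x"
      using wavelet_eigenvalue_eq[OF \<psi>(2) B(3,2,1,4), of s] \<psi>(3) by simp
    then have "B \<in> ?\<B>" using B by auto
    then show "\<psi> \<in> {\<psi> \<in> \<Psi>. \<exists>B\<in>?\<B>. wavelet_on \<A> \<mu> \<pi> \<theta> B \<psi>}" using \<psi>(1) B(3) by blast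
  qed
  ultimately show ?thesis by (rule rev_finite_subset)
qed

text \<open>
  Comparing coefficients in the finite expansion of an eigenfunction, which is legitimate as the
  operator acts termwise on finite sums of wavelets.
\<close>

lemma eigenspace_subset_span:
  assumes \<Psi>: "\<Psi> \<subseteq> W" "orthonormal \<Psi>" "lin_span \<Psi> = lin_span W"
  shows "eigenspace \<A> \<mu> \<pi> \<theta> R s \<kappa> \<subseteq> lin_span {\<psi> \<in> \<Psi>. wavelet_eigenvalue s \<psi> = \<kappa>}"
proof
  fix h assume "h \<in> eigenspace \<A> \<mu> \<pi> \<theta> R s \<kappa>"
  then have h: "h \<in> test_functions" "h \<in> l2_closure \<mu> (lin_span \<Psi>)"
    and ae: "AE x in \<mu>. geodetic_laplacian \<A> \<mu> s h x = \<kappa> * h x"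
    unfolding eigenspace_def L2_wavelet_def \<Psi>(3) by auto
  obtain S c where S: "finite S" "S \<subseteq> \<Psi>" and h_eq: "h = (\<lambda>x. \<Sum>\<psi>\<in>S. c \<psi> * \<psi> x)"
    using test_function_expansion[OF \<Psi>(1,2) h] .
  have SW: "S \<subseteq> W" using S(2) \<Psi>(1) by blast
  have test: "\<psi> \<in> test_functions" if "\<psi> \<in> S" for \<psi> using that SW wavelet_test_function by blast
  define d where "d \<psi> = c \<psi> * (wavelet_eigenvalue s \<psi> - \<kappa>)" for \<psi>
  define u where "u x = (\<Sum>\<psi>\<in>S. d \<psi> * \<psi> x)" for x
  have u_test: "u \<in> test_functions"
    unfolding u_def[abs_def]
  proof (rule test_functions_sum)
    fix \<psi> assume "\<psi> \<in> S"
    from test_functions_binop[OF test[OF this] test[OF this], of "\<lambda>u v. d \<psi> * u"]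
    show "(\<lambda>x. d \<psi> * \<psi> x) \<in> test_functions" .
  qed
  have u_eq: "u x = geodetic_laplacian \<A> \<mu> s h x - \<kappa> * h x" for x
  proof -
    have "geodetic_laplacian \<A> \<mu> s h x = (\<Sum>\<psi>\<in>S. c \<psi> * (wavelet_eigenvalue s \<psi> * \<psi> x))"
      unfolding h_eq by (rule laplacian_sum[OF S(1) SW])
    then have "geodetic_laplacian \<A> \<mu> s h x - \<kappa> * h x =
        (\<Sum>\<psi>\<in>S. c \<psi> * (wavelet_eigenvalue s \<psi> * \<psi> x) - \<kappa> * (c \<psi> * \<psi> x))"
      by (simp add: h_eq sum_distrib_left sum_subtractf)
    also have "\<dots> = u x"
      unfolding u_def d_def by (intro sum.cong refl) (simp add: algebra_simps)
    finally show ?thesis by simp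
  qed
  have "AE x in \<mu>. u x = 0" using ae by eventually_elim (simp add: u_eq)
  then have u0: "u x = 0" for x by (rule test_functions_AE_0[OF u_test])
  have d0: "d \<psi> = 0" if \<psi>: "\<psi> \<in> S" for \<psi>
  proof -
    have "l2_inner \<mu> u \<psi> = (\<Sum>\<phi>\<in>S. d \<phi> * l2_inner \<mu> \<phi> \<psi>)"
      unfolding u_def[abs_def] using test \<psi> by (intro l2_inner_sum_left) blast+
    also have "\<dots> = (\<Sum>\<phi>\<in>S. if \<phi> = \<psi> then d \<psi> else 0)"
    proof (rule sum.cong[OF refl])
      fix \<phi> assume "\<phi> \<in> S"
      then have "l2_inner \<mu> \<phi> \<psi> = (if \<phi> = \<psi> then 1 else 0)" using S(2) \<Psi>(2) \<psi> by blast
      then show "d \<phi> * l2_inner \<mu> \<phi> \<psi> = (if \<phi> = \<psi> then d \<psi> else 0)" by simp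
    qed
    also have "\<dots> = d \<psi>" using S(1) \<psi> by simp
    finally show ?thesis using u0 by (simp add: l2_inner_def)
  qed
  let ?S' = "{\<psi> \<in> S. wavelet_eigenvalue s \<psi> = \<kappa>}"
  have "h = (\<lambda>x. \<Sum>\<psi>\<in>?S'. c \<psi> * \<psi> x)"
    unfolding h_eq
  proof (intro ext sum.mono_neutral_right S(1) ballI)
    fix x \<psi> assume "\<psi> \<in> S - ?S'"
    then show "c \<psi> * \<psi> x = 0" using d0[of \<psi>] by (simp add: d_def)
  qed blast
  moreover have "(\<lambda>x. \<Sum>\<psi>\<in>?S'. c \<psi> * \<psi> x) \<in> lin_span {\<psi> \<in> \<Psi>. wavelet_eigenvalue s \<psi> = \<kappa>}"
    by (rule lin_spanI) (use S in auto)
  ultimately show "h \<in> lin_span {\<psi> \<in> \<Psi>. wavelet_eigenvalue s \<psi> = \<kappa>}" by (simp only:)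
qed

lemma wavelet_in_L2_wavelet:
  assumes "\<psi> \<in> W"
  shows "\<psi> \<in> L2_wavelet \<A> \<mu> \<pi> \<theta> R"
proof -
  have "l2_norm \<mu> (\<lambda>x. \<psi> x - \<psi> x) = 0" by (simp add: l2_norm_def)
  then show ?thesis
    unfolding L2_wavelet_def l2_closure_def
    using lin_span_base[OF assms] test_functions_L2[OF wavelet_test_function[OF assms]]
    by (auto intro!: bexI[of _ \<psi>])
qed

theorem wavelet_eigenbasis:
  "no_partial_overlap \<A> R \<and>
     (\<exists>\<Psi>. orthonormal_basis \<mu> (L2_wavelet \<A> \<mu> \<pi> \<theta> R) \<Psi> \<and> \<Psi> \<subseteq> W \<and>
        (\<forall>\<psi>\<in>\<Psi>. \<exists>\<kappa>. \<psi> \<in> eigenspace \<A> \<mu> \<pi> \<theta> R s \<kappa>)) \<and>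
     (s \<noteq> 0 \<longrightarrow> (\<forall>\<kappa>. \<exists>S. finite S \<and> eigenspace \<A> \<mu> \<pi> \<theta> R s \<kappa> \<subseteq> lin_span S))"
proof -
  obtain \<Psi> where \<Psi>: "\<Psi> \<subseteq> W" "orthonormal \<Psi>" "lin_span \<Psi> = lin_span W"
    using ex_orthonormal_wavelets .
  have "\<Psi> \<subseteq> L2 \<mu>" using \<Psi>(1) wavelet_test_function test_functions_L2 by blast
  then have basis: "orthonormal_basis \<mu> (L2_wavelet \<A> \<mu> \<pi> \<theta> R) \<Psi>"
    unfolding orthonormal_basis_def L2_wavelet_def using \<Psi>(2,3) by simp
  have eigen: "\<psi> \<in> eigenspace \<A> \<mu> \<pi> \<theta> R s (wavelet_eigenvalue s \<psi>)" if "\<psi> \<in> \<Psi>" for \<psi>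
  proof -
    have \<psi>: "\<psi> \<in> W" using that \<Psi>(1) by blast
    then show ?thesis
      unfolding eigenspace_def
      using wavelet_test_function wavelet_in_L2_wavelet laplacian_wavelet by simp
  qed
  have mult: "\<exists>S. finite S \<and> eigenspace \<A> \<mu> \<pi> \<theta> R s \<kappa> \<subseteq> lin_span S" if "s \<noteq> 0" for \<kappa>
    using finite_wavelets_with_eigenvalue[OF \<Psi>(1,2) that] eigenspace_subset_span[OF \<Psi>] by blast
  show ?thesis using no_partial_overlap basis \<Psi>(1) eigen mult by blast
qed

end

theorem theorem3p10:
  fixes \<A> :: "('a::t2_space, 'k::nonarch_local_field, 'n::finite) chart set"
    and \<omega> :: "('a, 'k, 'n) chart \<Rightarrow> 'k ^ 'n \<Rightarrow> 'k"
    and \<nu> :: "('k ^ 'n) measure"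
    and \<mu> :: "'a measure"
    and \<pi> :: 'k and \<theta> :: "'k \<Rightarrow> complex"
    and p :: nat and s :: real
  assumes "residue_characteristic TYPE('k) p"
    and "uniformiser \<pi>"
    and "wavelet_character \<pi> \<theta>"
    and "haar_measure \<nu>"
    and "compact (UNIV :: 'a set)"
    and "analytic_atlas \<A>"
    and "finite \<A>"
    and "equalising p \<A>"
    and "connected_nerve_graph \<A>"
    and "\<forall>\<alpha>\<in>\<A>. compact (cdom \<alpha>)"
    and "analytic_form \<A> \<omega>"
    and "nowhere_vanishing \<A> \<omega>"
    and "form_measure \<nu> \<A> \<omega> \<mu>"
  shows "\<forall>\<^sub>F R in at_right 0. no_partial_overlap \<A> R \<and>
     (\<exists>\<Psi>. orthonormal_basis \<mu> (L2_wavelet \<A> \<mu> \<pi> \<theta> R) \<Psi> \<and> \<Psi> \<subseteq> wavelets_upto \<A> \<mu> \<pi> \<theta> R \<and>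
        (\<forall>\<psi>\<in>\<Psi>. \<exists>\<kappa>. \<psi> \<in> eigenspace \<A> \<mu> \<pi> \<theta> R s \<kappa>)) \<and>
     (s \<noteq> 0 \<longrightarrow> (\<forall>\<kappa>. \<exists>S. finite S \<and> eigenspace \<A> \<mu> \<pi> \<theta> R s \<kappa> \<subseteq> lin_span S))"
proof -
  obtain R0 where R0: "fine_atlas \<A> \<omega> \<nu> \<mu> R0"
    using ex_fine_atlas[OF assms(4-7,10-13)] by blast
  then have "0 < R0" by (rule fine_atlas.R_pos)
  then have "\<forall>\<^sub>F R in at_right 0. 0 < R \<and> R \<le> R0"
    unfolding eventually_at_right_field by (intro exI[of _ R0]) auto
  then show ?thesis
  proof eventually_elim
    case (elim R)
    then have "fine_atlas \<A> \<omega> \<nu> \<mu> R" using fine_atlas_mono[OF R0] by blast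
    then interpret wavelet_atlas \<A> \<omega> \<nu> \<mu> R \<pi> \<theta>
      using assms(2,3) by (intro wavelet_atlas.intro wavelet_atlas_axioms.intro)
    show ?case by (rule wavelet_eigenbasis)
  qed
qed

end
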